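(* Let $X$ be the complex $K3$ surface with transcendental lattice $\langle 6\rangle\oplus\langle 2\rangle$. The elliptic fibration on $X$ derived from the Niemeier lattice $L=N(D_6^4)$, i.e. associated with the (unique up to $\mathrm{Aut}(L)$) primitive embedding $\phi(A_5\oplus A_1)=(i_1(A_5),d_6,0,0)$, has singular fibers of type $A_1$ ($I_2$), $D_4$ ($I_0^*$), $D_6$ ($I_2^*$), $D_6$ ($I_2^*$). Its Mordell-Weil group has rank $1$ and torsion part isomorphic to $\mathbb Z/2\mathbb Z\times\mathbb Z/2\mathbb Z$. Its Mordell-Weil lattice is generated by an infinite section (a section of infinite order) of height $\frac32$.
   Context: Root lattices are negative definite (roots have square $-2$). $d_1,\dots,d_6$ are the simple roots of $D_6$ in Bourbaki numbering: chain $d_1-d_2-d_3-d_4$, with $d_5$ and $d_6$ both joined to $d_4$. Glue vectors of $D_6$: $[0]=0$, $[1]=\frac12(d_1+2d_2+3d_3+4d_4+2d_5+3d_6)$, $[2]=d_1+d_2+d_3+d_4+\frac12(d_5+d_6)$, $[3]=\frac12(d_1+2d_2+3d_3+4d_4+3d_5+2d_6)$. The Niemeier lattice $N(D_6^4)\subset(D_6^* )^4$ is generated by $D_6^4$ and the glue vectors $[0,0,0,0],[1,1,1,1],[2,2,2,2],[3,3,3,3]$ and all even permutations of $[0,1,2,3]$. The embedding $(i_1(A_5),d_6,0,0)$ sends the consecutive simple roots of $A_5$ to $d_5,d_4,d_3,d_2,d_1$ in the first copy of $D_6$ and the simple root of $A_1$ to $d_6$ in the second copy. Kneser–Nishiyama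 correspondence: for a primitive embedding $\phi:A_5\oplus A_1\hookrightarrow L$, $W=\phi(A_5\oplus A_1)^{\perp_L}$ is the frame of an elliptic fibration (with section) on $X$, i.e. $NS(X)\simeq U\oplus W$ with $U$ generated by the fiber class and the zero section. Let $W_{\rm root}$ be the sublattice generated by vectors of square $-2$ and $\overline{W_{\rm root}}$ its primitive closure in $W$. The types of reducible fibers are given by $W_{\rm root}$; the Mordell-Weil group is $W/W_{\rm root}$, its torsion is $\overline{W_{\rm root}}/W_{\rm root}$, and the Mordell-Weil lattice is $W/\overline{W_{\rm root}}$ with the height pairing, i.e. minus the bilinear form of the orthogonal projections to $(W_{\rm root})^\perp\otimes\mathbb Q$ (Shioda's height pairing). *)

theory Defs
  imports
    "HOL-Analysis.Analysis"
    "HOL-Algebra.Elementary_Groups"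
    "HOL-Algebra.FiniteProduct"
    "HOL-Library.Multiset"
begin

section \<open>Lattices\<close>

text \<open>
  A lattice is a set \<open>L\<close> of vectors in a real vector space, with a real-valued form \<open>b\<close> on that space.
  Integer spans are those of the module structure over the integers.
\<close>

global_interpretation int_module: module "\<lambda>(k::int) (x::'v::real_vector). of_int k *\<^sub>R x"
  defines zspan = int_module.span
  by unfold_locales (simp_all add: algebra_simps)

definition integral_lattice :: "('v::real_vector \<Rightarrow> 'v \<Rightarrow> real) \<Rightarrow> 'v set \<Rightarrow> bool" where
  "integral_lattice b L \<longleftrightarrow>
     (\<forall>x. linear (b x)) \<and> (\<forall>y. linear (\<lambda>x. b x y)) \<and> (\<forall>x y. b x y = b y x) \<and>
     (\<exists>B. finite B \<and> independent B \<and> L = zspan B) \<and>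
     (\<forall>x\<in>L. \<forall>y\<in>L. b x y \<in> \<int>)"

definition even_lattice :: "('v \<Rightarrow> 'v \<Rightarrow> real) \<Rightarrow> 'v set \<Rightarrow> bool" where
  "even_lattice b L \<longleftrightarrow> (\<forall>x\<in>L. \<exists>k::int. b x x = 2 * of_int k)"

text \<open>Unimodular means equal to the dual lattice.\<close>

definition unimodular :: "('v::real_vector \<Rightarrow> 'v \<Rightarrow> real) \<Rightarrow> 'v set \<Rightarrow> bool" where
  "unimodular b L \<longleftrightarrow> {x \<in> span L. \<forall>y\<in>L. b x y \<in> \<int>} = L"

definition has_signature :: "('v::real_vector \<Rightarrow> 'v \<Rightarrow> real) \<Rightarrow> 'v set \<Rightarrow> nat \<Rightarrow> nat \<Rightarrow> bool" where
  "has_signature b L p n \<longleftrightarrow>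
     (\<exists>P N. finite P \<and> finite N \<and> card P = p \<and> card N = n \<and> P \<inter> N = {} \<and>
        independent (P \<union> N) \<and> span (P \<union> N) = span L \<and>
        (\<forall>x\<in>P \<union> N. \<forall>y\<in>P \<union> N. x \<noteq> y \<longrightarrow> b x y = 0) \<and>
        (\<forall>x\<in>P. b x x > 0) \<and> (\<forall>x\<in>N. b x x < 0))"

text \<open>For a subgroup \<open>M\<close>, the set \<open>rational_hull M\<close> is \<open>M \<otimes> \<rat>\<close> inside the ambient space.\<close>

definition rational_hull :: "'v::real_vector set \<Rightarrow> 'v set" where
  "rational_hull M = {x. \<exists>k::int. k \<noteq> 0 \<and> of_int k *\<^sub>R x \<in> M}"

definition primitive_closure :: "'v::real_vector set \<Rightarrow> 'v set \<Rightarrow> 'v set" where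
  "primitive_closure L M = L \<inter> rational_hull M"

definition primitive_sublattice :: "'v::real_vector set \<Rightarrow> 'v set \<Rightarrow> bool" where
  "primitive_sublattice L M \<longleftrightarrow> M \<subseteq> L \<and> primitive_closure L M = M"

definition orth_compl :: "('v \<Rightarrow> 'v \<Rightarrow> real) \<Rightarrow> 'v set \<Rightarrow> 'v set \<Rightarrow> 'v set" where
  "orth_compl b L M = {x \<in> L. \<forall>y\<in>M. b x y = 0}"

definition lattice_isometry ::
  "('v::real_vector \<Rightarrow> 'v \<Rightarrow> real) \<Rightarrow> 'v set \<Rightarrow> ('w::real_vector \<Rightarrow> 'w \<Rightarrow> real) \<Rightarrow> 'w set \<Rightarrow> ('v \<Rightarrow> 'w) \<Rightarrow> bool" where
  "lattice_isometry b L b' L' f \<longleftrightarrow>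
     bij_betw f L L' \<and>
     (\<forall>x\<in>L. \<forall>y\<in>L. f (x + y) = f x + f y) \<and>
     (\<forall>x\<in>L. \<forall>y\<in>L. b' (f x) (f y) = b x y)"

definition lattice_group :: "'v::real_vector set \<Rightarrow> 'v monoid" where
  "lattice_group L = \<lparr>carrier = L, monoid.mult = (+), one = 0\<rparr>"


section \<open>Root lattices\<close>

datatype dynkin = Dynkin_A nat | Dynkin_D nat | Dynkin_E nat

fun dynkin_rank :: "dynkin \<Rightarrow> nat" where
  "dynkin_rank (Dynkin_A n) = n"
| "dynkin_rank (Dynkin_D n) = n"
| "dynkin_rank (Dynkin_E n) = n"

text \<open>Edges of the Dynkin diagrams, with vertices \<open>1, \<dots>, n\<close> in Bourbaki numbering.\<close>

fun dynkin_edges :: "dynkin \<Rightarrow> (nat \<times> nat) set" where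
  "dynkin_edges (Dynkin_A n) = {(i, i + 1) |i. 1 \<le> i \<and> i + 1 \<le> n}"
| "dynkin_edges (Dynkin_D n) = {(i, i + 1) |i. 1 \<le> i \<and> i + 2 \<le> n} \<union> {(n - 2, n)}"
| "dynkin_edges (Dynkin_E n) = {(1, 3), (2, 4)} \<union> {(i, i + 1) |i. 3 \<le> i \<and> i + 1 \<le> n}"

text \<open>The Gram matrix of the simple roots, in the negative definite convention.\<close>

definition dynkin_gram :: "dynkin \<Rightarrow> nat \<Rightarrow> nat \<Rightarrow> real" where
  "dynkin_gram t i j =
     (if i = j then -2
      else if (i, j) \<in> dynkin_edges t \<or> (j, i) \<in> dynkin_edges t then 1 else 0)"

definition simple_roots :: "('v \<Rightarrow> 'v \<Rightarrow> real) \<Rightarrow> dynkin \<Rightarrow> 'v list \<Rightarrow> bool" where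
  "simple_roots b t vs \<longleftrightarrow>
     length vs = dynkin_rank t \<and>
     (\<forall>i<length vs. \<forall>j<length vs. b (vs ! i) (vs ! j) = dynkin_gram t (i + 1) (j + 1))"

text \<open>
  Images of the simple roots under an isometric embedding into \<open>L\<close> of the orthogonal direct sum of
  the root lattices of types \<open>ts\<close>. Since an embedding is determined by these images, the list of
  lists \<open>vss\<close> stands for the embedding, and \<open>zspan (set (concat vss))\<close> is its image. (Injectivity
  is automatic, because the Gram matrix is nondegenerate.)
\<close>

definition root_embedding ::
  "('v \<Rightarrow> 'v \<Rightarrow> real) \<Rightarrow> 'v set \<Rightarrow> dynkin list \<Rightarrow> 'v list list \<Rightarrow> bool" where
  "root_embedding b L ts vss \<longleftrightarrow>
     set (concat vss) \<subseteq> L \<and> list_all2 (simple_roots b) ts vss \<and>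
     (\<forall>k<length vss. \<forall>l<length vss. k \<noteq> l \<longrightarrow>
        (\<forall>x\<in>set (vss ! k). \<forall>y\<in>set (vss ! l). b x y = 0))"

definition embedding_image :: "'v::real_vector list list \<Rightarrow> 'v set" where
  "embedding_image vss = zspan (set (concat vss))"

definition primitive_root_embedding ::
  "('v::real_vector \<Rightarrow> 'v \<Rightarrow> real) \<Rightarrow> 'v set \<Rightarrow> dynkin list \<Rightarrow> 'v list list \<Rightarrow> bool" where
  "primitive_root_embedding b L ts vss \<longleftrightarrow>
     root_embedding b L ts vss \<and> primitive_sublattice L (embedding_image vss)"

definition has_root_type ::
  "('v::real_vector \<Rightarrow> 'v \<Rightarrow> real) \<Rightarrow> 'v set \<Rightarrow> dynkin multiset \<Rightarrow> bool" where
  "has_root_type b R M \<longleftrightarrow>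
     (\<exists>ts vss. mset ts = M \<and> root_embedding b R ts vss \<and> embedding_image vss = R)"

definition root_sublattice :: "('v::real_vector \<Rightarrow> 'v \<Rightarrow> real) \<Rightarrow> 'v set \<Rightarrow> 'v set" where
  "root_sublattice b W = zspan {x \<in> W. b x x = -2}"


section \<open>The Niemeier lattice of type \<open>D\<^sub>6\<^sup>4\<close>\<close>

text \<open>The sum of the four negative definite forms on the copies of \<open>D\<^sub>6 \<otimes> \<real>\<close>.\<close>

definition neg_form :: "real ^ 6 ^ 4 \<Rightarrow> real ^ 6 ^ 4 \<Rightarrow> real" where
  "neg_form x y = - (x \<bullet> y)"

text \<open>
  Simple roots of \<open>D\<^sub>6\<close> in Bourbaki's coordinates. The index types \<open>6\<close> and \<open>4\<close> are the integers
  modulo 6 and 4, so coordinate 6 is the one written \<open>0\<close> there.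
\<close>

definition d :: "nat \<Rightarrow> real ^ 6" where
  "d i = (if i = 6 then axis 5 1 + axis 6 1 else axis (of_nat i) 1 - axis (of_nat (i + 1)) 1)"

definition glue :: "nat \<Rightarrow> real ^ 6" where
  "glue i =
     (if i = 1 then (1/2) *\<^sub>R (d 1 + 2 *\<^sub>R d 2 + 3 *\<^sub>R d 3 + 4 *\<^sub>R d 4 + 2 *\<^sub>R d 5 + 3 *\<^sub>R d 6)
      else if i = 2 then d 1 + d 2 + d 3 + d 4 + (1/2) *\<^sub>R (d 5 + d 6)
      else if i = 3 then (1/2) *\<^sub>R (d 1 + 2 *\<^sub>R d 2 + 3 *\<^sub>R d 3 + 4 *\<^sub>R d 4 + 3 *\<^sub>R d 5 + 2 *\<^sub>R d 6)
      else 0)"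

definition in_copy :: "4 \<Rightarrow> real ^ 6 \<Rightarrow> real ^ 6 ^ 4" where
  "in_copy k v = axis k v"

definition glue_word :: "nat \<Rightarrow> nat \<Rightarrow> nat \<Rightarrow> nat \<Rightarrow> real ^ 6 ^ 4" where
  "glue_word p q r s =
     in_copy 1 (glue p) + in_copy 2 (glue q) + in_copy 3 (glue r) + in_copy 4 (glue s)"

definition niemeier_D6_4 :: "(real ^ 6 ^ 4) set" where
  "niemeier_D6_4 = zspan
     ({in_copy k (d i) |k i. i \<in> {1..6}} \<union>
      {glue_word 0 0 0 0, glue_word 1 1 1 1, glue_word 2 2 2 2, glue_word 3 3 3 3} \<union>
      {glue_word (p 0) (p 1) (p 2) (p 3) |p. p permutes {0..3} \<and> evenperm p})"

text \<open>The embedding \<open>(i\<^sub>1(A\<^sub>5), d\<^sub>6, 0, 0)\<close> of \<open>A\<^sub>5 \<oplus> A\<^sub>1\<close>.\<close>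

definition phi :: "(real ^ 6 ^ 4) list list" where
  "phi = [[in_copy 1 (d 5), in_copy 1 (d 4), in_copy 1 (d 3), in_copy 1 (d 2), in_copy 1 (d 1)],
          [in_copy 2 (d 6)]]"


section \<open>Elliptic fibrations on a K3 surface, through their Neron-Severi data\<close>

text \<open>
  The pair \<open>(H, b)\<close> plays the role of \<open>H\<^sup>2(X, \<int>)\<close> with the intersection form, \<open>T\<close> that of the
  transcendental lattice of \<open>X\<close>; the Neron-Severi lattice is the orthogonal complement of \<open>T\<close>.
\<close>

definition K3_lattice :: "('v::real_vector \<Rightarrow> 'v \<Rightarrow> real) \<Rightarrow> 'v set \<Rightarrow> bool" where
  "K3_lattice b H \<longleftrightarrow>
     integral_lattice b H \<and> even_lattice b H \<and> unimodular b H \<and> has_signature b H 3 19"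

definition K3_with_transcendental_6_2 ::
  "('v::real_vector \<Rightarrow> 'v \<Rightarrow> real) \<Rightarrow> 'v set \<Rightarrow> 'v set \<Rightarrow> bool" where
  "K3_with_transcendental_6_2 b H T \<longleftrightarrow>
     K3_lattice b H \<and> primitive_sublattice H T \<and>
     (\<exists>u v. T = zspan {u, v} \<and> b u u = 6 \<and> b v v = 2 \<and> b u v = 0)"

definition neron_severi :: "('v \<Rightarrow> 'v \<Rightarrow> real) \<Rightarrow> 'v set \<Rightarrow> 'v set \<Rightarrow> 'v set" where
  "neron_severi b H T = orth_compl b H T"

text \<open>
  Kodaira's fibre types; the starred ones are \<open>I\<^sub>n\<^sup>*\<close>, \<open>II\<^sup>*\<close>, \<open>III\<^sup>*\<close> and \<open>IV\<^sup>*\<close>.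
  \<open>Kod_I 0\<close> is a smooth fibre.
\<close>

datatype kodaira =
  Kod_I nat | Kod_II | Kod_III | Kod_IV
| Kod_I_star nat | Kod_II_star | Kod_III_star | Kod_IV_star

fun euler_number :: "kodaira \<Rightarrow> nat" where
  "euler_number (Kod_I n) = n"
| "euler_number Kod_II = 2"
| "euler_number Kod_III = 3"
| "euler_number Kod_IV = 4"
| "euler_number (Kod_I_star n) = n + 6"
| "euler_number Kod_IV_star = 8"
| "euler_number Kod_III_star = 9"
| "euler_number Kod_II_star = 10"

text \<open>
  The diagram of the fibre components that do not meet the zero section. The value is \<open>{#}\<close> for
  irreducible fibres.
\<close>

fun fibre_root_type :: "kodaira \<Rightarrow> dynkin multiset" where
  "fibre_root_type (Kod_I n) = (if n \<ge> 2 then {#Dynkin_A (n - 1)#} else {#})"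
| "fibre_root_type Kod_II = {#}"
| "fibre_root_type Kod_III = {#Dynkin_A 1#}"
| "fibre_root_type Kod_IV = {#Dynkin_A 2#}"
| "fibre_root_type (Kod_I_star n) = {#Dynkin_D (n + 4)#}"
| "fibre_root_type Kod_IV_star = {#Dynkin_E 6#}"
| "fibre_root_type Kod_III_star = {#Dynkin_E 7#}"
| "fibre_root_type Kod_II_star = {#Dynkin_E 8#}"

text \<open>\<open>F\<close> is the class of a fibre and \<open>Z\<close> that of the zero section; they span a copy of \<open>U\<close>.\<close>

definition frame :: "('v \<Rightarrow> 'v \<Rightarrow> real) \<Rightarrow> 'v set \<Rightarrow> 'v \<Rightarrow> 'v \<Rightarrow> 'v set" where
  "frame b NS F Z = orth_compl b NS {F, Z}"

text \<open>
  The multiset \<open>fibres\<close> lists the types of the singular fibres. It is tied to the lattice by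
  two facts: the reducible fibres are given by the root sublattice of the frame, and the Euler
  numbers of the singular fibres add up to that of a K3 surface. The second one is what separates
  fibres with the same diagram (as \<open>I\<^sub>2\<close> and \<open>III\<close>).
\<close>

definition elliptic_fibration ::
  "('v::real_vector \<Rightarrow> 'v \<Rightarrow> real) \<Rightarrow> 'v set \<Rightarrow> 'v \<Rightarrow> 'v \<Rightarrow> kodaira multiset \<Rightarrow> bool" where
  "elliptic_fibration b NS F Z fibres \<longleftrightarrow>
     F \<in> NS \<and> Z \<in> NS \<and> b F F = 0 \<and> b F Z = 1 \<and> b Z Z = -2 \<and>
     Kod_I 0 \<notin># fibres \<and>
     has_root_type b (root_sublattice b (frame b NS F Z)) (\<Sum>\<^sub># (image_mset fibre_root_type fibres)) \<and>
     (\<Sum>k\<in>#fibres. euler_number k) = 24"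

text \<open>
  The fibration derived from the embedding \<open>vss\<close> into the negative definite lattice \<open>(b', L)\<close>:
  its frame is isometric to the orthogonal complement of the image.
\<close>

definition derived_from ::
  "('v::real_vector \<Rightarrow> 'v \<Rightarrow> real) \<Rightarrow> 'v set \<Rightarrow> 'v \<Rightarrow> 'v \<Rightarrow>
   ('w::real_vector \<Rightarrow> 'w \<Rightarrow> real) \<Rightarrow> 'w set \<Rightarrow> 'w list list \<Rightarrow> bool" where
  "derived_from b NS F Z b' L vss \<longleftrightarrow>
     (\<exists>f. lattice_isometry b (frame b NS F Z) b' (orth_compl b' L (embedding_image vss)) f)"


section \<open>Mordell-Weil group and Mordell-Weil lattice of a frame\<close>

definition mordell_weil :: "('v::real_vector \<Rightarrow> 'v \<Rightarrow> real) \<Rightarrow> 'v set \<Rightarrow> 'v set monoid" where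
  "mordell_weil b W = lattice_group W Mod root_sublattice b W"

definition mordell_weil_lattice :: "('v::real_vector \<Rightarrow> 'v \<Rightarrow> real) \<Rightarrow> 'v set \<Rightarrow> 'v set monoid" where
  "mordell_weil_lattice b W = lattice_group W Mod primitive_closure W (root_sublattice b W)"

text \<open>The section and the element of the Mordell-Weil lattice represented by a vector of the frame.\<close>

definition mw_class :: "('v::real_vector \<Rightarrow> 'v \<Rightarrow> real) \<Rightarrow> 'v set \<Rightarrow> 'v \<Rightarrow> 'v set" where
  "mw_class b W w = root_sublattice b W #>\<^bsub>lattice_group W\<^esub> w"

definition mwl_class :: "('v::real_vector \<Rightarrow> 'v \<Rightarrow> real) \<Rightarrow> 'v set \<Rightarrow> 'v \<Rightarrow> 'v set" where
  "mwl_class b W w = primitive_closure W (root_sublattice b W) #>\<^bsub>lattice_group W\<^esub> w"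

text \<open>Orthogonal projection of \<open>W \<otimes> \<rat>\<close> to the orthogonal complement of its root sublattice.\<close>

definition root_orth_proj :: "('v::real_vector \<Rightarrow> 'v \<Rightarrow> real) \<Rightarrow> 'v set \<Rightarrow> 'v \<Rightarrow> 'v" where
  "root_orth_proj b W x =
     (THE y. y \<in> orth_compl b (rational_hull W) (root_sublattice b W) \<and>
             x - y \<in> rational_hull (root_sublattice b W))"

text \<open>
  The height pairing of the sections represented by two vectors of \<open>W\<close>. It depends only on their
  classes modulo the primitive closure of the root sublattice, which the projection kills.
\<close>

definition height_pairing :: "('v::real_vector \<Rightarrow> 'v \<Rightarrow> real) \<Rightarrow> 'v set \<Rightarrow> 'v \<Rightarrow> 'v \<Rightarrow> real" where
  "height_pairing b W x y = - b (root_orth_proj b W x) (root_orth_proj b W y)"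

definition torsion_elements :: "('a, 'm) monoid_scheme \<Rightarrow> 'a set" where
  "torsion_elements G = {x \<in> carrier G. \<exists>n::nat. n > 0 \<and> x [^]\<^bsub>G\<^esub> n = \<one>\<^bsub>G\<^esub>}"

text \<open>An abelian group has rank \<open>r\<close> if it has a maximal independent system of \<open>r\<close> elements.\<close>

definition has_rank :: "('a, 'm) monoid_scheme \<Rightarrow> nat \<Rightarrow> bool" where
  "has_rank G r \<longleftrightarrow>
     (\<exists>S \<subseteq> carrier G. finite S \<and> card S = r \<and>
        (\<forall>c::'a \<Rightarrow> int. (\<Otimes>\<^bsub>G\<^esub>s\<in>S. s [^]\<^bsub>G\<^esub> c s) = \<one>\<^bsub>G\<^esub> \<longrightarrow> (\<forall>s\<in>S. c s = 0)) \<and>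
        (\<forall>g\<in>carrier G. \<exists>n::nat. n > 0 \<and> g [^]\<^bsub>G\<^esub> n \<in> generate G S))"

end

(*
The roots of N(D6^4) are those of the four copies of D6, because the nonzero glue classes have norm at
least 4. A chain of roots of type A5 therefore lies in one copy, where it has the form f_i - f_(i+1) for an
orthonormal system of six signed unit vectors, and the root of A1 lies in another copy. The alternating
group on the copies is sharply 2-transitive and preserves the glue code; an odd permutation of the copies
preserves it together with an odd number of sign changes in every copy. Hence all embeddings are conjugate.

A vector of the orthogonal complement of the embedding has first component t (1, ..., 1) with t in Z/2.
The integer 2t and the parities of twice the first coordinates of the components 2 and 3 identify W/W_root
with Z x Z/2 x Z/2; a vector with t = 1/2 projects to (1/2, ..., 1/2) of norm 6/4 = 3/2.

The fibre types are read off from the root lattice because a decomposition of a definite lattice into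
indecomposable root lattices is unique. The rank, and for D4 and D6 the degeneracy of the Gram
matrix modulo 2, determine the types of the components. The Euler number excludes a fibre of type III.
*)

theory Submission
  imports Defs
begin

section \<open>Decompositions into root lattices\<close>

text \<open>The chain of type A5 determines its six axes together with their signs. Permutations and
  even sign changes of the coordinates, that is the Weyl group of D6, preserve the parity of the
  number of minus signs, so there are two Weyl orbits of such chains. They become conjugate only
  because an odd number of sign changes exchanges [1] and [3], and an odd permutation of the copies
  undoes this on the glue code. The A5 thus prescribes a parity; among the two permutations that put
  the copies of the A5 and of the A1 in their places, exactly one has it.

  The fibre types enter through the mere existence of some decomposition of the root sublattice, so
  its components have to be recognised from the lattice itself. In ranks 4 and 6 determinants modulo
  2 suffice: A4, A6 and E6 have 5, 7 and 3, whereas D4 and D6 have 4.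

  The isometry in \<open>derived_from\<close> is additive on the frame only. Everything is therefore
  computed in the concrete complement and carried back along the inverse map.\<close>

fun irreducible_type :: "dynkin \<Rightarrow> bool" where
  "irreducible_type (Dynkin_A n) \<longleftrightarrow> n \<ge> 1"
| "irreducible_type (Dynkin_D n) \<longleftrightarrow> n \<ge> 4"
| "irreducible_type (Dynkin_E n) \<longleftrightarrow> n = 6 \<or> n = 7 \<or> n = 8"

lemma irreducible_type_rank: "irreducible_type t \<Longrightarrow> dynkin_rank t \<ge> 1"
  by (cases t) auto

section \<open>Dynkin diagrams: connectedness and nondegenerate Gram matrices\<close>

lemma dynkin_gram_A:
  "dynkin_gram (Dynkin_A n) i j =
    (if i = j then -2 else if j = i + 1 \<and> 1 \<le> i \<and> j \<le> n \<or> i = j + 1 \<and> 1 \<le> j \<and> i \<le> n then 1 else 0)"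
  unfolding dynkin_gram_def dynkin_edges.simps by auto

lemma dynkin_gram_D:
  "dynkin_gram (Dynkin_D n) i j =
    (if i = j then -2
     else if j = i + 1 \<and> 1 \<le> i \<and> i + 2 \<le> n \<or> i = j + 1 \<and> 1 \<le> j \<and> j + 2 \<le> n \<or>
       i = n - 2 \<and> j = n \<or> j = n - 2 \<and> i = n then 1 else 0)"
  unfolding dynkin_gram_def dynkin_edges.simps by auto

lemma dynkin_gram_E:
  "dynkin_gram (Dynkin_E n) i j =
    (if i = j then -2
     else if i = 1 \<and> j = 3 \<or> j = 1 \<and> i = 3 \<or> i = 2 \<and> j = 4 \<or> j = 2 \<and> i = 4 \<or>
       3 \<le> i \<and> j = i + 1 \<and> j \<le> n \<or> 3 \<le> j \<and> i = j + 1 \<and> i \<le> n then 1 else 0)"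
  unfolding dynkin_gram_def dynkin_edges.simps by auto

text \<open>Connectedness of the diagram, phrased for a labelling of the vertices that is constant
  along edges. In \<open>component_subset\<close> the label of a root is the component of another
  decomposition that contains it.\<close>

lemma dynkin_connected:
  assumes t: "irreducible_type t"
    and c: "\<And>i j. i \<in> {1..dynkin_rank t} \<Longrightarrow> j \<in> {1..dynkin_rank t} \<Longrightarrow> dynkin_gram t i j = 1 \<Longrightarrow> c i = c j"
    and i: "i \<in> {1..dynkin_rank t}"
  shows "c i = c (dynkin_rank t)"
proof (cases t)
  case (Dynkin_A n)
  have adj: "c i = c (Suc i)" if "1 \<le> i" "Suc i \<le> n" for i
    using c[of i "Suc i"] that by (simp add: Dynkin_A dynkin_gram_A)
  have "i \<le> n" "1 \<le> i" using i by (simp_all add: Dynkin_A)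
  then have "c i = c n"
  proof (induction rule: inc_induct)
    case (step k)
    then show ?case using adj[of k] by simp
  qed simp
  then show ?thesis by (simp add: Dynkin_A)
next
  case (Dynkin_D n)
  define m where "m = n - 4"
  have m: "t = Dynkin_D (m + 4)" using t by (simp add: Dynkin_D m_def)
  have adj: "c i = c (Suc i)" if "1 \<le> i" "Suc i \<le> m + 3" for i
    using c[of i "Suc i"] that by (simp add: m dynkin_gram_D)
  have chain: "c j = c (m + 3)" if "1 \<le> j" "j \<le> m + 3" for j
    using that(2,1)
  proof (induction rule: inc_induct)
    case (step k)
    then show ?case using adj[of k] by simp
  qed simp
  \<comment> \<open>The last vertex is joined to the third from last and not to its predecessor; the
    chain connects that one to \<open>m + 3\<close>.\<close>
  have "c (m + 2) = c (m + 4)"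
    using c[of "m + 2" "m + 4"] by (simp add: m dynkin_gram_D)
  then have last: "c (m + 3) = c (m + 4)" using chain[of "m + 2"] by simp
  have "i = m + 4 \<or> i \<le> m + 3" "1 \<le> i" using i by (auto simp: m)
  then have "c i = c (m + 4)" using chain[of i] last by auto
  then show ?thesis by (simp add: m)
next
  case (Dynkin_E n)
  have n: "n = 6 \<or> n = 7 \<or> n = 8" using t by (simp add: Dynkin_E)
  have adj: "c i = c (Suc i)" if "3 \<le> i" "Suc i \<le> n" for i
    using c[of i "Suc i"] that by (simp add: Dynkin_E dynkin_gram_E)
  have chain: "c j = c n" if "3 \<le> j" "j \<le> n" for j
    using that(2,1)
  proof (induction rule: inc_induct)
    case (step k)
    then show ?case using adj[of k] by simp
  qed simp
  have "c 1 = c 3" "c 2 = c 4"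
    using c[of 1 3] c[of 2 4] n by (auto simp: Dynkin_E dynkin_gram_E)
  then have "c 1 = c n" "c 2 = c n" using chain[of 3] chain[of 4] n by auto
  moreover have "i = 1 \<or> i = 2 \<or> 3 \<le> i" using i by auto
  ultimately have "c i = c n" using chain[of i] i by (auto simp: Dynkin_E)
  then show ?thesis by (simp add: Dynkin_E)
qed

lemma dynkin_gram_sum_restrict:
  assumes "S \<subseteq> {1..n}" "\<And>i. i \<in> {1..n} - S \<Longrightarrow> dynkin_gram t i j = 0"
  shows "(\<Sum>i\<in>{1..n}. c i * dynkin_gram t i j) = (\<Sum>i\<in>S. c i * dynkin_gram t i j)"
  using assms by (intro sum.mono_neutral_right) auto

text \<open>Along an arm of a diagram the kernel equations of the Gram matrix say that each
  coefficient is the mean of its neighbours, which makes the coefficients an arithmetic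
  progression.\<close>

lemma linear_recurrence:
  fixes c :: "nat \<Rightarrow> real"
  assumes "c 0 = 0" "\<And>k. 1 \<le> k \<Longrightarrow> k < m \<Longrightarrow> c (k - 1) + c (k + 1) = 2 * c k" "k \<le> m"
  shows "c k = of_nat k * c 1"
  using assms(3)
proof (induction k rule: less_induct)
  case (less k)
  show ?case
  proof (cases "k \<le> 1")
    case True
    then have "k = 0 \<or> k = 1" by auto
    then show ?thesis using assms(1) by (elim disjE) simp_all
  next
    case False
    define l where "l = k - 2"
    have l: "k = Suc (Suc l)" using False by (simp add: l_def)
    have lt: "l < k" "Suc l < k" and le: "l \<le> m" "Suc l \<le> m" using less.prems l by simp_all
    note less.IH[OF lt(1) le(1)] less.IH[OF lt(2) le(2)]
    moreover have "c l + c k = 2 * c (Suc l)" using assms(2)[of "Suc l"] less.prems l by simp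
    ultimately show ?thesis by (simp add: l algebra_simps)
  qed
qed

text \<open>In types A and D a kernel vector grows linearly along an arm, and the equations at the
  far end or at the fork contradict the growth. The independence of simple roots in any ambient
  space rests on this.\<close>

lemma dynkin_gram_nondegenerate:
  fixes c :: "nat \<Rightarrow> real"
  assumes t: "irreducible_type t"
    and c: "\<And>j. j \<in> {1..dynkin_rank t} \<Longrightarrow> (\<Sum>i\<in>{1..dynkin_rank t}. c i * dynkin_gram t i j) = 0"
    and i: "i \<in> {1..dynkin_rank t}"
  shows "c i = 0"
proof (cases t)
  case (Dynkin_A n)
  \<comment> \<open>Zero values at 0 and \<open>n + 1\<close> turn the equations at the two ends
    into instances of the same recurrence.\<close>
  define e where "e k = (if k \<in> {1..n} then c k else 0)" for k
  have rec: "e (k - 1) + e (k + 1) = 2 * e k" if k: "1 \<le> k" "k < n + 1" for k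
  proof -
    define l where "l = k - 1"
    have l: "k = l + 1" using k by (simp add: l_def)
    have "(\<Sum>i\<in>{1..n}. c i * dynkin_gram t i k) =
        (\<Sum>i\<in>{l, l + 1, l + 2} \<inter> {1..n}. c i * dynkin_gram t i k)"
      by (rule dynkin_gram_sum_restrict) (auto simp: Dynkin_A dynkin_gram_A l)
    also have "\<dots> = (\<Sum>i\<in>{l, l + 1, l + 2}. e i * dynkin_gram t i k)"
      by (rule sum.mono_neutral_cong_left) (auto simp: e_def)
    also have "\<dots> = e l - 2 * e (l + 1) + e (l + 2)"
      using k by (cases "l = 0"; cases "l + 1 = n") (simp_all add: Dynkin_A dynkin_gram_A e_def l)
    finally show ?thesis using c[of k] k by (simp add: Dynkin_A l)
  qed
  have lin: "e k = of_nat k * e 1" if "k \<le> n + 1" for k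
    by (rule linear_recurrence[OF _ rec that]) (simp_all add: e_def)
  have "e 1 = 0" using lin[of "n + 1"] by (simp add: e_def)
  then have "e i = 0" using lin[of i] i by (simp add: Dynkin_A)
  then show ?thesis using i by (simp add: e_def Dynkin_A)
next
  case (Dynkin_D n)
  define m where "m = n - 4"
  have m: "t = Dynkin_D (m + 4)" using t by (simp add: Dynkin_D m_def)
  have eq: "(\<Sum>i\<in>S. c i * dynkin_gram t i j) = 0"
    if "j \<in> {1..m + 4}" "S \<subseteq> {1..m + 4}" "\<And>i. i \<in> {1..m + 4} - S \<Longrightarrow> dynkin_gram t i j = 0" for S j
    using c[of j] dynkin_gram_sum_restrict[OF that(2,3), of c] that(1) by (simp add: m)
  define e where "e k = (if k = 0 then 0 else c k)" for k
  have rec: "e (k - 1) + e (k + 1) = 2 * e k" if k: "1 \<le> k" "k < m + 2" for k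
  proof (cases "k = 1")
    case True
    have "(\<Sum>i\<in>{1, 2}. c i * dynkin_gram t i 1) = 0"
      by (intro eq) (auto simp: m dynkin_gram_D)
    then have "c 2 = 2 * c 1" by (simp add: m dynkin_gram_D)
    then show ?thesis using True by (simp add: e_def numeral_2_eq_2)
  next
    case False
    define l where "l = k - 2"
    have l: "k = l + 2" "l < m" using False k by (simp_all add: l_def)
    have "(\<Sum>i\<in>{l + 1, l + 2, l + 3}. c i * dynkin_gram t i (l + 2)) = 0"
      using l(2) by (intro eq) (auto simp: m dynkin_gram_D)
    then have "c (l + 1) - 2 * c (l + 2) + c (l + 3) = 0"
      using l(2) by (simp add: m dynkin_gram_D)
    then show ?thesis by (simp add: e_def l numeral_3_eq_3)
  qed
  have lin: "e k = of_nat k * e 1" if "k \<le> m + 2" for k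
    by (rule linear_recurrence[OF _ rec that]) (simp_all add: e_def)
  have "(\<Sum>i\<in>{m + 2, m + 3}. c i * dynkin_gram t i (m + 3)) = 0"
    by (intro eq) (auto simp: m dynkin_gram_D)
  then have 1: "c (m + 2) = 2 * c (m + 3)" by (simp add: m dynkin_gram_D)
  have "(\<Sum>i\<in>{m + 2, m + 4}. c i * dynkin_gram t i (m + 4)) = 0"
    by (intro eq) (auto simp: m dynkin_gram_D)
  then have 2: "c (m + 2) = 2 * c (m + 4)" by (simp add: m dynkin_gram_D)
  have "(\<Sum>i\<in>{m + 1, m + 2, m + 3, m + 4}. c i * dynkin_gram t i (m + 2)) = 0"
    by (intro eq) (auto simp: m dynkin_gram_D)
  then have 3: "c (m + 1) + c (m + 3) + c (m + 4) = 2 * c (m + 2)"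
    by (simp add: m dynkin_gram_D)
  have "c (m + 1) = of_nat (m + 1) * c 1" "c (m + 2) = of_nat (m + 2) * c 1"
    using lin[of "m + 1"] lin[of "m + 2"] by (simp_all add: e_def)
  \<comment> \<open>Both short arms carry half of \<open>c (m + 2)\<close>, so the equation at the
    fork leaves no growth on the long arm.\<close>
  moreover have "c (m + 1) = c (m + 2)" using 1 2 3 by linarith
  ultimately have c1: "c 1 = 0" by (simp add: algebra_simps)
  have low: "c k = 0" if "1 \<le> k" "k \<le> m + 2" for k
    using lin[of k] that c1 by (simp add: e_def)
  have "c (m + 3) = 0" "c (m + 4) = 0" using 1 2 low[of "m + 2"] by simp_all
  moreover have "i \<le> m + 2 \<or> i = m + 3 \<or> i = m + 4" "1 \<le> i" using i by (auto simp: m)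
  ultimately show ?thesis using low[of i] by auto
next
  case (Dynkin_E n)
  have n: "n = 6 \<or> n = 7 \<or> n = 8" using t by (simp add: Dynkin_E)
  have eq: "(\<Sum>i\<in>S. c i * dynkin_gram t i j) = 0"
    if "j \<in> {1..n}" "S \<subseteq> {1..n}" "\<And>i. i \<in> {1..n} - S \<Longrightarrow> dynkin_gram t i j = 0" for S j
    using c[of j] dynkin_gram_sum_restrict[OF that(2,3), of c] that(1) by (simp add: Dynkin_E)
  note E = Dynkin_E dynkin_gram_E
  have n6: "6 \<le> n" using n by auto
  have "(\<Sum>i\<in>{1, 3}. c i * dynkin_gram t i 1) = 0"
    using n6 by (intro eq) (auto simp: E)
  then have low1: "c 3 = 2 * c 1" using n6 by (simp add: E)
  have "(\<Sum>i\<in>{2, 4}. c i * dynkin_gram t i 2) = 0"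
    using n6 by (intro eq) (auto simp: E)
  then have low2: "c 4 = 2 * c 2" using n6 by (simp add: E)
  have "(\<Sum>i\<in>{1, 3, 4}. c i * dynkin_gram t i 3) = 0"
    using n6 by (intro eq) (auto simp: E)
  then have low3: "c 1 + c 4 = 2 * c 3" using n6 by (simp add: E)
  have "(\<Sum>i\<in>{2, 3, 4, 5}. c i * dynkin_gram t i 4) = 0"
    using n6 by (intro eq) (auto simp: E)
  then have low4: "c 2 + c 3 + c 5 = 2 * c 4" using n6 by (simp add: E)
  have "(\<Sum>i\<in>{4, 5, 6}. c i * dynkin_gram t i 5) = 0"
    using n6 by (intro eq) (auto simp: E)
  then have low5: "c 4 + c 6 = 2 * c 5" using n6 by (simp add: E)
  \<comment> \<open>These five rows make the first six coefficients proportional to 2, 3, 4, 6, 5,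
    4, as in the highest root of E8. The remaining rows, which depend on \<open>n\<close>, admit no
    nonzero multiple.\<close>
  note low = low1 low2 low3 low4 low5
  consider "n = 6" | "n = 7" | "n = 8" using n by blast
  then have "\<forall>k\<in>{1..n}. c k = 0"
  proof cases
    case 1
    have "(\<Sum>i\<in>{5, 6}. c i * dynkin_gram t i 6) = 0" by (intro eq; auto simp: E 1)
    then have "c 5 = 2 * c 6" by (simp add: E 1)
    then have "c 1 = 0" "c 2 = 0" "c 3 = 0" "c 4 = 0" "c 5 = 0" "c 6 = 0" using low by linarith+
    moreover have "k \<in> {1, 2, 3, 4, 5, 6}" if "k \<in> {1..n}" for k using that by (auto simp: 1)
    ultimately show ?thesis by blast
  next
    case 2
    have "(\<Sum>i\<in>{5, 6, 7}. c i * dynkin_gram t i 6) = 0" "(\<Sum>i\<in>{6, 7}. c i * dynkin_gram t i 7) = 0"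
      by (intro eq; auto simp: E 2)+
    then have "c 5 + c 7 = 2 * c 6" "c 6 = 2 * c 7" by (simp_all add: E 2)
    then have "c 1 = 0" "c 2 = 0" "c 3 = 0" "c 4 = 0" "c 5 = 0" "c 6 = 0" "c 7 = 0" using low by linarith+
    moreover have "k \<in> {1, 2, 3, 4, 5, 6, 7}" if "k \<in> {1..n}" for k using that by (auto simp: 2)
    ultimately show ?thesis by blast
  next
    case 3
    have "(\<Sum>i\<in>{5, 6, 7}. c i * dynkin_gram t i 6) = 0" "(\<Sum>i\<in>{6, 7, 8}. c i * dynkin_gram t i 7) = 0"
      "(\<Sum>i\<in>{7, 8}. c i * dynkin_gram t i 8) = 0"
      by (intro eq; auto simp: E 3)+
    then have "c 5 + c 7 = 2 * c 6" "c 6 + c 8 = 2 * c 7" "c 7 = 2 * c 8" by (simp_all add: E 3)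
    then have "c 1 = 0" "c 2 = 0" "c 3 = 0" "c 4 = 0" "c 5 = 0" "c 6 = 0" "c 7 = 0" "c 8 = 0"
      using low by linarith+
    moreover have "k \<in> {1, 2, 3, 4, 5, 6, 7, 8}" if "k \<in> {1..n}" for k using that by (auto simp: 3)
    ultimately show ?thesis by blast
  qed
  then show ?thesis using i by (simp add: Dynkin_E)
qed

section \<open>Simple roots in a space with a symmetric form\<close>

locale symmetric_form =
  fixes b :: "'v::real_vector \<Rightarrow> 'v \<Rightarrow> real"
  assumes linear_b: "\<And>x. linear (b x)" and sym: "\<And>x y. b x y = b y x"
begin

lemma add_right: "b x (y + z) = b x y + b x z" and scale_right: "b x (c *\<^sub>R y) = c * b x y"
  and zero_right: "b x 0 = 0" and diff_right: "b x (y - z) = b x y - b x z"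
  and sum_right: "b x (sum f A) = (\<Sum>i\<in>A. b x (f i))"
  using linear_b[of x] by (simp_all add: linear_add linear_scale linear_0 linear_diff linear_sum)

lemma add_left: "b (y + z) x = b y x + b z x" and scale_left: "b (c *\<^sub>R y) x = c * b y x"
  and zero_left: "b 0 x = 0" and diff_left: "b (y - z) x = b y x - b z x"
  and sum_left: "b (sum f A) x = (\<Sum>i\<in>A. b (f i) x)"
  by (simp_all only: sym[of _ x] add_right scale_right zero_right diff_right sum_right)

lemma orth_zspan:
  assumes "\<And>x y. x \<in> A \<Longrightarrow> y \<in> B \<Longrightarrow> b x y = 0" "x \<in> zspan A" "y \<in> zspan B"
  shows "b x y = 0"
  using assms(2)
proof (induction rule: int_module.span_induct_alt)
  case (step c u v)
  have "b u y = 0" using assms(3)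
  proof (induction rule: int_module.span_induct_alt)
    case (step c' u' v')
    then show ?case using assms(1)[OF \<open>u \<in> A\<close>] by (simp add: add_right scale_right)
  qed (simp add: zero_right)
  then show ?case using step by (simp add: add_left scale_left)
qed (simp add: zero_left)

lemma simple_roots_inner:
  assumes "simple_roots b t vs" "i < length vs" "j < length vs"
  shows "b (vs ! i) (vs ! j) = dynkin_gram t (i + 1) (j + 1)"
  using assms by (simp add: simple_roots_def)

text \<open>Pairing a relation with each simple root yields a kernel vector of the Gram matrix. The
  coefficients belong to positions in the list, so repeated entries are excluded as well.\<close>

lemma simple_roots_lin_indep:
  assumes vs: "simple_roots b t vs" and t: "irreducible_type t"
    and c: "(\<Sum>i<length vs. c i *\<^sub>R vs ! i) = 0" and i: "i < length vs"
  shows "c i = (0::real)"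
proof -
  have len: "length vs = dynkin_rank t" using vs by (simp add: simple_roots_def)
  define e where "e k = c (k - 1)" for k
  have "(\<Sum>k\<in>{1..dynkin_rank t}. e k * dynkin_gram t k j) = 0" if j: "j \<in> {1..dynkin_rank t}" for j
  proof -
    have "(\<Sum>k\<in>{1..dynkin_rank t}. e k * dynkin_gram t k j) =
        (\<Sum>k<dynkin_rank t. c k * dynkin_gram t (k + 1) j)"
      by (rule sum.reindex_bij_witness[of _ "\<lambda>k. k + 1" "\<lambda>k. k - 1"]) (auto simp: e_def)
    also have "\<dots> = (\<Sum>k<length vs. c k * b (vs ! k) (vs ! (j - 1)))"
      using j by (intro sum.cong) (auto simp: len simple_roots_inner[OF vs])
    also have "\<dots> = b (\<Sum>k<length vs. c k *\<^sub>R vs ! k) (vs ! (j - 1))"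
      by (simp add: sum_left scale_left)
    finally show ?thesis by (simp add: c zero_left)
  qed
  then have "e (i + 1) = 0" by (rule dynkin_gram_nondegenerate[OF t]) (use i len in auto)
  then show ?thesis by (simp add: e_def)
qed

lemma simple_roots_basis:
  assumes vs: "simple_roots b t vs" and t: "irreducible_type t"
  shows "distinct vs" "independent (set vs)"
proof -
  note indep = simple_roots_lin_indep[OF vs t]
  show dist: "distinct vs"
  proof (rule ccontr)
    assume "\<not> distinct vs"
    then obtain i j where ij: "i < length vs" "j < length vs" "i \<noteq> j" "vs ! i = vs ! j"
      by (auto simp: distinct_conv_nth)
    \<comment> \<open>Equal entries at \<open>i\<close> and \<open>j\<close> would give the relation
      with coefficients 1 and -1.\<close>
    let ?c = "\<lambda>k. (if k = i then 1 else 0) - (if k = j then 1 else 0 :: real)"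
    have "(\<Sum>k<length vs. ?c k *\<^sub>R vs ! k) =
      (\<Sum>k<length vs. if k = i then vs ! k else 0) - (\<Sum>k<length vs. if k = j then vs ! k else 0)"
      unfolding sum_subtractf[symmetric] by (intro sum.cong) auto
    also have "\<dots> = 0" using ij by simp
    finally have "?c i = 0" by (rule indep) (rule ij(1))
    then show False using ij(3) by simp
  qed
  show "independent (set vs)"
  proof
    assume "dependent (set vs)"
    then obtain u where u: "(\<Sum>v\<in>set vs. u v *\<^sub>R v) = 0" "\<exists>v\<in>set vs. u v \<noteq> 0"
      by (auto simp: dependent_finite)
    have "(\<Sum>v\<in>set vs. u v *\<^sub>R v) = (\<Sum>k<length vs. u (vs ! k) *\<^sub>R vs ! k)"
      by (rule sum.reindex_bij_betw[OF bij_betw_nth[OF dist], symmetric]) auto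
    then have "u (vs ! k) = 0" if "k < length vs" for k
      using indep[of "\<lambda>k. u (vs ! k)" k] u(1) that by simp
    then show False using u(2) by (auto simp: in_set_conv_nth)
  qed
qed

lemma span_zspan: "span (zspan A) = span A"
proof
  have "zspan A \<subseteq> span A"
    by (rule int_module.span_minimal) (auto intro: span_base int_module.subspaceI span_zero span_add span_scale)
  then show "span (zspan A) \<subseteq> span A" by (simp add: span_minimal)
  show "span A \<subseteq> span (zspan A)" by (intro span_mono int_module.span_superset)
qed

text \<open>The rank is the dimension of the real span, which the lattice determines.\<close>

lemma simple_roots_rank:
  assumes "simple_roots b t vs" "irreducible_type t" "simple_roots b t' vs'" "irreducible_type t'"
    "zspan (set vs) = zspan (set vs')"
  shows "dynkin_rank t = dynkin_rank t'"
proof -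
  have "span (set vs) = span (set vs')" using assms(5) span_zspan by metis
  then have "card (set vs) = card (set vs')"
    using dim_span_eq_card_independent[OF simple_roots_basis(2)[OF assms(1,2)]]
      dim_span_eq_card_independent[OF simple_roots_basis(2)[OF assms(3,4)]] by simp
  then show ?thesis
    using simple_roots_basis(1)[OF assms(1,2)] simple_roots_basis(1)[OF assms(3,4)] assms(1,3)
    by (simp add: distinct_card simple_roots_def)
qed

lemma zspan_nth:
  assumes "x \<in> zspan (set vs)"
  obtains c :: "nat \<Rightarrow> int" where "x = (\<Sum>i<length vs. of_int (c i) *\<^sub>R vs ! i)"
proof -
  have "\<exists>c :: nat \<Rightarrow> int. x = (\<Sum>i<length vs. of_int (c i) *\<^sub>R vs ! i)"
    using assms
  proof (induction rule: int_module.span_induct_alt)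
    case base
    show ?case by (intro exI[of _ "\<lambda>_. 0"]) simp
  next
    case (step k u v)
    then obtain c :: "nat \<Rightarrow> int" where c: "v = (\<Sum>i<length vs. of_int (c i) *\<^sub>R vs ! i)" by blast
    obtain j where j: "j < length vs" "u = vs ! j" using step(1) by (auto simp: in_set_conv_nth)
    have "(\<Sum>i<length vs. of_int ((if i = j then k else 0) + c i) *\<^sub>R vs ! i) =
      (\<Sum>i<length vs. if i = j then of_int k *\<^sub>R vs ! i else 0) + v"
      unfolding c sum.distrib[symmetric] by (intro sum.cong) (auto simp: scaleR_left_distrib)
    then have "of_int k *\<^sub>R u + v = (\<Sum>i<length vs. of_int ((if i = j then k else 0) + c i) *\<^sub>R vs ! i)"
      using j by simp
    then show ?case by (rule exI[of _ "\<lambda>i. (if i = j then k else 0) + c i"])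
  qed
  then show ?thesis using that by blast
qed

text \<open>
  In a lattice of type \<open>D\<^sub>n\<close> the difference of the last two simple roots has even products with all
  vectors, without being divisible by 2. This cannot happen when the Gram matrix is invertible modulo 2.
\<close>

lemma D_radical_mod_2:
  assumes vs: "simple_roots b (Dynkin_D n) vs" and n: "n \<ge> 4"
  defines "z \<equiv> vs ! (n - 2) - vs ! (n - 1)"
  shows "z \<in> zspan (set vs)" "b z z = -4" "y \<in> zspan (set vs) \<Longrightarrow> \<exists>m::int. b z y = 2 * of_int m"
proof -
  have len: "length vs = n" using vs by (simp add: simple_roots_def)
  then show z: "z \<in> zspan (set vs)"
    unfolding z_def using n by (intro int_module.span_diff int_module.span_base nth_mem) auto
  define k where "k = n - 4"
  have k: "n = k + 4" using n by (simp add: k_def)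
  have inner: "b (vs ! i) (vs ! j) = dynkin_gram (Dynkin_D (k + 4)) (i + 1) (j + 1)" if "i < k + 4" "j < k + 4" for i j
    using simple_roots_inner[OF vs] that len by (simp add: k)
  have zk: "z = vs ! (k + 2) - vs ! (k + 3)" by (simp add: z_def k numeral_eq_Suc)
  show "b z z = -4"
    unfolding zk by (simp add: diff_left diff_right inner dynkin_gram_D)
  have even: "\<exists>m::int. b z (vs ! j) = 2 * of_int m" if j: "j < k + 4" for j
  proof -
    have "b z (vs ! j) = (if j = k + 2 then -2 else if j = k + 3 then 2 else 0)"
      unfolding zk using j by (simp add: diff_left inner dynkin_gram_D)
    then show ?thesis by (auto intro: exI[of _ "-1"] exI[of _ 1] exI[of _ 0])
  qed
  show "\<exists>m::int. b z y = 2 * of_int m" if "y \<in> zspan (set vs)"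
    using that
  proof (induction rule: int_module.span_induct_alt)
    case base
    show ?case by (intro exI[of _ 0]) (simp add: zero_right)
  next
    case (step c u v)
    then obtain j where "j < k + 4" "u = vs ! j" using len k by (auto simp: in_set_conv_nth)
    then obtain m1 m2 :: int where "b z u = 2 * of_int m1" "b z v = 2 * of_int m2"
      using even step(2) by blast
    then have "b z (of_int c *\<^sub>R u + v) = 2 * of_int (c * m1 + m2)"
      by (simp add: add_right scale_right algebra_simps)
    then show ?case by blast
  qed
qed

text \<open>Half of \<open>z\<close> would be a lattice vector of norm -1, impossible in an even
  lattice. Applied to the vector of \<open>D_radical_mod_2\<close>, this excludes every basis whose
  Gram matrix has odd determinant.\<close>

lemma even_combination:
  assumes z: "z = (\<Sum>i<length vs. of_int (c i) *\<^sub>R vs ! i)" "b z z = -4"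
    and even: "\<And>y. y \<in> zspan (set vs) \<Longrightarrow> \<exists>m::int. b y y = 2 * of_int m"
    and c: "\<And>i. i < length vs \<Longrightarrow> even (c i)"
  shows False
proof -
  define y where "y = (\<Sum>i<length vs. of_int (c i div 2) *\<^sub>R vs ! i)"
  have "of_int (c i) = 2 * (of_int (c i div 2) :: real)" if "i < length vs" for i
    using c[OF that] by (metis dvd_mult_div_cancel of_int_mult of_int_numeral)
  then have "z = 2 *\<^sub>R y"
    unfolding z y_def scaleR_sum_right by (intro sum.cong) simp_all
  then have "b y y = -1" using z(2) by (simp add: scale_left scale_right)
  moreover have "y \<in> zspan (set vs)"
    unfolding y_def by (intro int_module.span_sum int_module.span_scale int_module.span_base) simp
  then obtain m :: int where "b y y = 2 * of_int m" using even by blast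
  ultimately have "real_of_int (2 * m) = of_int (-1)" by simp
  then have "2 * m = -1" by (simp only: of_int_eq_iff)
  then show False by presburger
qed

text \<open>The rank leaves only A4 beside D4, and A6 and E6 beside D6. Their determinants 5, 7 and
  3 (up to sign) are odd, so the even products of \<open>z\<close> with the simple roots force even
  coefficients. In odd rank this can fail: A5 has determinant 6.\<close>

lemma simple_roots_type_D:
  assumes vs: "simple_roots b t vs" and t: "irreducible_type t"
    and vs': "simple_roots b (Dynkin_D n) vs'" and n: "n = 4 \<or> n = 6"
    and eq: "zspan (set vs) = zspan (set vs')"
    and even: "\<And>y. y \<in> zspan (set vs) \<Longrightarrow> \<exists>m::int. b y y = 2 * of_int m"
  shows "t = Dynkin_D n"
proof -
  have n4: "n \<ge> 4" using n by auto
  have rank: "dynkin_rank t = n"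
    using simple_roots_rank[OF vs t vs' _ eq] n by auto
  then have len: "length vs = n" using vs by (simp add: simple_roots_def)
  define z where "z = vs' ! (n - 2) - vs' ! (n - 1)"
  note z = D_radical_mod_2[OF vs' n4, folded z_def eq]
  obtain c :: "nat \<Rightarrow> int" where c: "z = (\<Sum>i<length vs. of_int (c i) *\<^sub>R vs ! i)"
    using zspan_nth[OF z(1)] .
  obtain m :: "nat \<Rightarrow> int" where m: "\<And>j. j < n \<Longrightarrow> b z (vs ! j) = 2 * of_int (m j)"
  proof -
    have "\<forall>j. \<exists>m::int. j < n \<longrightarrow> b z (vs ! j) = 2 * of_int m"
      using z(3) len by (metis int_module.span_base nth_mem)
    then show ?thesis using that by metis
  qed
  have gram: "(\<Sum>i<n. of_int (c i) * dynkin_gram t (i + 1) (j + 1)) = 2 * of_int (m j)" if "j < n" for j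
  proof -
    have "b z (vs ! j) = (\<Sum>i<n. of_int (c i) * b (vs ! i) (vs ! j))"
      by (simp add: c sum_left scale_left len)
    then show ?thesis using m[OF that] that simple_roots_inner[OF vs] len by simp
  qed
  have contra: False if "\<And>i. i < n \<Longrightarrow> even (c i)"
    using even_combination[OF c z(2) even] that len by blast
  consider "t = Dynkin_D n" | "n = 4" "t = Dynkin_A 4" | "n = 6" "t = Dynkin_A 6" | "n = 6" "t = Dynkin_E 6"
    using rank t n by (cases t) auto
  then show ?thesis
  proof cases
    case 2
    have bound: "{..<n} = {0, 1, 2, 3}" using 2 by auto
    have "real_of_int (c 1) = of_int (2 * c 0 + 2 * m 0)"
      using gram[of 0] unfolding bound 2(2) by (simp add: 2(1) dynkin_gram_A)
    then have e0: "c 1 = 2 * c 0 + 2 * m 0" by (simp only: of_int_eq_iff)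
    have "real_of_int (c 0 + c 2) = of_int (2 * c 1 + 2 * m 1)"
      using gram[of 1] unfolding bound 2(2) by (simp add: 2(1) dynkin_gram_A)
    then have e1: "c 0 + c 2 = 2 * c 1 + 2 * m 1" by (simp only: of_int_eq_iff)
    have "real_of_int (c 1 + c 3) = of_int (2 * c 2 + 2 * m 2)"
      using gram[of 2] unfolding bound 2(2) by (simp add: 2(1) dynkin_gram_A)
    then have e2: "c 1 + c 3 = 2 * c 2 + 2 * m 2" by (simp only: of_int_eq_iff)
    have "real_of_int (c 2) = of_int (2 * c 3 + 2 * m 3)"
      using gram[of 3] unfolding bound 2(2) by (simp add: 2(1) dynkin_gram_A)
    then have e3: "c 2 = 2 * c 3 + 2 * m 3" by (simp only: of_int_eq_iff)
    \<comment> \<open>Elimination modulo 2: the end equations give \<open>c 1\<close> and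
      \<open>c 2\<close>, the inner ones then \<open>c 0\<close> and \<open>c 3\<close>.\<close>
    have "even (c 0)" "even (c 1)" "even (c 2)" "even (c 3)"
      using e0 e1 e2 e3 by presburger+
    then have "even (c i)" if "i < n" for i
      using that bound by (metis (no_types, lifting) insert_iff lessThan_iff empty_iff)
    then show ?thesis using contra by blast
  next
    case 3
    have bound: "{..<n} = {0, 1, 2, 3, 4, 5}" using 3 by auto
    have "real_of_int (c 1) = of_int (2 * c 0 + 2 * m 0)"
      using gram[of 0] unfolding bound 3(2) by (simp add: 3(1) dynkin_gram_A)
    then have e0: "c 1 = 2 * c 0 + 2 * m 0" by (simp only: of_int_eq_iff)
    have "real_of_int (c 0 + c 2) = of_int (2 * c 1 + 2 * m 1)"
      using gram[of 1] unfolding bound 3(2) by (simp add: 3(1) dynkin_gram_A)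
    then have e1: "c 0 + c 2 = 2 * c 1 + 2 * m 1" by (simp only: of_int_eq_iff)
    have "real_of_int (c 1 + c 3) = of_int (2 * c 2 + 2 * m 2)"
      using gram[of 2] unfolding bound 3(2) by (simp add: 3(1) dynkin_gram_A)
    then have e2: "c 1 + c 3 = 2 * c 2 + 2 * m 2" by (simp only: of_int_eq_iff)
    have "real_of_int (c 2 + c 4) = of_int (2 * c 3 + 2 * m 3)"
      using gram[of 3] unfolding bound 3(2) by (simp add: 3(1) dynkin_gram_A)
    then have e3: "c 2 + c 4 = 2 * c 3 + 2 * m 3" by (simp only: of_int_eq_iff)
    have "real_of_int (c 3 + c 5) = of_int (2 * c 4 + 2 * m 4)"
      using gram[of 4] unfolding bound 3(2) by (simp add: 3(1) dynkin_gram_A)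
    then have e4: "c 3 + c 5 = 2 * c 4 + 2 * m 4" by (simp only: of_int_eq_iff)
    have "real_of_int (c 4) = of_int (2 * c 5 + 2 * m 5)"
      using gram[of 5] unfolding bound 3(2) by (simp add: 3(1) dynkin_gram_A)
    then have e5: "c 4 = 2 * c 5 + 2 * m 5" by (simp only: of_int_eq_iff)
    have "even (c 0)" "even (c 1)" "even (c 2)" "even (c 3)" "even (c 4)" "even (c 5)"
      using e0 e1 e2 e3 e4 e5 by presburger+
    then have "even (c i)" if "i < n" for i
      using that bound by (metis (no_types, lifting) insert_iff lessThan_iff empty_iff)
    then show ?thesis using contra by blast
  next
    case 4
    have bound: "{..<n} = {0, 1, 2, 3, 4, 5}" using 4 by auto
    have "real_of_int (c 2) = of_int (2 * c 0 + 2 * m 0)"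
      using gram[of 0] unfolding bound 4(2) by (simp add: 4(1) dynkin_gram_E)
    then have e0: "c 2 = 2 * c 0 + 2 * m 0" by (simp only: of_int_eq_iff)
    have "real_of_int (c 3) = of_int (2 * c 1 + 2 * m 1)"
      using gram[of 1] unfolding bound 4(2) by (simp add: 4(1) dynkin_gram_E)
    then have e1: "c 3 = 2 * c 1 + 2 * m 1" by (simp only: of_int_eq_iff)
    have "real_of_int (c 0 + c 3) = of_int (2 * c 2 + 2 * m 2)"
      using gram[of 2] unfolding bound 4(2) by (simp add: 4(1) dynkin_gram_E)
    then have e2: "c 0 + c 3 = 2 * c 2 + 2 * m 2" by (simp only: of_int_eq_iff)
    have "real_of_int (c 1 + c 2 + c 4) = of_int (2 * c 3 + 2 * m 3)"
      using gram[of 3] unfolding bound 4(2) by (simp add: 4(1) dynkin_gram_E)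
    then have e3: "c 1 + c 2 + c 4 = 2 * c 3 + 2 * m 3" by (simp only: of_int_eq_iff)
    have "real_of_int (c 3 + c 5) = of_int (2 * c 4 + 2 * m 4)"
      using gram[of 4] unfolding bound 4(2) by (simp add: 4(1) dynkin_gram_E)
    then have e4: "c 3 + c 5 = 2 * c 4 + 2 * m 4" by (simp only: of_int_eq_iff)
    have "real_of_int (c 4) = of_int (2 * c 5 + 2 * m 5)"
      using gram[of 5] unfolding bound 4(2) by (simp add: 4(1) dynkin_gram_E)
    then have e5: "c 4 = 2 * c 5 + 2 * m 5" by (simp only: of_int_eq_iff)
    \<comment> \<open>The ends of the three arms give \<open>c 2\<close>, \<open>c 3\<close> and
      \<open>c 4\<close>; the other rows then give the remaining coefficients.\<close>
    have "even (c 0)" "even (c 1)" "even (c 2)" "even (c 3)" "even (c 4)" "even (c 5)"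
      using e0 e1 e2 e3 e4 e5 by presburger+
    then have "even (c i)" if "i < n" for i
      using that bound by (metis (no_types, lifting) insert_iff lessThan_iff empty_iff)
    then show ?thesis using contra by blast
  qed
qed

end

section \<open>Uniqueness of the decomposition of a definite even lattice\<close>

locale definite_lattice = symmetric_form b for b :: "'v::real_vector \<Rightarrow> 'v \<Rightarrow> real" +
  fixes R :: "'v set"
  assumes subspace_R: "int_module.subspace R"
    and nonpos: "\<And>x. x \<in> R \<Longrightarrow> b x x \<le> 0"
    and definite: "\<And>x. x \<in> R \<Longrightarrow> b x x = 0 \<Longrightarrow> x = 0"
    and even_norm: "\<And>x. x \<in> R \<Longrightarrow> \<exists>m::int. b x x = 2 * of_int m"
begin

text \<open>Without \<open>irreducible_type\<close> the list of types would not be determined: A_0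
  can be inserted at will, and D_3 coincides with A_3.\<close>

definition root_decomposition :: "dynkin list \<Rightarrow> 'v list list \<Rightarrow> bool" where
  "root_decomposition ts vss \<longleftrightarrow>
    root_embedding b R ts vss \<and> embedding_image vss = R \<and> (\<forall>t\<in>set ts. irreducible_type t)"

abbreviation component :: "'v list list \<Rightarrow> nat \<Rightarrow> 'v set" where
  "component vss i \<equiv> zspan (set (vss ! i))"

lemma root_decompositionD:
  assumes "root_decomposition ts vss"
  shows "length vss = length ts"
    "\<And>i. i < length ts \<Longrightarrow> simple_roots b (ts ! i) (vss ! i)"
    "\<And>i. i < length ts \<Longrightarrow> irreducible_type (ts ! i)"
    "\<And>i. i < length ts \<Longrightarrow> set (vss ! i) \<subseteq> R"
    "\<And>i. i < length ts \<Longrightarrow> component vss i \<subseteq> R"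
    "\<And>i j x y. i < length ts \<Longrightarrow> j < length ts \<Longrightarrow> i \<noteq> j \<Longrightarrow> x \<in> component vss i \<Longrightarrow> y \<in> component vss j \<Longrightarrow> b x y = 0"
    "zspan (set (concat vss)) = R"
proof -
  have emb: "set (concat vss) \<subseteq> R" "list_all2 (simple_roots b) ts vss"
    "\<And>k l x y. k < length vss \<Longrightarrow> l < length vss \<Longrightarrow> k \<noteq> l \<Longrightarrow> x \<in> set (vss ! k) \<Longrightarrow> y \<in> set (vss ! l) \<Longrightarrow> b x y = 0"
    using assms unfolding root_decomposition_def root_embedding_def by blast+
  show len: "length vss = length ts" using emb(2) by (simp add: list_all2_lengthD)
  show "simple_roots b (ts ! i) (vss ! i)" if "i < length ts" for i
    using emb(2) that by (rule list_all2_nthD)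
  show "irreducible_type (ts ! i)" if "i < length ts" for i
    using assms that by (simp add: root_decomposition_def)
  show sub: "set (vss ! i) \<subseteq> R" if "i < length ts" for i
  proof -
    have "vss ! i \<in> set vss" using that len by simp
    then have "set (vss ! i) \<subseteq> set (concat vss)" by auto
    then show ?thesis using emb(1) by (rule subset_trans)
  qed
  show "component vss i \<subseteq> R" if "i < length ts" for i
    using sub[OF that] subspace_R by (rule int_module.span_minimal)
  show "b x y = 0" if "i < length ts" "j < length ts" "i \<noteq> j" "x \<in> component vss i" "y \<in> component vss j" for i j x y
    by (rule orth_zspan[OF emb(3)[of i j] that(4,5)]) (use that len in simp_all)
  show "zspan (set (concat vss)) = R"
    using assms by (simp add: root_decomposition_def embedding_image_def)
qed

lemma decompose:
  assumes D: "root_decomposition ts vss" and x: "x \<in> R"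
  obtains y where "\<And>i. i < length ts \<Longrightarrow> y i \<in> component vss i" "x = (\<Sum>i<length ts. y i)"
proof -
  note D' = root_decompositionD[OF D]
  have "x \<in> zspan (set (concat vss))" using x D'(7) by simp
  then have "\<exists>y. (\<forall>i<length ts. y i \<in> component vss i) \<and> x = (\<Sum>i<length ts. y i)"
  proof (induction rule: int_module.span_induct_alt)
    case base
    show ?case by (intro exI[of _ "\<lambda>_. 0"]) (simp add: int_module.span_zero)
  next
    case (step k u v)
    then obtain y where y: "\<forall>i<length ts. y i \<in> component vss i" "v = (\<Sum>i<length ts. y i)" by blast
    obtain l where "l \<in> set vss" "u \<in> set l" using step(1) by auto
    then obtain j where j: "j < length ts" "u \<in> set (vss ! j)"
      using D'(1) by (auto simp: in_set_conv_nth[of l])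
    define y' where "y' i = (if i = j then of_int k *\<^sub>R u else 0) + y i" for i
    have "(\<Sum>i<length ts. y' i) = of_int k *\<^sub>R u + v"
      using j(1) by (simp add: y'_def sum.distrib y(2))
    moreover have "y' i \<in> component vss i" if "i < length ts" for i
      using y(1) that j(2) unfolding y'_def
      by (cases "i = j") (auto intro: int_module.span_add int_module.span_scale int_module.span_base)
    ultimately show ?case by (intro exI[of _ y']) simp
  qed
  then show ?thesis using that by blast
qed

text \<open>The parts of a root in the components are mutually orthogonal, and each nonzero part has
  norm at most -2 because the lattice is definite and even. A total of -2 leaves room for one part
  only.\<close>

lemma root_in_component:
  assumes D: "root_decomposition ts vss" and r: "r \<in> R" "b r r = -2"
  obtains i where "i < length ts" "r \<in> component vss i"
proof -
  note D' = root_decompositionD[OF D]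
  obtain y where y: "\<And>i. i < length ts \<Longrightarrow> y i \<in> component vss i" "r = (\<Sum>i<length ts. y i)"
    by (rule decompose[OF D r(1)]) blast
  have yR: "y i \<in> R" if "i < length ts" for i using y(1)[OF that] D'(5)[OF that] by blast
  have small: "b (y i) (y i) \<le> -2" if i: "i < length ts" "y i \<noteq> 0" for i
  proof -
    obtain m :: int where m: "b (y i) (y i) = 2 * of_int m" using even_norm[OF yR[OF i(1)]] by blast
    have "b (y i) (y i) < 0"
      using nonpos[OF yR[OF i(1)]] definite[OF yR[OF i(1)]] i(2) by linarith
    then have "real_of_int m < 0" unfolding m by simp
    then have "real_of_int m \<le> -1" by simp
    then show ?thesis unfolding m by simp
  qed
  have "b r r = (\<Sum>i<length ts. \<Sum>j<length ts. b (y i) (y j))"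
    unfolding y(2) by (simp only: sum_left, simp only: sum_right)
  also have "\<dots> = (\<Sum>i<length ts. \<Sum>j<length ts. if j = i then b (y i) (y i) else 0)"
    using y(1) D'(6) by (intro sum.cong refl) auto
  finally have norm: "(\<Sum>i<length ts. b (y i) (y i)) = -2" using r(2) by simp
  have "r \<noteq> 0" using r(2) zero_left by auto
  then have "\<not> (\<forall>i\<in>{..<length ts}. y i = 0)" using y(2) sum.neutral by blast
  then obtain i where i: "i < length ts" "y i \<noteq> 0" by blast
  have other: "y j = 0" if j: "j < length ts" "j \<noteq> i" for j
  proof (rule ccontr)
    assume yj: "y j \<noteq> 0"
    have "(\<Sum>k\<in>{..<length ts} - {i, j}. b (y k) (y k)) \<le> 0"
      by (intro sum_nonpos) (use nonpos yR in auto)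
    moreover have "(\<Sum>k<length ts. b (y k) (y k)) =
        (\<Sum>k\<in>{..<length ts} - {i, j}. b (y k) (y k)) + (\<Sum>k\<in>{i, j}. b (y k) (y k))"
      by (rule sum.subset_diff) (use i j in auto)
    ultimately show False using norm small[OF i] small[OF j(1) yj] j(2) by simp
  qed
  have "r = y i" unfolding y(2) using i(1) other by (simp add: sum.remove)
  then show ?thesis using that[OF i(1)] y(1)[OF i(1)] by simp
qed

text \<open>Each root of \<open>vs\<close> lies in one component. Adjacent roots have product 1,
  which orthogonal components do not allow, so by connectedness of the diagram the component is the
  same for all.\<close>

lemma component_subset:
  assumes D: "root_decomposition ts vss" and vs: "simple_roots b t vs" "irreducible_type t" "set vs \<subseteq> R"
  obtains i where "i < length ts" "zspan (set vs) \<subseteq> component vss i"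
proof -
  note D' = root_decompositionD[OF D]
  have len: "length vs = dynkin_rank t" using vs by (simp add: simple_roots_def)
  have norm: "b (vs ! k) (vs ! k) = -2" if "k < length vs" for k
    using simple_roots_inner[OF vs(1) that that] by (simp add: dynkin_gram_def)
  have "\<exists>i. i < length ts \<and> vs ! k \<in> component vss i" if "k < length vs" for k
  proof -
    have "vs ! k \<in> R" using vs(3) nth_mem[OF that] by blast
    from root_in_component[OF D this norm[OF that]] show ?thesis by blast
  qed
  then obtain c where c: "\<And>k. k < length vs \<Longrightarrow> c k < length ts \<and> vs ! k \<in> component vss (c k)" by metis
  define e where "e k = c (k - 1)" for k
  have e: "e k = e (dynkin_rank t)" if "k \<in> {1..dynkin_rank t}" for k
  proof (rule dynkin_connected[OF vs(2) _ that])
    fix i j assume ij: "i \<in> {1..dynkin_rank t}" "j \<in> {1..dynkin_rank t}" "dynkin_gram t i j = 1"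
    then have "b (vs ! (i - 1)) (vs ! (j - 1)) = 1"
      using simple_roots_inner[OF vs(1), of "i - 1" "j - 1"] len by auto
    moreover have "i - 1 < length vs" "j - 1 < length vs" using ij len by auto
    note c[OF this(1)] c[OF this(2)]
    ultimately show "e i = e j"
      using D'(6)[of "c (i - 1)" "c (j - 1)" "vs ! (i - 1)" "vs ! (j - 1)"] unfolding e_def by force
  qed
  have same: "c k = e (dynkin_rank t)" if "k < length vs" for k
  proof -
    have "e (k + 1) = e (dynkin_rank t)" by (rule e) (use that len in auto)
    then show ?thesis by (simp add: e_def)
  qed
  \<comment> \<open>Some root has to exist for the common index to be in range.\<close>
  have rank: "0 < length vs" using irreducible_type_rank[OF vs(2)] len by simp
  have "set vs \<subseteq> component vss (e (dynkin_rank t))"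
    using c same by (auto simp: in_set_conv_nth)
  then have "zspan (set vs) \<subseteq> component vss (e (dynkin_rank t))"
    by (rule int_module.span_minimal) (rule int_module.subspace_span)
  moreover have "e (dynkin_rank t) < length ts" using c[OF rank] same[OF rank] by simp
  ultimately show ?thesis using that by blast
qed

text \<open>Distinct components are orthogonal, so an inclusion between them would make a simple
  root orthogonal to itself.\<close>

lemma component_inj:
  assumes D: "root_decomposition ts vss" and ij: "i < length ts" "j < length ts"
    and sub: "component vss i \<subseteq> component vss j"
  shows "i = j"
proof (rule ccontr)
  assume "i \<noteq> j"
  note D' = root_decompositionD[OF D]
  have "length (vss ! i) = dynkin_rank (ts ! i)" using D'(2)[OF ij(1)] by (simp add: simple_roots_def)
  then have pos: "0 < length (vss ! i)" using irreducible_type_rank[OF D'(3)[OF ij(1)]] by simp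
  then have v: "vss ! i ! 0 \<in> component vss i" by (intro int_module.span_base nth_mem)
  then have "b (vss ! i ! 0) (vss ! i ! 0) = 0" using D'(6)[OF ij \<open>i \<noteq> j\<close>] sub by blast
  moreover have "b (vss ! i ! 0) (vss ! i ! 0) = -2"
    using simple_roots_inner[OF D'(2)[OF ij(1)] pos pos] by (simp add: dynkin_gram_def)
  ultimately show False by simp
qed

lemma decompositions_match:
  assumes D1: "root_decomposition ts vss" and D2: "root_decomposition ts' vss'"
  obtains \<sigma> where "bij_betw \<sigma> {..<length ts} {..<length ts'}"
    "\<And>i. i < length ts \<Longrightarrow> component vss i = component vss' (\<sigma> i)"
proof -
  have match: "\<exists>j<length ts'. component vss i = component vss' j"
    if D1: "root_decomposition ts vss" and D2: "root_decomposition ts' vss'" and i: "i < length ts"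
    for ts ts' vss vss' i
  proof -
    note D1' = root_decompositionD[OF D1] and D2' = root_decompositionD[OF D2]
    obtain j where j: "j < length ts'" "component vss i \<subseteq> component vss' j"
      by (rule component_subset[OF D2 D1'(2-4)[OF i]])
    obtain k where k: "k < length ts" "component vss' j \<subseteq> component vss k"
      by (rule component_subset[OF D1 D2'(2-4)[OF j(1)]])
    \<comment> \<open>The inclusions lead from component \<open>i\<close> to \<open>j\<close> and on
      to \<open>k\<close>; the return to the start turns both into equalities.\<close>
    have "i = k" using component_inj[OF D1 i k(1)] j(2) k(2) by blast
    then show ?thesis using j k by blast
  qed
  have "\<forall>i. \<exists>j. i < length ts \<longrightarrow> j < length ts' \<and> component vss i = component vss' j"
    using match[OF D1 D2] by blast
  then obtain \<sigma> where \<sigma>: "\<And>i. i < length ts \<Longrightarrow> \<sigma> i < length ts' \<and> component vss i = component vss' (\<sigma> i)"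
    by metis
  have "inj_on \<sigma> {..<length ts}"
  proof (rule inj_onI)
    fix i j assume ij: "i \<in> {..<length ts}" "j \<in> {..<length ts}" "\<sigma> i = \<sigma> j"
    then have "component vss i = component vss j" using \<sigma>[of i] \<sigma>[of j] by simp
    then show "i = j" using component_inj[OF D1] ij by simp
  qed
  moreover have "\<sigma> ` {..<length ts} = {..<length ts'}"
  proof (intro equalityI image_subsetI subsetI)
    fix j assume "j \<in> {..<length ts'}"
    then have j: "j < length ts'" by simp
    then obtain i where i: "i < length ts" "component vss' j = component vss i"
      using match[OF D2 D1] by blast
    then have "j = \<sigma> i" using component_inj[OF D2 j, of "\<sigma> i"] \<sigma>[of i] by simp
    then show "j \<in> \<sigma> ` {..<length ts}" using i by simp
  qed (use \<sigma> in auto)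
  ultimately have "bij_betw \<sigma> {..<length ts} {..<length ts'}" by (simp add: bij_betw_def)
  then show ?thesis using that[of \<sigma>] \<sigma> by blast
qed

text \<open>Matched components are the same lattice. Rank 1 singles out A1, and
  \<open>simple_roots_type_D\<close> recognises D4 and D6. The first list is left general because it
  will come from unknown fibres.\<close>

lemma root_type_unique:
  assumes D1: "root_decomposition ts vss" and D2: "root_decomposition ts' vss'"
    and ts': "set ts' \<subseteq> {Dynkin_A 1, Dynkin_D 4, Dynkin_D 6}"
  shows "mset ts = mset ts'"
proof -
  note D1' = root_decompositionD[OF D1] and D2' = root_decompositionD[OF D2]
  obtain \<sigma> where \<sigma>: "bij_betw \<sigma> {..<length ts} {..<length ts'}"
    "\<And>i. i < length ts \<Longrightarrow> component vss i = component vss' (\<sigma> i)"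
    by (rule decompositions_match[OF D1 D2]) blast
  have type: "ts ! i = ts' ! \<sigma> i" if i: "i < length ts" for i
  proof -
    have \<sigma>i: "\<sigma> i < length ts'" using \<sigma>(1) i by (auto simp: bij_betw_def)
    have ev: "\<exists>m::int. b y y = 2 * of_int m" if "y \<in> component vss i" for y
      using even_norm D1'(5)[OF i] that by blast
    have "ts' ! \<sigma> i \<in> {Dynkin_A 1, Dynkin_D 4, Dynkin_D 6}" using ts' nth_mem[OF \<sigma>i] by blast
    then consider "ts' ! \<sigma> i = Dynkin_A 1" | n where "ts' ! \<sigma> i = Dynkin_D n" "n = 4 \<or> n = 6" by blast
    then show ?thesis
    proof cases
      case 1
      have "dynkin_rank (ts ! i) = 1"
        using simple_roots_rank[OF D1'(2,3)[OF i] D2'(2,3)[OF \<sigma>i] \<sigma>(2)[OF i]] 1 by simp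
      then show ?thesis using D1'(3)[OF i] unfolding 1 by (cases "ts ! i") auto
    next
      case 2
      then show ?thesis
        using simple_roots_type_D[OF D1'(2,3)[OF i], of n "vss' ! \<sigma> i"] D2'(2)[OF \<sigma>i] \<sigma>(2)[OF i] ev by simp
    qed
  qed
  have "mset xs = image_mset (nth xs) (mset_set {..<length xs})" for xs :: "dynkin list"
    by (metis map_nth mset_map mset_upt lessThan_atLeast0)
  then have "mset ts = image_mset (nth ts) (mset_set {..<length ts})" by blast
  also have "\<dots> = image_mset (\<lambda>i. ts' ! \<sigma> i) (mset_set {..<length ts})"
    by (intro image_mset_cong) (simp add: type)
  also have "\<dots> = image_mset (nth ts') (image_mset \<sigma> (mset_set {..<length ts}))"
    by (simp add: multiset.map_comp comp_def)
  also have "image_mset \<sigma> (mset_set {..<length ts}) = mset_set {..<length ts'}"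
    using \<sigma>(1) by (simp add: image_mset_mset_set bij_betw_def)
  also have "image_mset (nth ts') (mset_set {..<length ts'}) = mset ts'"
    by (metis map_nth mset_map mset_upt lessThan_atLeast0)
  finally show ?thesis .
qed

end

section \<open>Coordinates on the Niemeier lattice\<close>

lemma exhaust_6:
  fixes x :: 6
  shows "x = 1 \<or> x = 2 \<or> x = 3 \<or> x = 4 \<or> x = 5 \<or> x = 6"
proof (induct x)
  case (of_int z)
  then have "0 \<le> z" and "z < 6" by simp_all
  then have "z = 0 \<or> z = 1 \<or> z = 2 \<or> z = 3 \<or> z = 4 \<or> z = 5" by arith
  then show ?case by auto
qed

lemma forall_6: "(\<forall>i::6. P i) \<longleftrightarrow> P 1 \<and> P 2 \<and> P 3 \<and> P 4 \<and> P 5 \<and> P 6"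
  by (metis exhaust_6)

lemma UNIV_6: "UNIV = {1, 2, 3, 4, 5, 6::6}"
  using exhaust_6 by auto

lemma sum_6: "sum f (UNIV::6 set) = f 1 + f 2 + f 3 + f 4 + f 5 + f 6"
  unfolding UNIV_6 by (simp add: ac_simps)

lemma int_subspaceI:
  assumes "0 \<in> S" "\<And>x y. x \<in> S \<Longrightarrow> y \<in> S \<Longrightarrow> x + y \<in> S"
    "\<And>x. x \<in> S \<Longrightarrow> - x \<in> S"
  shows "int_module.subspace (S :: 'v::real_vector set)"
proof (rule int_module.subspaceI)
  fix c :: int and x assume x: "x \<in> S"
  have nat: "real n *\<^sub>R x \<in> S" for n
    by (induction n) (use x assms in \<open>auto simp: scaleR_left_distrib\<close>)
  show "of_int c *\<^sub>R x \<in> S"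
  proof (cases "c \<ge> 0")
    case True
    then show ?thesis using nat[of "nat c"] by simp
  next
    case False
    then show ?thesis using assms(3)[OF nat[of "nat (- c)"]] by simp
  qed
qed (use assms in auto)

text \<open>On \<open>D6_dual\<close> no rounding takes place; the floor only serves to have integer
  values. The coordinates of a vector of \<open>D6_dual\<close> agree modulo 1, so any of them would
  give the same parity.\<close>

definition half :: "real ^ 6 \<Rightarrow> int" where "half v = \<lfloor>2 * v $ 1\<rfloor>"

definition coord_sum :: "real ^ 6 \<Rightarrow> int" where "coord_sum v = \<lfloor>\<Sum>i\<in>UNIV. v $ i\<rfloor>"

text \<open>The union of Z^6 and its translate by (1/2, ..., 1/2).\<close>

definition D6_dual :: "(real ^ 6) set" where
  "D6_dual = {v. (\<forall>i. 2 * v $ i \<in> \<int>) \<and> (\<forall>i j. v $ i - v $ j \<in> \<int>)}"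

definition D6_root_lattice :: "(real ^ 6) set" where
  "D6_root_lattice = {v \<in> D6_dual. even (half v) \<and> even (coord_sum v)}"

text \<open>
  The class of \<open>v\<close> in \<open>D\<^sub>6\<^sup>*/D\<^sub>6\<close> is determined by the parities of \<open>half v\<close> and \<open>coord_sum v\<close>;
  the glue vectors [0], [1], [2], [3] have parities (0,0), (1,1), (0,1), (1,0). In these terms the glue
  code is cut out by four linear equations.
\<close>

definition glue_code :: "(4 \<Rightarrow> int) \<Rightarrow> (4 \<Rightarrow> int) \<Rightarrow> bool" where
  "glue_code h s \<longleftrightarrow>
     even (h 1 + h 2 + h 3 + h 4) \<and> even (s 1 + s 2 + h 1 + h 4) \<and>
     even (s 1 + s 3 + h 1 + h 2) \<and> even (s 1 + s 4 + h 1 + h 3)"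

lemma of_int_half: assumes "v \<in> D6_dual" shows "of_int (half v) = 2 * v $ 1"
proof -
  have "2 * v $ 1 \<in> \<int>" using assms unfolding D6_dual_def by blast
  then show ?thesis unfolding half_def by simp
qed

text \<open>The differences to the first coordinate are integers, and what remains is six times that
  coordinate, thus three times an integer.\<close>

lemma sum_6_dual_Ints:
  assumes "v \<in> D6_dual" shows "(\<Sum>i\<in>UNIV. v $ i) \<in> \<int>"
proof -
  have "(\<Sum>i\<in>UNIV. v $ i) = (\<Sum>i\<in>UNIV. v $ i - v $ 1) + 3 * (2 * v $ 1)"
    by (simp add: sum_subtractf sum_6)
  also have "\<dots> \<in> \<int>"
    using assms unfolding D6_dual_def by (intro Ints_add Ints_sum Ints_mult[of 3]) auto
  finally show ?thesis .
qed

lemma of_int_coord_sum: "v \<in> D6_dual \<Longrightarrow> of_int (coord_sum v) = (\<Sum>i\<in>UNIV. v $ i)"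
  using sum_6_dual_Ints by (simp add: coord_sum_def)

lemma D6_dual_add: assumes "v \<in> D6_dual" "w \<in> D6_dual" shows "v + w \<in> D6_dual"
proof -
  have "2 * v $ i + 2 * w $ i \<in> \<int>" for i
    using assms by (intro Ints_add) (auto simp: D6_dual_def)
  moreover have "(v $ i - v $ j) + (w $ i - w $ j) \<in> \<int>" for i j
    using assms by (intro Ints_add) (auto simp: D6_dual_def)
  ultimately show ?thesis by (simp add: D6_dual_def algebra_simps)
qed

lemma D6_dual_uminus: assumes "v \<in> D6_dual" shows "- v \<in> D6_dual"
proof -
  have "- (2 * v $ i) \<in> \<int>" for i
    using assms by (intro Ints_minus) (auto simp: D6_dual_def)
  moreover have "- (v $ i - v $ j) \<in> \<int>" for i j
    using assms by (intro Ints_minus) (auto simp: D6_dual_def)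
  ultimately show ?thesis by (simp add: D6_dual_def algebra_simps)
qed

lemma D6_dual_0: "0 \<in> D6_dual"
  by (simp add: D6_dual_def)

lemma half_0 [simp]: "half 0 = 0" and coord_sum_0 [simp]: "coord_sum 0 = 0"
  by (simp_all add: half_def coord_sum_def)

lemma half_add: assumes "v \<in> D6_dual" "w \<in> D6_dual" shows "half (v + w) = half v + half w"
proof -
  have "real_of_int (half (v + w)) = of_int (half v + half w)"
    using assms by (simp add: of_int_half D6_dual_add)
  then show ?thesis by linarith
qed

lemma coord_sum_add: assumes "v \<in> D6_dual" "w \<in> D6_dual" shows "coord_sum (v + w) = coord_sum v + coord_sum w"
proof -
  have "real_of_int (coord_sum (v + w)) = of_int (coord_sum v + coord_sum w)"
    using assms by (simp add: of_int_coord_sum D6_dual_add sum.distrib)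
  then show ?thesis by linarith
qed

lemma half_uminus: "v \<in> D6_dual \<Longrightarrow> half (- v) = - half v"
  using half_add[of v "- v"] by (simp add: D6_dual_uminus)

lemma coord_sum_uminus: "v \<in> D6_dual \<Longrightarrow> coord_sum (- v) = - coord_sum v"
  using coord_sum_add[of v "- v"] by (simp add: D6_dual_uminus)

lemma subspace_D6_dual: "int_module.subspace D6_dual"
  by (intro int_subspaceI D6_dual_0 D6_dual_add D6_dual_uminus)

lemma half_scale: assumes "v \<in> D6_dual" shows "half (of_int c *\<^sub>R v) = c * half v"
proof -
  have "real_of_int (half (of_int c *\<^sub>R v)) = of_int (c * half v)"
    using assms int_module.subspace_scale[OF subspace_D6_dual assms, of c] by (simp add: of_int_half)
  then show ?thesis by linarith
qed

lemma coord_sum_scale: assumes "v \<in> D6_dual" shows "coord_sum (of_int c *\<^sub>R v) = c * coord_sum v"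
proof -
  have "real_of_int (coord_sum (of_int c *\<^sub>R v)) = of_int (c * coord_sum v)"
    using assms int_module.subspace_scale[OF subspace_D6_dual assms, of c]
    by (simp add: of_int_coord_sum sum_distrib_left)
  then show ?thesis by linarith
qed

lemma D6_dual_Ints: assumes "v \<in> D6_dual" "even (half v)" shows "v $ i \<in> \<int>"
proof -
  obtain m where "half v = 2 * m" using assms by blast
  then have "v $ 1 = of_int m" using of_int_half[OF assms(1)] by simp
  moreover have "v $ i - v $ 1 \<in> \<int>" using assms by (simp add: D6_dual_def)
  ultimately show ?thesis by (metis Ints_add Ints_of_int diff_add_cancel)
qed

lemma D6_dual_half_odd: assumes "v \<in> D6_dual" "odd (half v)" shows "(v $ i)\<^sup>2 \<ge> 1 / 4"
proof -
  have "v $ i - v $ 1 \<in> \<int>" using assms by (simp add: D6_dual_def)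
  then obtain m where m: "v $ i - v $ 1 = of_int m" by (auto elim: Ints_cases)
  then have *: "2 * v $ i = of_int (half v + 2 * m)" using of_int_half[OF assms(1)] by simp
  have "half v + 2 * m \<noteq> 0" using assms(2) by presburger
  then have "0 < (half v + 2 * m)\<^sup>2" by simp
  then have "1 \<le> (half v + 2 * m)\<^sup>2" by linarith
  then have "1 \<le> (2 * v $ i)\<^sup>2" unfolding * by (metis of_int_1_le_iff of_int_power)
  then show "(v $ i)\<^sup>2 \<ge> 1 / 4" by (simp add: power2_eq_square)
qed

lemma D6_dual_IntsI: "(\<And>i. v $ i \<in> \<int>) \<Longrightarrow> v \<in> D6_dual"
  by (auto simp: D6_dual_def intro: Ints_mult)

lemma d_simps:
  "d (Suc 0) = axis 1 1 - axis 2 1" "d 1 = axis 1 1 - axis 2 1" "d 2 = axis 2 1 - axis 3 1" "d 3 = axis 3 1 - axis 4 1"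
  "d 4 = axis 4 1 - axis 5 1" "d 5 = axis 5 1 - axis 6 1" "d 6 = axis 5 1 + axis 6 1"
  by (simp_all add: d_def)

lemma axis_nth: "axis i x $ j = (if j = i then x else 0)"
  by (simp add: axis_def)

lemma glue_coords:
  "glue 0 = 0" "glue (Suc 0) = (\<chi> i. 1/2)" "glue 1 = (\<chi> i. 1/2)" "glue 2 = axis 1 1" "glue 3 = (\<chi> i. if i = 6 then -1/2 else 1/2)"
  by (simp_all add: glue_def d_simps vec_eq_iff forall_6 axis_nth)

lemma atLeastAtMost_1_6: "{1..6::nat} = {1, 2, 3, 4, 5, 6}"
  by auto

lemma D6_root_lattice_eq: "D6_root_lattice = zspan (d ` {1..6})"
proof -
  have sub: "int_module.subspace D6_root_lattice"
    by (rule int_subspaceI)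
      (auto simp: D6_root_lattice_def D6_dual_0 D6_dual_add D6_dual_uminus half_add coord_sum_add half_uminus coord_sum_uminus)
  have d_in: "d i \<in> D6_root_lattice" if "i \<in> {1..6}" for i
  proof -
    have 1: "d i \<in> D6_dual"
      using that unfolding atLeastAtMost_1_6 by (intro D6_dual_IntsI) (auto simp: d_simps axis_nth)
    have "real_of_int (half (d i)) \<in> {-2, 0, 2}"
      using that unfolding atLeastAtMost_1_6 by (subst of_int_half[OF 1]) (auto simp: d_simps axis_nth)
    then have "half (d i) \<in> {-2, 0, 2}" by simp linarith
    moreover have "real_of_int (coord_sum (d i)) \<in> {0, 2}"
      using that unfolding atLeastAtMost_1_6 by (subst of_int_coord_sum[OF 1]) (auto simp: d_simps axis_nth sum_6)
    ultimately show ?thesis using 1 by (auto simp: D6_root_lattice_def)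
  qed
  have "v \<in> zspan (d ` {1..6})" if v: "v \<in> D6_root_lattice" for v
  proof -
    have "\<exists>z. \<forall>i. v $ i = of_int (z i)"
      using v D6_dual_Ints[of v] unfolding D6_root_lattice_def Ints_def by (intro choice) blast
    then obtain z where z: "\<And>i. v $ i = of_int (z i)" by blast
    obtain m where "coord_sum v = 2 * m" using v by (auto simp: D6_root_lattice_def)
    then have "(\<Sum>i\<in>UNIV. v $ i) = of_int (2 * m)" using of_int_coord_sum[of v] v by (simp add: D6_root_lattice_def)
    then have "real_of_int (\<Sum>i\<in>UNIV. z i) = of_int (2 * m)" by (simp add: z)
    then have m: "z 6 = 2 * m - z 1 - z 2 - z 3 - z 4 - z 5" by (simp add: sum_6)
    \<comment> \<open>Partial sums telescope along the chain. At the fork the coefficient of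
      \<open>d 6\<close> has to be half of the total coordinate sum, which is the integer
      \<open>m\<close> because the sum is even.\<close>
    have eq: "v = of_int (z 1) *\<^sub>R d 1 + of_int (z 1 + z 2) *\<^sub>R d 2 + of_int (z 1 + z 2 + z 3) *\<^sub>R d 3
        + of_int (z 1 + z 2 + z 3 + z 4) *\<^sub>R d 4 + of_int (z 1 + z 2 + z 3 + z 4 + z 5 - m) *\<^sub>R d 5
        + of_int m *\<^sub>R d 6"
      by (simp add: vec_eq_iff forall_6 d_simps axis_nth z m)
    show ?thesis unfolding eq
      by (intro int_module.span_add int_module.span_scale int_module.span_base imageI) simp_all
  qed
  then show ?thesis
    using int_module.span_minimal[OF _ sub] d_in by blast
qed

section \<open>The glue code and the coordinates of the Niemeier lattice\<close>

definition niemeier_coords :: "(real ^ 6 ^ 4) set" where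
  "niemeier_coords = {x. (\<forall>k. x $ k \<in> D6_dual) \<and> glue_code (\<lambda>k. half (x $ k)) (\<lambda>k. coord_sum (x $ k))}"

lemma glue_code_add:
  assumes "glue_code h s" "glue_code h' s'"
  shows "glue_code (\<lambda>k. h k + h' k) (\<lambda>k. s k + s' k)"
  using assms unfolding glue_code_def by (simp only: even_add) argo

lemma glue_code_uminus: "glue_code h s \<Longrightarrow> glue_code (\<lambda>k. - h k) (\<lambda>k. - s k)"
  by (simp only: glue_code_def even_add even_minus)

lemma subspace_niemeier_coords: "int_module.subspace niemeier_coords"
proof (rule int_subspaceI)
  show "0 \<in> niemeier_coords"
    by (simp add: niemeier_coords_def D6_dual_0 glue_code_def)
next
  fix x y assume xy: "x \<in> niemeier_coords" "y \<in> niemeier_coords"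
  then have "glue_code (\<lambda>k. half (x $ k) + half (y $ k)) (\<lambda>k. coord_sum (x $ k) + coord_sum (y $ k))"
    by (intro glue_code_add) (simp_all add: niemeier_coords_def)
  with xy show "x + y \<in> niemeier_coords"
    by (simp add: niemeier_coords_def D6_dual_add half_add coord_sum_add)
next
  fix x assume x: "x \<in> niemeier_coords"
  then have "glue_code (\<lambda>k. - half (x $ k)) (\<lambda>k. - coord_sum (x $ k))"
    by (intro glue_code_uminus) (simp_all add: niemeier_coords_def)
  with x show "- x \<in> niemeier_coords"
    by (simp add: niemeier_coords_def D6_dual_uminus half_uminus coord_sum_uminus)
qed

lemma glue_D6_dual: "glue i \<in> D6_dual"
proof -
  have "glue i = (if i = 1 then glue 1 else if i = 2 then glue 2 else if i = 3 then glue 3 else glue 0)"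
    by (simp add: glue_def)
  moreover have "glue 0 \<in> D6_dual" "glue 1 \<in> D6_dual" "glue 2 \<in> D6_dual" "glue 3 \<in> D6_dual"
    unfolding glue_coords by (auto simp: D6_dual_def axis_nth)
  ultimately show ?thesis by presburger
qed

lemma half_glue: "half (glue 0) = 0" "half (glue 1) = 1" "half (glue 2) = 2" "half (glue 3) = 1"
  by (simp_all add: half_def glue_coords axis_nth)

lemma coord_sum_glue: "coord_sum (glue 0) = 0" "coord_sum (glue 1) = 3" "coord_sum (glue 2) = 1" "coord_sum (glue 3) = 2"
  by (simp_all add: coord_sum_def glue_coords axis_nth sum_6)

lemma glue_word_nth:
  "glue_word p q r s $ 1 = glue p" "glue_word p q r s $ 2 = glue q"
  "glue_word p q r s $ 3 = glue r" "glue_word p q r s $ 4 = glue s"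
  by (simp_all add: glue_word_def in_copy_def axis_nth)

lemma glue_word_in_coords: "glue_word p q r s \<in> niemeier_coords \<longleftrightarrow>
   glue_code (\<lambda>k. half (glue_word p q r s $ k)) (\<lambda>k. coord_sum (glue_word p q r s $ k))"
  by (auto simp: niemeier_coords_def forall_4 glue_word_nth glue_D6_dual)

lemma glue_parity:
  assumes "i \<in> {0, 1, 2, 3}"
  shows "even (half (glue i)) \<longleftrightarrow> i \<in> {0, 2}" "even (coord_sum (glue i)) \<longleftrightarrow> i \<in> {0, 3}"
  using assms by (auto simp: half_glue coord_sum_glue simp del: One_nat_def)

definition swap_values :: "nat \<Rightarrow> nat \<Rightarrow> nat \<Rightarrow> nat" where
  "swap_values a b i = (if i = a then b else if i = b then a else i)"

text \<open>\<open>glue_code\<close> for words of glue vectors: \<open>H\<close> and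
  \<open>S\<close> are the parities from \<open>glue_parity\<close>, and a nested equality of truth
  values stands for the evenness of a sum. Membership becomes a finite evaluation.\<close>

definition word_parity :: "nat \<Rightarrow> nat \<Rightarrow> nat \<Rightarrow> nat \<Rightarrow> bool" where
  "word_parity w x y z =
    (let H = (\<lambda>i. i \<in> {0, 2}); S = (\<lambda>i. i \<in> {0, 3}) in
    (((H w = H x) = H y) = H z) \<and> (((S w = S x) = H w) = H z) \<and>
    (((S w = S y) = H w) = H x) \<and> (((S w = S z) = H w) = H y))"

lemma glue_word_coords_iff:
  assumes "w \<in> {0, 1, 2, 3}" "x \<in> {0, 1, 2, 3}" "y \<in> {0, 1, 2, 3}" "z \<in> {0, 1, 2, 3}"
  shows "glue_word w x y z \<in> niemeier_coords \<longleftrightarrow> word_parity w x y z"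
  unfolding glue_word_in_coords glue_code_def glue_word_nth even_add word_parity_def Let_def
  unfolding glue_parity[OF assms(1)] glue_parity[OF assms(2)] glue_parity[OF assms(3)] glue_parity[OF assms(4)] ..

text \<open>Checked by evaluating all cases. A swap of letters leads into the code as well as out of
  it, which makes \<open>glue_word_permutes\<close> an equivalence.\<close>

lemma word_parity_transpose:
  "\<forall>w\<in>{0,1,2,3}. \<forall>x\<in>{0,1,2,3}. \<forall>y\<in>{0,1,2,3}. \<forall>z\<in>{0,1,2,3}. \<forall>a\<in>{0,1,2,3}. \<forall>b\<in>{0,1,2,3}.
    a \<noteq> b \<longrightarrow> w \<noteq> x \<longrightarrow> w \<noteq> y \<longrightarrow> w \<noteq> z \<longrightarrow> x \<noteq> y \<longrightarrow> x \<noteq> z \<longrightarrow> y \<noteq> z \<longrightarrow>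
    word_parity (swap_values a b w) (swap_values a b x) (swap_values a b y) (swap_values a b z) \<noteq> word_parity w x y z"
  unfolding word_parity_def Let_def swap_values_def
  by code_simp

lemma glue_word_transpose:
  assumes "p permutes {0..3::nat}" "a \<in> {0..3}" "b \<in> {0..3}" "a \<noteq> b"
  defines "q \<equiv> Transposition.transpose a b \<circ> p"
  shows "glue_word (q 0) (q 1) (q 2) (q 3) \<in> niemeier_coords \<longleftrightarrow>
    glue_word (p 0) (p 1) (p 2) (p 3) \<notin> niemeier_coords"
proof -
  have range: "{0..3} = {0, 1, 2, 3::nat}" by auto
  have im: "p i \<in> {0, 1, 2, 3} \<longleftrightarrow> i \<in> {0, 1, 2, 3}" for i
    using permutes_in_image[OF assms(1), of i] unfolding range .
  have im0: "p 0 \<in> {0, 1, 2, 3}" and im1: "p 1 \<in> {0, 1, 2, 3}"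
    and im2: "p 2 \<in> {0, 1, 2, 3}" and im3: "p 3 \<in> {0, 1, 2, 3}"
    by (simp_all only: im) simp_all
  have a: "a \<in> {0, 1, 2, 3}" and b: "b \<in> {0, 1, 2, 3}" using assms(2,3) unfolding range by auto
  have q: "q i = swap_values a b (p i)" for i
    by (simp add: q_def swap_values_def transpose_def)
  have t: "swap_values a b i \<in> {0, 1, 2, 3}" if "i \<in> {0, 1, 2, 3}" for i
    using that a b by (simp add: swap_values_def)
  have neq: "p 0 \<noteq> p 1" "p 0 \<noteq> p 2" "p 0 \<noteq> p 3" "p 1 \<noteq> p 2" "p 1 \<noteq> p 3" "p 2 \<noteq> p 3"
    by (simp_all add: inj_eq[OF permutes_inj[OF assms(1)]])
  have "word_parity (swap_values a b (p 0)) (swap_values a b (p 1)) (swap_values a b (p 2)) (swap_values a b (p 3))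
      \<noteq> word_parity (p 0) (p 1) (p 2) (p 3)"
    using word_parity_transpose[THEN bspec, OF im0, THEN bspec, OF im1, THEN bspec, OF im2,
        THEN bspec, OF im3, THEN bspec, OF a, THEN bspec, OF b] neq assms(4) by blast
  then show ?thesis
    unfolding q glue_word_coords_iff[OF im0 im1 im2 im3]
      glue_word_coords_iff[OF t[OF im0] t[OF im1] t[OF im2] t[OF im3]] by simp
qed

text \<open>Both sides hold for the identity, and both change under every transposition.\<close>

lemma glue_word_permutes:
  assumes "p permutes {0..3::nat}"
  shows "glue_word (p 0) (p 1) (p 2) (p 3) \<in> niemeier_coords \<longleftrightarrow> evenperm p"
proof -
  have "finite {0..3::nat}" by simp
  with assms show ?thesis
  proof (induction rule: permutes_induct)
    case id
    show ?case
      by (simp add: glue_word_in_coords glue_word_nth half_glue coord_sum_glue glue_code_def evenperm_id del: One_nat_def)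
  next
    case (swap a b p)
    then have "permutation p"
      unfolding permutation_permutes by (intro exI[of _ "{0..3}"]) simp
    then have "evenperm (Transposition.transpose a b \<circ> p) \<longleftrightarrow> \<not> evenperm p"
      using swap(3) by (simp add: evenperm_comp[OF permutation_swap_id] evenperm_swap)
    then show ?case
      by (simp only: glue_word_transpose[OF swap.hyps(4,1,2,3)] swap.IH not_not)
  qed
qed

lemma in_copy_nth: "in_copy k v $ l = (if l = k then v else 0)"
  by (simp add: in_copy_def axis_nth)

lemma in_copy_linear: "linear (in_copy k)"
  by (rule linearI) (simp_all add: vec_eq_iff in_copy_nth)

lemma in_copy_D6:
  assumes "v \<in> D6_root_lattice"
  shows "in_copy k v \<in> niemeier_D6_4"
proof -
  have "v \<in> zspan (d ` {1..6})" using assms by (simp add: D6_root_lattice_eq)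
  then show ?thesis
  proof (induction rule: int_module.span_induct_alt)
    case base
    have "in_copy k 0 = 0" by (simp add: vec_eq_iff in_copy_nth)
    then show ?case by (simp add: niemeier_D6_4_def int_module.span_zero)
  next
    case (step c x y)
    from step(1) obtain i where "i \<in> {1..6}" "x = d i" by blast
    then have "in_copy k x \<in> niemeier_D6_4"
      unfolding niemeier_D6_4_def by (intro int_module.span_base) blast
    then have "of_int c *\<^sub>R in_copy k x + in_copy k y \<in> niemeier_D6_4"
      using step(2) unfolding niemeier_D6_4_def by (intro int_module.span_add int_module.span_scale)
    then show ?case by (simp add: linear_add[OF in_copy_linear] linear_scale[OF in_copy_linear])
  qed
qed

lemma sum_in_copy: "x = in_copy 1 (x $ 1) + in_copy 2 (x $ 2) + in_copy 3 (x $ 3) + in_copy 4 (x $ 4)"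
  by (simp add: vec_eq_iff forall_4 in_copy_nth)

text \<open>Four independent equations on eight parities leave 16 classes, and the words [1,1,1,1],
  [2,2,2,2], [0,1,2,3] and [0,2,3,1] form a basis of them over the field with two elements. A vector
  minus the right glue then lies in D6^4.\<close>

lemma niemeier_eq: "niemeier_D6_4 = niemeier_coords"
proof
  have copies: "in_copy k (d i) \<in> niemeier_coords" if "i \<in> {1..6}" for k i
  proof -
    have "d i \<in> D6_root_lattice"
      unfolding D6_root_lattice_eq using that by (intro int_module.span_base) auto
    then show ?thesis
      by (auto simp: niemeier_coords_def in_copy_nth D6_dual_0 D6_root_lattice_def glue_code_def)
  qed
  have words: "{glue_word 0 0 0 0, glue_word 1 1 1 1, glue_word 2 2 2 2, glue_word 3 3 3 3} \<subseteq> niemeier_coords"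
    by (simp add: glue_word_in_coords glue_word_nth half_glue coord_sum_glue glue_code_def del: One_nat_def)
  show "niemeier_D6_4 \<subseteq> niemeier_coords"
    unfolding niemeier_D6_4_def
    by (intro int_module.span_minimal subspace_niemeier_coords) (use copies words glue_word_permutes in blast)
  then have sub: "g \<in> niemeier_D6_4 \<Longrightarrow> g \<in> niemeier_coords" for g by blast
  show "niemeier_coords \<subseteq> niemeier_D6_4"
  proof
    fix x assume x: "x \<in> niemeier_coords"
    let ?N = niemeier_D6_4
    define h s where "h k = half (x $ k)" and "s k = coord_sum (x $ k)" for k
    have code: "glue_code h s" and dual: "x $ k \<in> D6_dual" for k
      using x by (simp_all add: niemeier_coords_def h_def[abs_def] s_def[abs_def])
    have g1: "glue_word 1 1 1 1 \<in> ?N" and g2: "glue_word 2 2 2 2 \<in> ?N"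
      unfolding niemeier_D6_4_def by (intro int_module.span_base; simp)+
    have id: "glue_word 0 1 2 3 \<in> ?N"
    proof -
      have "glue_word (id 0) (id 1) (id 2) (id 3) \<in> ?N"
        unfolding niemeier_D6_4_def
        by (rule int_module.span_base) (use permutes_id evenperm_id in blast)
      then show ?thesis by simp
    qed
    have cyc: "glue_word 0 2 3 1 \<in> ?N"
    proof -
      \<comment> \<open>The 3-cycle whose word is 0 2 3 1.\<close>
      define p :: "nat \<Rightarrow> nat" where "p = Transposition.transpose 1 2 \<circ> Transposition.transpose 2 3"
      have "p permutes {0..3}"
        unfolding p_def by (intro permutes_compose permutes_swap_id) auto
      moreover have "evenperm p"
        unfolding p_def by (subst evenperm_comp) (auto simp: permutation_swap_id evenperm_swap)
      ultimately have "glue_word (p 0) (p 1) (p 2) (p 3) \<in> ?N"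
        unfolding niemeier_D6_4_def by (intro int_module.span_base) blast
      then show ?thesis by (simp add: p_def transpose_def)
    qed
    \<comment> \<open>The second and third coefficients correct \<open>h\<close> at the copies 2 and
      3, at each of which only one of the two words is odd. The last one adjusts \<open>s 1\<close>,
      to which [1,1,1,1] has contributed \<open>3 * h 1\<close>. The equations of the code settle
      the other parities.\<close>
    define g where "g = of_int (h 1) *\<^sub>R glue_word 1 1 1 1 + of_int (h 1 + h 2) *\<^sub>R glue_word 0 1 2 3
        + of_int (h 1 + h 3) *\<^sub>R glue_word 0 2 3 1 + of_int (s 1 - 3 * h 1) *\<^sub>R glue_word 2 2 2 2"
    have gN: "g \<in> ?N"
      using g1 g2 id cyc unfolding g_def niemeier_D6_4_def
      by (intro int_module.span_add int_module.span_scale)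
    have gk: "g $ k = of_int (h 1) *\<^sub>R glue 1 + of_int (h 1 + h 2) *\<^sub>R glue (if k = 1 then 0 else if k = 2 then 1 else if k = 3 then 2 else 3)
        + of_int (h 1 + h 3) *\<^sub>R glue (if k = 1 then 0 else if k = 2 then 2 else if k = 3 then 3 else 1) + of_int (s 1 - 3 * h 1) *\<^sub>R glue 2" for k
      using exhaust_4[of k] unfolding g_def by (elim disjE) (simp_all add: glue_word_nth del: One_nat_def)
    have dual_sum: "of_int a *\<^sub>R glue i + of_int b *\<^sub>R glue j + of_int c *\<^sub>R glue m + of_int e *\<^sub>R glue n \<in> D6_dual" for a b c e i j m n
      by (intro int_module.subspace_add int_module.subspace_scale subspace_D6_dual glue_D6_dual)
    have half_sum: "half (of_int a *\<^sub>R glue i + of_int b *\<^sub>R glue j + of_int c *\<^sub>R glue m + of_int e *\<^sub>R glue n)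
       = a * half (glue i) + b * half (glue j) + c * half (glue m) + e * half (glue n)"
      "coord_sum (of_int a *\<^sub>R glue i + of_int b *\<^sub>R glue j + of_int c *\<^sub>R glue m + of_int e *\<^sub>R glue n)
       = a * coord_sum (glue i) + b * coord_sum (glue j) + c * coord_sum (glue m) + e * coord_sum (glue n)" for a b c e i j m n
      by (simp_all only: half_add coord_sum_add half_scale coord_sum_scale D6_dual_add int_module.subspace_scale[OF subspace_D6_dual] glue_D6_dual)
    have "x $ k - g $ k \<in> D6_root_lattice" for k
    proof -
      have dk: "g $ k \<in> D6_dual" unfolding gk by (rule dual_sum)
      have "even (h k - half (g $ k))"
        using exhaust_4[of k] code unfolding gk half_sum glue_code_def
        by (elim disjE) (simp add: half_glue del: One_nat_def; argo?)+
      moreover have "even (s k - coord_sum (g $ k))"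
        using exhaust_4[of k] code unfolding gk half_sum glue_code_def
        by (elim disjE) (simp add: coord_sum_glue del: One_nat_def; argo?)+
      ultimately show ?thesis
        using dk dual[of k] D6_dual_uminus[OF dk] half_add[of "x $ k" "- (g $ k)"] coord_sum_add[of "x $ k" "- (g $ k)"]
          D6_dual_add[of "x $ k" "- (g $ k)"]
        by (simp add: D6_root_lattice_def half_uminus coord_sum_uminus h_def s_def)
    qed
    then have "in_copy k ((x - g) $ k) \<in> ?N" for k by (intro in_copy_D6) simp
    then have "x - g \<in> ?N"
      by (subst sum_in_copy) (simp add: niemeier_D6_4_def int_module.span_add)
    then have "(x - g) + g \<in> ?N"
      using gN unfolding niemeier_D6_4_def by (rule int_module.span_add)
    then show "x \<in> ?N" by simp
  qed
qed

section \<open>Short integer vectors and the roots of the Niemeier lattice\<close>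

definition signed_axes :: "(real ^ 'n) set" where
  "signed_axes = {v. \<exists>i. v = axis i 1 \<or> v = - axis i 1}"

lemma inner_vec_sum: "(v :: real ^ 'n) \<bullet> w = (\<Sum>i\<in>UNIV. v $ i * w $ i)"
  by (simp add: inner_vec_def)

text \<open>Integer squares with sum 2 include exactly two nonzero ones, both equal to 1.\<close>

lemma int_vec_norm_2:
  fixes v :: "real ^ 'n"
  assumes "\<And>i. v $ i \<in> \<int>" "v \<bullet> v = 2"
  obtains u w where "u \<in> signed_axes" "w \<in> signed_axes" "u \<bullet> w = 0" "v = u + w"
proof -
  have "\<exists>z. \<forall>i. v $ i = of_int (z i)"
    using assms(1) unfolding Ints_def by (intro choice) blast
  then obtain z where z: "\<And>i. v $ i = of_int (z i)" by blast
  have "real_of_int (\<Sum>i\<in>UNIV. (z i)\<^sup>2) = of_int 2"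
    using assms(2) by (simp add: inner_vec_sum z power2_eq_square)
  then have sum: "(\<Sum>i\<in>UNIV. (z i)\<^sup>2) = 2" by linarith
  have small: "(z i)\<^sup>2 = (if z i \<noteq> 0 then 1 else 0)" "z i \<in> {-1, 0, 1}" for i
  proof -
    have "(z i)\<^sup>2 \<le> 2" using member_le_sum[of i UNIV "\<lambda>i. (z i)\<^sup>2"] sum by simp
    then have "\<bar>z i\<bar> < 2" by (intro power2_less_imp_less[of _ 2]) auto
    then have "z i = -1 \<or> z i = 0 \<or> z i = 1" by linarith
    then show "(z i)\<^sup>2 = (if z i \<noteq> 0 then 1 else 0)" "z i \<in> {-1, 0, 1}" by auto
  qed
  have "int (card {i. z i \<noteq> 0}) = 2"
    using sum by (simp add: small(1) sum.If_cases)
  then have "card {i. z i \<noteq> 0} = 2" by simp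
  then obtain i j where ij: "{i. z i \<noteq> 0} = {i, j}" "i \<noteq> j" by (auto simp: card_2_iff)
  have zi: "z i = 1 \<or> z i = -1" "z j = 1 \<or> z j = -1" using ij small(2)[of i] small(2)[of j] by blast+
  have zo: "z k = 0" if "k \<noteq> i" "k \<noteq> j" for k using ij that by blast
  have minus: "axis m (- 1) = - axis m (1::real)" for m :: 'n
    by (simp add: vec_eq_iff axis_nth)
  have axes: "axis m 1 \<in> signed_axes" "- axis m 1 \<in> signed_axes" for m :: 'n
    by (auto simp: signed_axes_def)
  show ?thesis
  proof (rule that)
    show "axis i (of_int (z i)) \<in> signed_axes" "axis j (of_int (z j)) \<in> signed_axes"
      using zi axes by (auto simp: minus)
    show "axis i (of_int (z i)) \<bullet> axis j (of_int (z j)) = (0::real)"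
      using ij(2) by (subst inner_axis) (simp add: axis_nth)
    show "v = axis i (of_int (z i)) + axis j (of_int (z j))"
    proof (rule vec_eq_iff[THEN iffD2], rule allI)
      fix k
      show "v $ k = (axis i (of_int (z i)) + axis j (of_int (z j))) $ k"
        using ij(2) zo[of k] by (cases "k = i"; cases "k = j") (simp_all add: axis_nth z)
    qed
  qed
qed

lemma int_vec_norm_ge_1:
  fixes v :: "real ^ 'n"
  assumes "\<And>i. v $ i \<in> \<int>" "v \<noteq> 0"
  shows "1 \<le> v \<bullet> v"
proof -
  obtain i where i: "v $ i \<noteq> 0" using assms(2) by (auto simp: vec_eq_iff)
  obtain m where m: "v $ i = of_int m" using assms(1) by (auto elim: Ints_cases)
  have "1 \<le> m\<^sup>2" using i m by (simp add: int_one_le_iff_zero_less)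
  then have "1 \<le> (v $ i)\<^sup>2" unfolding m by (metis of_int_1_le_iff of_int_power)
  also have "\<dots> \<le> v \<bullet> v"
    unfolding inner_vec_sum using member_le_sum[of i UNIV "\<lambda>i. v $ i * v $ i"] by (simp add: power2_eq_square)
  finally show ?thesis .
qed

text \<open>Squaring an integer keeps its parity, so the norm is congruent to the coordinate sum
  modulo 2.\<close>

lemma D6_root_lattice_norm_even:
  assumes "v \<in> D6_root_lattice"
  obtains m :: int where "v \<bullet> v = 2 * of_int m"
proof -
  have v: "v \<in> D6_dual" "even (half v)" "even (coord_sum v)" using assms by (auto simp: D6_root_lattice_def)
  have "\<exists>z. \<forall>i. v $ i = of_int (z i)"
    using D6_dual_Ints[OF v(1,2)] unfolding Ints_def by (intro choice) blast
  then obtain z where z: "\<And>i. v $ i = of_int (z i)" by blast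
  have "real_of_int (coord_sum v) = of_int (\<Sum>i\<in>UNIV. z i)"
    using of_int_coord_sum[OF v(1)] by (simp add: z)
  then have "even (\<Sum>i\<in>UNIV. z i)" using v(3) by (metis of_int_eq_iff)
  moreover have "even ((\<Sum>i\<in>UNIV. z i * z i) - (\<Sum>i\<in>UNIV. z i))"
    unfolding sum_subtractf[symmetric] by (intro dvd_sum) auto
  ultimately have "even (\<Sum>i\<in>UNIV. z i * z i)" by simp
  then obtain m where "(\<Sum>i\<in>UNIV. z i * z i) = 2 * m" by blast
  then have "real_of_int (\<Sum>i\<in>UNIV. z i * z i) = 2 * of_int m" by simp
  then have "v \<bullet> v = 2 * of_int m" by (simp add: inner_vec_sum z)
  then show ?thesis by (rule that)
qed

lemma inner_four: "(x :: real ^ 6 ^ 4) \<bullet> y = x $ 1 \<bullet> y $ 1 + x $ 2 \<bullet> y $ 2 + x $ 3 \<bullet> y $ 3 + x $ 4 \<bullet> y $ 4"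
  by (simp add: inner_vec_def[of x y] sum_4)

lemma glue_code_odd_pair:
  assumes "glue_code h s" "odd (h k)"
  obtains l where "l \<noteq> k" "odd (h l)"
proof -
  have "even (h 1 + h 2 + h 3 + h 4)" using assms(1) by (simp add: glue_code_def)
  then show ?thesis using exhaust_4[of k] assms(2) that[of 1] that[of 2] that[of 3] that[of 4]
    by (elim disjE) (simp_all, argo+)
qed

text \<open>Half-integral components do not occur alone and have norm at least 6/4 each, which
  already gives 3. If all components are integral, the code makes all coordinate sums congruent
  modulo 2; if these are odd, four nonzero components give norm at least 4. What is left is D6^4,
  where nonzero components have norm at least 2, so there is only one.\<close>

lemma niemeier_root:
  assumes "x \<in> niemeier_D6_4" "neg_form x x = -2"
  obtains k u w where "x = in_copy k (u + w)" "u \<in> signed_axes" "w \<in> signed_axes" "u \<bullet> w = 0"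
proof -
  have norm: "x \<bullet> x = 2" using assms(2) by (simp add: neg_form_def)
  have sumn: "(\<Sum>k\<in>UNIV. x $ k \<bullet> x $ k) = 2" using norm by (simp add: inner_vec_def[of x x])
  define h s where "h k = half (x $ k)" and "s k = coord_sum (x $ k)" for k
  have code: "glue_code h s" and dual: "x $ k \<in> D6_dual" for k
    using assms(1) by (simp_all add: niemeier_eq niemeier_coords_def h_def[abs_def] s_def[abs_def])
  have even_h: "even (h k)" for k
  proof (rule ccontr)
    assume k: "odd (h k)"
    then obtain l where l: "l \<noteq> k" "odd (h l)" using glue_code_odd_pair code by blast
    have ge: "3 / 2 \<le> x $ m \<bullet> x $ m" if "odd (h m)" for m
    proof -
      have "(\<Sum>i\<in>(UNIV::6 set). 1 / 4) \<le> (\<Sum>i\<in>UNIV. x $ m $ i * x $ m $ i)"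
        using D6_dual_half_odd[OF dual] that by (intro sum_mono) (simp add: h_def power2_eq_square)
      then show ?thesis by (simp add: inner_vec_sum sum_6)
    qed
    have "(\<Sum>m\<in>{k, l}. x $ m \<bullet> x $ m) \<le> (\<Sum>m\<in>UNIV. x $ m \<bullet> x $ m)"
      by (intro sum_mono2) auto
    then show False using ge[OF k] ge[OF l(2)] l(1) sumn by simp
  qed
  have ints: "x $ k $ i \<in> \<int>" for k i
    using D6_dual_Ints[OF dual] even_h by (simp add: h_def)
  have even_s: "even (s k)" for k
  proof (rule ccontr)
    assume "odd (s k)"
    moreover have "even (s m) \<longleftrightarrow> even (s 1)" for m
      using code even_h exhaust_4[of m] unfolding glue_code_def by (elim disjE) (simp_all, blast+)
    ultimately have odd: "odd (s m)" for m by blast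
    have "x $ m \<noteq> 0" for m using odd[of m] by (auto simp: s_def)
    then have "(\<Sum>m\<in>(UNIV::4 set). 1) \<le> (\<Sum>m\<in>UNIV. x $ m \<bullet> x $ m)"
      using int_vec_norm_ge_1[OF ints] by (intro sum_mono) auto
    then show False using sumn by simp
  qed
  have root: "x $ k \<in> D6_root_lattice" for k
    using dual even_h even_s by (simp add: D6_root_lattice_def h_def s_def)
  have "x \<noteq> 0" using norm by auto
  then obtain k where k: "x $ k \<noteq> 0" by (auto simp: vec_eq_iff)
  have ge2: "2 \<le> x $ m \<bullet> x $ m" if m: "x $ m \<noteq> 0" for m
  proof -
    obtain e where e: "x $ m \<bullet> x $ m = 2 * of_int e" using D6_root_lattice_norm_even[OF root] .
    have "0 < x $ m \<bullet> x $ m" using m by simp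
    then have "0 < real_of_int e" unfolding e by simp
    then have "1 \<le> real_of_int e" by simp
    with e show ?thesis by simp
  qed
  have other: "x $ m = 0" if "m \<noteq> k" for m
  proof (rule ccontr)
    assume m: "x $ m \<noteq> 0"
    have "(\<Sum>l\<in>{k, m}. x $ l \<bullet> x $ l) \<le> (\<Sum>l\<in>UNIV. x $ l \<bullet> x $ l)"
      by (intro sum_mono2) auto
    then show False using ge2[OF k] ge2[OF m] that sumn by simp
  qed
  have x: "x = in_copy k (x $ k)" using other by (auto simp: vec_eq_iff in_copy_nth)
  have "x $ k \<bullet> x $ k = 2"
    using sumn other by (simp add: sum.remove[of UNIV k])
  then obtain u w where "u \<in> signed_axes" "w \<in> signed_axes" "u \<bullet> w = 0" "x $ k = u + w"
    using int_vec_norm_2[of "x $ k"] ints by blast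
  then show ?thesis using that[of k u w] x by simp
qed

section \<open>Uniqueness of the embedding\<close>

lemma signed_axes_uminus [simp]: "- v \<in> signed_axes \<longleftrightarrow> v \<in> signed_axes"
  unfolding signed_axes_def mem_Collect_eq by (metis minus_minus)

lemma signed_axes_inner:
  assumes "u \<in> signed_axes" "w \<in> signed_axes"
  shows "u \<bullet> w = 1 \<and> w = u \<or> u \<bullet> w = -1 \<and> w = - u \<or> u \<bullet> w = 0"
  using assms unfolding signed_axes_def by (auto simp: inner_axis_axis split: if_splits)

lemma signed_axes_inner_self: "u \<in> signed_axes \<Longrightarrow> u \<bullet> u = 1"
  unfolding signed_axes_def by (auto simp: inner_axis_axis split: if_splits)

text \<open>The roots of D_n; the orthogonality excludes \<open>u + u\<close> and
  \<open>u - u\<close>.\<close>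

definition axis_pairs :: "(real ^ 'n) set" where
  "axis_pairs = {u + w |u w. u \<in> signed_axes \<and> w \<in> signed_axes \<and> u \<bullet> w = 0}"

text \<open>The product -1 requires \<open>q\<close> or \<open>- p\<close> among the summands of
  \<open>v\<close>; the other summand, negated, is the new axis. The second alternative continues
  the chain after rewriting \<open>p - q\<close> as \<open>(- q) - (- p)\<close>.\<close>

lemma axis_pair_step:
  assumes p: "p \<in> signed_axes" and q: "q \<in> signed_axes" and pq: "p \<bullet> q = 0"
    and v: "v \<in> axis_pairs" and pv: "(p - q) \<bullet> v = -1"
  obtains r where "r \<in> signed_axes" "r \<bullet> p = 0" "r \<bullet> q = 0" "v = q - r \<or> v = - p - r"
proof -
  obtain u w where uw: "u \<in> signed_axes" "w \<in> signed_axes" "u \<bullet> w = 0" "v = u + w"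
    using v by (auto simp: axis_pairs_def)
  note step = that
  have eq: "p \<bullet> u - q \<bullet> u + p \<bullet> w - q \<bullet> w = -1" using pv uw(4) by (simp add: inner_simps)
  have *: thesis if "a \<in> signed_axes" "b \<in> signed_axes" "a \<bullet> b = 0" "v = a + b"
    "p \<bullet> a - q \<bullet> a + p \<bullet> b - q \<bullet> b = -1" "a = - p \<or> a = q" for a b
  proof (rule step[of "- b"])
    show "- b \<in> signed_axes" using \<open>b \<in> _\<close> by simp
    show "- b \<bullet> p = 0" "- b \<bullet> q = 0" "v = q - - b \<or> v = - p - - b"
      using that pq signed_axes_inner_self[OF p] signed_axes_inner_self[OF q]
      by (auto simp: inner_commute)
  qed
  \<comment> \<open>Otherwise no term on the left of \<open>eq\<close> is negative.\<close>
  have "u = - p \<or> u = q \<or> w = - p \<or> w = q"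
  proof (rule ccontr)
    assume "\<not> ?thesis"
    then have "p \<bullet> u \<ge> 0" "p \<bullet> w \<ge> 0" "q \<bullet> u \<le> 0" "q \<bullet> w \<le> 0"
      using signed_axes_inner[OF p uw(1)] signed_axes_inner[OF p uw(2)]
        signed_axes_inner[OF q uw(1)] signed_axes_inner[OF q uw(2)] by auto
    then show False using eq by linarith
  qed
  moreover have "w \<bullet> u = 0" "v = w + u" "p \<bullet> w - q \<bullet> w + p \<bullet> u - q \<bullet> u = -1"
    using uw eq by (simp_all add: inner_commute)
  ultimately show thesis
    using *[of u w] *[of w u] uw eq by blast
qed

text \<open>Products of roots with axes are integers. The value 1/2 is the one that a wrong
  continuation of the chain produces in \<open>A5_in_axis_pairs\<close>.\<close>

lemma axis_pair_inner_half:
  assumes "f \<in> signed_axes" "v \<in> axis_pairs"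
  shows "2 * (f \<bullet> v) \<noteq> 1"
proof -
  obtain u w where uw: "u \<in> signed_axes" "w \<in> signed_axes" "v = u + w"
    using assms(2) by (auto simp: axis_pairs_def)
  then have "f \<bullet> v = f \<bullet> u + f \<bullet> w" by (simp add: inner_add_right)
  moreover have "f \<bullet> u = 1 \<or> f \<bullet> u = -1 \<or> f \<bullet> u = 0" "f \<bullet> w = 1 \<or> f \<bullet> w = -1 \<or> f \<bullet> w = 0"
    using signed_axes_inner[OF assms(1) uw(1)] signed_axes_inner[OF assms(1) uw(2)] by blast+
  ultimately show ?thesis by auto
qed

text \<open>Each further root has the two continuations of \<open>axis_pair_step\<close>. For the
  second root they merely decide which summand of \<open>v1\<close> is \<open>f1\<close>; from the
  third root on, orthogonality relations reject the one that does not extend the frame.\<close>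

lemma A5_in_axis_pairs:
  fixes v1 v2 v3 v4 v5 :: "real ^ 'n"
  assumes v: "v1 \<in> axis_pairs" "v2 \<in> axis_pairs" "v3 \<in> axis_pairs" "v4 \<in> axis_pairs" "v5 \<in> axis_pairs"
    and adj: "v1 \<bullet> v2 = -1" "v2 \<bullet> v3 = -1" "v3 \<bullet> v4 = -1" "v4 \<bullet> v5 = -1"
    and orth: "v1 \<bullet> v3 = 0" "v1 \<bullet> v4 = 0" "v1 \<bullet> v5 = 0" "v2 \<bullet> v4 = 0" "v2 \<bullet> v5 = 0" "v3 \<bullet> v5 = 0"
  obtains f1 f2 f3 f4 f5 f6 where
    "{f1, f2, f3, f4, f5, f6} \<subseteq> signed_axes"
    "f1 \<bullet> f2 = 0" "f1 \<bullet> f3 = 0" "f1 \<bullet> f4 = 0" "f1 \<bullet> f5 = 0" "f1 \<bullet> f6 = 0"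
    "f2 \<bullet> f3 = 0" "f2 \<bullet> f4 = 0" "f2 \<bullet> f5 = 0" "f2 \<bullet> f6 = 0"
    "f3 \<bullet> f4 = 0" "f3 \<bullet> f5 = 0" "f3 \<bullet> f6 = 0" "f4 \<bullet> f5 = 0" "f4 \<bullet> f6 = 0" "f5 \<bullet> f6 = 0"
    "v1 = f1 - f2" "v2 = f2 - f3" "v3 = f3 - f4" "v4 = f4 - f5" "v5 = f5 - f6"
proof -
  obtain p q where pq: "p \<in> signed_axes" "q \<in> signed_axes" "p \<bullet> q = 0" "v1 = p + q"
    using v(1) by (auto simp: axis_pairs_def)
  have "\<exists>f1 f2 f3. f1 \<in> signed_axes \<and> f2 \<in> signed_axes \<and> f3 \<in> signed_axes \<and>
    f1 \<bullet> f2 = 0 \<and> f1 \<bullet> f3 = 0 \<and> f2 \<bullet> f3 = 0 \<and> v1 = f1 - f2 \<and> v2 = f2 - f3"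
  proof -
    have "- q \<in> signed_axes" "p \<bullet> - q = 0" "(p - - q) \<bullet> v2 = -1"
      using pq adj(1) by simp_all
    then obtain r where r: "r \<in> signed_axes" "r \<bullet> p = 0" "r \<bullet> - q = 0" "v2 = - q - r \<or> v2 = - p - r"
      using axis_pair_step[OF pq(1) _ _ v(2)] by blast
    from r(4) show ?thesis
    proof
      assume "v2 = - q - r"
      then show ?thesis using pq r(1-3)
        by (intro exI[of _ p] exI[of _ "- q"] exI[of _ r]) (simp add: inner_commute)
    next
      assume "v2 = - p - r"
      then show ?thesis using pq r(1-3)
        by (intro exI[of _ q] exI[of _ "- p"] exI[of _ r]) (simp add: inner_commute)
    qed
  qed
  then obtain f1 f2 f3 where f: "f1 \<in> signed_axes" "f2 \<in> signed_axes" "f3 \<in> signed_axes"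
    "f1 \<bullet> f2 = 0" "f1 \<bullet> f3 = 0" "f2 \<bullet> f3 = 0" and v1: "v1 = f1 - f2" and v2: "v2 = f2 - f3" by blast
  have f': "f2 \<bullet> f1 = 0" "f3 \<bullet> f1 = 0" "f3 \<bullet> f2 = 0" using f by (simp_all add: inner_commute)
  note one = signed_axes_inner_self[OF f(1)] signed_axes_inner_self[OF f(2)] signed_axes_inner_self[OF f(3)]
  obtain f4 where f4: "f4 \<in> signed_axes" "f4 \<bullet> f2 = 0" "f4 \<bullet> f3 = 0" "v3 = f3 - f4 \<or> v3 = - f2 - f4"
    using axis_pair_step[OF f(2,3,6) v(3)] adj(2) v2 by blast
  \<comment> \<open>The other continuation gives \<open>f1 - f2\<close>, \<open>f2 - f3\<close>,
    \<open>- f1 - f2\<close>, a genuine chain of type A3 (the one with A3 = D3). Only the fourth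
    root excludes it: its product with \<open>f1\<close> would be 1/2.\<close>
  have v3: "v3 = f3 - f4"
  proof (rule ccontr)
    assume "v3 \<noteq> f3 - f4"
    then have v3: "v3 = - f2 - f4" using f4 by blast
    have "f1 \<bullet> f4 = 1"
      using orth(1) f f' one f4(2) unfolding v1 v3 by (simp add: inner_simps inner_commute)
    then have "f4 = f1" using signed_axes_inner[OF f(1) f4(1)] by auto
    then have "2 * (f1 \<bullet> v4) = 1"
      using orth(2) adj(3) unfolding v1 v3 by (simp add: inner_simps)
    then show False using axis_pair_inner_half[OF f(1) v(4)] by blast
  qed
  have f14: "f1 \<bullet> f4 = 0"
    using orth(1) f f' f4(2) unfolding v1 v3 by (simp add: inner_simps inner_commute)
  have f4': "f3 \<bullet> f4 = 0" "f2 \<bullet> f4 = 0" "f4 \<bullet> f1 = 0" using f4 f14 by (simp_all add: inner_commute)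
  obtain f5 where f5: "f5 \<in> signed_axes" "f5 \<bullet> f3 = 0" "f5 \<bullet> f4 = 0" "v4 = f4 - f5 \<or> v4 = - f3 - f5"
    using axis_pair_step[OF f(3) f4(1) f4'(1) v(4)] adj(3) v3 by blast
  have v4: "v4 = f4 - f5"
  proof (rule ccontr)
    assume "v4 \<noteq> f4 - f5"
    then have v4: "v4 = - f3 - f5" using f5 by blast
    have "f2 \<bullet> f5 = 1"
      using orth(4) f f' one f5(2) unfolding v2 v4 by (simp add: inner_simps inner_commute)
    then have "f5 = f2" using signed_axes_inner[OF f(2) f5(1)] by auto
    then show False using orth(2) f f' one unfolding v1 v4 by (simp add: inner_simps)
  qed
  have f25: "f2 \<bullet> f5 = 0"
    using orth(4) f4 f4' f f' f5(2) unfolding v2 v4 by (simp add: inner_simps inner_commute)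
  have f15: "f1 \<bullet> f5 = 0"
    using orth(2) f4 f4' f14 f f' f25 unfolding v1 v4 by (simp add: inner_simps inner_commute)
  have f5': "f3 \<bullet> f5 = 0" "f4 \<bullet> f5 = 0" using f5 by (simp_all add: inner_commute)
  obtain f6 where f6: "f6 \<in> signed_axes" "f6 \<bullet> f4 = 0" "f6 \<bullet> f5 = 0" "v5 = f5 - f6 \<or> v5 = - f4 - f6"
    using axis_pair_step[OF f4(1) f5(1) f5'(2) v(5)] adj(4) v4 by blast
  have v5: "v5 = f5 - f6"
  proof (rule ccontr)
    assume "v5 \<noteq> f5 - f6"
    then have v5: "v5 = - f4 - f6" using f6 by blast
    have "f3 \<bullet> f6 = 1"
      using orth(6) f4' f4 signed_axes_inner_self[OF f4(1)] f6(2) unfolding v3 v5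
      by (simp add: inner_simps inner_commute)
    then have "f6 = f3" using signed_axes_inner[OF f(3) f6(1)] by auto
    then show False using orth(5) f f' one f4' unfolding v2 v5 by (simp add: inner_simps)
  qed
  have f36: "f3 \<bullet> f6 = 0"
    using orth(6) f4 f4' f5' f5 f6(2) unfolding v3 v5 by (simp add: inner_simps inner_commute)
  have f26: "f2 \<bullet> f6 = 0"
    using orth(5) f36 f25 f5' unfolding v2 v5 by (simp add: inner_simps)
  have f16: "f1 \<bullet> f6 = 0"
    using orth(3) f26 f15 f25 unfolding v1 v5 by (simp add: inner_simps)
  show thesis
    by (rule that[of f1 f2 f3 f4 f5 f6])
      (use f f4(1) f5(1) f6 f4' f5' f14 f25 f15 f36 f26 f16 v1 v2 v3 v4 v5 in \<open>auto simp: inner_commute\<close>)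
qed

section \<open>Signed permutations of the coordinates\<close>

definition signed_frame :: "('n::finite \<Rightarrow> real ^ 'n) \<Rightarrow> bool" where
  "signed_frame h \<longleftrightarrow> (\<forall>j. h j \<in> signed_axes) \<and> (\<forall>i j. i \<noteq> j \<longrightarrow> h i \<bullet> h j = 0)"

definition frame_map :: "('n::finite \<Rightarrow> real ^ 'n) \<Rightarrow> real ^ 'n \<Rightarrow> real ^ 'n" where
  "frame_map h v = (\<Sum>j\<in>UNIV. v $ j *\<^sub>R h j)"

text \<open>A signed axis has coordinate sum 1 or -1, so the sum shows the sign whatever the
  position.\<close>

definition odd_signs :: "('n::finite \<Rightarrow> real ^ 'n) \<Rightarrow> bool" where
  "odd_signs h \<longleftrightarrow> odd (card {j. (\<Sum>i\<in>UNIV. h j $ i) < 0})"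

text \<open>Orthogonality keeps the axes distinct, so the frame consists of the columns of a signed
  permutation matrix.\<close>

lemma signed_frame_obtain:
  assumes "signed_frame h"
  obtains \<tau> \<sigma> where "bij \<tau>" "\<And>j. \<sigma> j = 1 \<or> \<sigma> j = -1" "\<And>j. h j = axis (\<tau> j) (\<sigma> j)"
proof -
  have minus: "- axis m 1 = axis m (- 1 :: real)" for m :: 'a
    by (simp add: vec_eq_iff axis_nth)
  have "\<exists>t. (snd t = 1 \<or> snd t = -1) \<and> h j = axis (fst t) (snd t)" for j
  proof -
    have "h j \<in> signed_axes" using assms by (simp add: signed_frame_def)
    then obtain i where "h j = axis i 1 \<or> h j = axis i (- 1)" by (auto simp: signed_axes_def minus)
    then show ?thesis by (metis fst_conv snd_conv)
  qed
  then obtain t where t: "\<And>j. snd (t j) = 1 \<or> snd (t j) = -1" "\<And>j. h j = axis (fst (t j)) (snd (t j))"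
    by metis
  have "inj (\<lambda>j. fst (t j))"
  proof (rule injI, rule ccontr)
    fix i j assume ij: "fst (t i) = fst (t j)" "i \<noteq> j"
    have "h i \<bullet> h j = snd (t i) * snd (t j)"
      by (simp add: t(2) inner_axis_axis ij(1))
    moreover have "h i \<bullet> h j = 0" using assms ij(2) by (simp add: signed_frame_def)
    ultimately show False using t(1)[of i] t(1)[of j] by auto
  qed
  then have "bij (\<lambda>j. fst (t j))" by (simp add: bij_def finite_UNIV_inj_surj)
  then show ?thesis using that[of "\<lambda>j. fst (t j)" "\<lambda>j. snd (t j)"] t by blast
qed

lemma frame_map_nth:
  assumes "inj \<tau>" "\<And>j. h j = axis (\<tau> j) (\<sigma> j)"
  shows "frame_map h v $ (\<tau> j) = \<sigma> j * v $ j"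
proof -
  have "frame_map h v $ (\<tau> j) = (\<Sum>i\<in>UNIV. if i = j then v $ i * \<sigma> i else 0)"
    unfolding frame_map_def assms(2) sum_component
    by (intro sum.cong) (use injD[OF assms(1)] in \<open>auto simp: axis_nth\<close>)
  then show ?thesis by simp
qed

lemma frame_map_linear: "linear (frame_map h)"
  unfolding frame_map_def
  by (rule linearI) (simp_all add: sum.distrib scaleR_add_left scaleR_sum_right)

lemma frame_map_axis: "frame_map h (axis i 1) = h i"
proof -
  have "frame_map h (axis i 1) = (\<Sum>j\<in>UNIV. if j = i then h j else 0)"
    unfolding frame_map_def by (intro sum.cong) (auto simp: axis_nth)
  then show ?thesis by simp
qed

lemma frame_map_inner:
  assumes "signed_frame h"
  shows "frame_map h v \<bullet> frame_map h w = v \<bullet> w"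
proof -
  obtain \<tau> \<sigma> where t: "bij \<tau>" "\<And>j. \<sigma> j = 1 \<or> \<sigma> j = -1" "\<And>j. h j = axis (\<tau> j) (\<sigma> j)"
    by (rule signed_frame_obtain[OF assms]) blast
  have "frame_map h v \<bullet> frame_map h w = (\<Sum>i\<in>UNIV. frame_map h v $ (\<tau> i) * frame_map h w $ (\<tau> i))"
    unfolding inner_vec_sum by (rule sum.reindex_bij_betw[OF t(1), symmetric])
  also have "\<dots> = v \<bullet> w"
    unfolding inner_vec_sum frame_map_nth[OF bij_is_inj[OF t(1)] t(3)]
    by (intro sum.cong) (use t(2) in \<open>auto\<close>, metis minus_mult_minus mult_1 mult_minus1)
  finally show ?thesis .
qed

lemma frame_map_surj: "signed_frame h \<Longrightarrow> surj (frame_map h)"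
proof -
  assume h: "signed_frame h"
  have "inj (frame_map h)"
  proof (rule injI)
    fix v w assume "frame_map h v = frame_map h w"
    then have "frame_map h (v - w) = 0" by (simp add: linear_diff[OF frame_map_linear])
    then have "(v - w) \<bullet> (v - w) = 0" using frame_map_inner[OF h, of "v - w" "v - w"] by simp
    then show "v = w" by simp
  qed
  then show ?thesis by (simp add: linear_injective_imp_surjective[OF frame_map_linear])
qed

text \<open>Signs may vary from coordinate to coordinate because \<open>w $ i + w $ j\<close>
  differs from \<open>w $ i - w $ j\<close> by the integer \<open>2 * w $ j\<close>.\<close>

lemma D6_dual_reindex:
  assumes "w \<in> D6_dual" "\<And>j. v $ j = w $ (\<tau> j) \<or> v $ j = - w $ (\<tau> j)"
  shows "v \<in> D6_dual"
proof -
  have w: "2 * w $ i \<in> \<int>" "w $ i - w $ j \<in> \<int>" for i j using assms(1) unfolding D6_dual_def by blast+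
  have w': "w $ i + w $ j \<in> \<int>" for i j
    using Ints_add[OF w(2)[of i j] w(1)[of j]] by (simp add: add.commute)
  have "2 * v $ i \<in> \<int>" for i
    using assms(2)[of i] w(1)[of "\<tau> i"] by (auto simp: minus_in_Ints_iff)
  moreover have "v $ i - v $ j \<in> \<int>" for i j
    using assms(2)[of i] assms(2)[of j] w(2)[of "\<tau> i" "\<tau> j"] w(2)[of "\<tau> j" "\<tau> i"]
      w'[of "\<tau> i" "\<tau> j"] Ints_minus[OF w'[of "\<tau> i" "\<tau> j"]]
    by auto
  ultimately show ?thesis by (simp add: D6_dual_def)
qed

lemma frame_map_D6_dual:
  assumes "signed_frame h"
  shows "frame_map h v \<in> D6_dual \<longleftrightarrow> v \<in> D6_dual"
proof -
  obtain \<tau> \<sigma> where t: "bij \<tau>" "\<And>j. \<sigma> j = 1 \<or> \<sigma> j = -1" "\<And>j. h j = axis (\<tau> j) (\<sigma> j)"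
    by (rule signed_frame_obtain[OF assms]) blast
  have nth: "frame_map h v $ (\<tau> j) = v $ j \<or> frame_map h v $ (\<tau> j) = - v $ j" for j
    using frame_map_nth[OF bij_is_inj[OF t(1)] t(3), of v j] t(2)[of j] by auto
  have nth': "frame_map h v $ j = v $ (inv_into UNIV \<tau> j) \<or> frame_map h v $ j = - v $ (inv_into UNIV \<tau> j)" for j
    using nth[of "inv_into UNIV \<tau> j"] by (simp add: bij_is_surj[OF t(1)] surj_f_inv_f)
  have "v $ j = frame_map h v $ (\<tau> j) \<or> v $ j = - frame_map h v $ (\<tau> j)" for j
    using nth[of j] by auto
  then show ?thesis using D6_dual_reindex nth' by blast
qed

lemma D6_dual_nth:
  assumes "v \<in> D6_dual"
  obtains m :: int where "2 * v $ i = of_int (half v + 2 * m)"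
proof -
  have "v $ i - v $ 1 \<in> \<int>" using assms by (simp add: D6_dual_def)
  then obtain m where "v $ i - v $ 1 = of_int m" by (auto elim: Ints_cases)
  then have "2 * v $ i = of_int (half v + 2 * m)" using of_int_half[OF assms] by simp
  then show ?thesis by (rule that)
qed

lemma frame_map_half:
  assumes "signed_frame h" "v \<in> D6_dual"
  shows "even (half (frame_map h v)) \<longleftrightarrow> even (half v)"
proof -
  obtain \<tau> \<sigma> where t: "bij \<tau>" "\<And>j. \<sigma> j = 1 \<or> \<sigma> j = -1" "\<And>j. h j = axis (\<tau> j) (\<sigma> j)"
    by (rule signed_frame_obtain[OF assms(1)]) blast
  obtain j where j: "\<tau> j = 1" using t(1) by (metis bij_pointE)
  obtain m where m: "2 * v $ j = of_int (half v + 2 * m)" using D6_dual_nth[OF assms(2)] .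
  have "real_of_int (half (frame_map h v)) = \<sigma> j * (2 * v $ j)"
    using of_int_half[of "frame_map h v"] frame_map_D6_dual[OF assms(1)] assms(2)
      frame_map_nth[OF bij_is_inj[OF t(1)] t(3), of v j] j by simp
  then have "real_of_int (half (frame_map h v)) = of_int (half v + 2 * m) \<or>
      real_of_int (half (frame_map h v)) = of_int (- (half v + 2 * m))"
    unfolding m using t(2)[of j] by auto
  then have "half (frame_map h v) = half v + 2 * m \<or> half (frame_map h v) = - (half v + 2 * m)"
    by (simp only: of_int_eq_iff)
  then show ?thesis by auto
qed

text \<open>Changing the sign of a coordinate subtracts twice that coordinate from the sum, an
  integer with the parity of \<open>half v\<close>. An odd number of changes thus exchanges the
  classes [1] and [3] and fixes [2].\<close>

lemma frame_map_coord_sum: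
  assumes "signed_frame h" "v \<in> D6_dual"
  shows "even (coord_sum (frame_map h v)) \<longleftrightarrow> even (coord_sum v + of_bool (odd_signs h) * half v)"
proof -
  obtain \<tau> \<sigma> where t: "bij \<tau>" "\<And>j. \<sigma> j = 1 \<or> \<sigma> j = -1" "\<And>j. h j = axis (\<tau> j) (\<sigma> j)"
    by (rule signed_frame_obtain[OF assms(1)]) blast
  define N where "N = {j. \<sigma> j = -1}"
  have sum: "(\<Sum>i\<in>UNIV. h j $ i) = \<sigma> j" for j
    unfolding t(3) axis_nth by simp
  have "\<sigma> j < 0 \<longleftrightarrow> \<sigma> j = -1" for j using t(2)[of j] by auto
  then have N: "odd_signs h \<longleftrightarrow> odd (card N)"
    by (simp add: odd_signs_def N_def sum)
  have "\<forall>i. \<exists>m. 2 * v $ i = of_int (half v + 2 * m)"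
  proof
    fix i show "\<exists>m. 2 * v $ i = of_int (half v + 2 * m)"
      by (rule D6_dual_nth[OF assms(2), of i]) blast
  qed
  then obtain m where m: "\<And>i. 2 * v $ i = of_int (half v + 2 * m i)"
    by metis
  have "real_of_int (coord_sum (frame_map h v)) = (\<Sum>i\<in>UNIV. frame_map h v $ i)"
    using assms by (simp add: of_int_coord_sum frame_map_D6_dual)
  also have "\<dots> = (\<Sum>j\<in>UNIV. frame_map h v $ (\<tau> j))"
    by (rule sum.reindex_bij_betw[OF t(1), symmetric])
  also have "\<dots> = (\<Sum>j\<in>UNIV. v $ j - (if j \<in> N then of_int (half v + 2 * m j) else 0))"
    unfolding frame_map_nth[OF bij_is_inj[OF t(1)] t(3)] m[symmetric]
    by (intro sum.cong) (use t(2) in \<open>auto simp: N_def\<close>)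
  also have "\<dots> = (\<Sum>j\<in>UNIV. v $ j) - (\<Sum>j\<in>N. of_int (half v + 2 * m j))"
    by (simp add: sum_subtractf sum.If_cases del: of_int_add of_int_mult)
  also have "\<dots> = of_int (coord_sum v - (\<Sum>j\<in>N. half v + 2 * m j))"
    using of_int_coord_sum[OF assms(2)] by simp
  finally have "coord_sum (frame_map h v) = coord_sum v - (\<Sum>j\<in>N. half v + 2 * m j)"
    by (simp only: of_int_eq_iff)
  then have "coord_sum (frame_map h v) = coord_sum v - (int (card N) * half v + 2 * (\<Sum>j\<in>N. m j))"
    by (simp add: sum.distrib sum_distrib_left)
  then show ?thesis by (simp add: N)
qed

lemma glue_code_cong:
  assumes "\<And>k. even (h k) \<longleftrightarrow> even (h' k)" "\<And>k. even (s k) \<longleftrightarrow> even (s' k)"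
  shows "glue_code h s \<longleftrightarrow> glue_code h' s'"
  by (simp only: glue_code_def even_add assms)

text \<open>The assumption on \<open>q\<close> is the invariance of the glue code under a
  permutation of the copies combined with the effect of the frames: by
  \<open>frame_map_coord_sum\<close> they add \<open>half\<close> to \<open>coord_sum\<close> in
  every copy when \<open>e\<close> holds.\<close>

lemma niemeier_isometry:
  assumes h: "\<And>k. signed_frame (h k)" "\<And>k. odd_signs (h k) \<longleftrightarrow> e"
    and q: "bij q" "\<And>a s. glue_code (\<lambda>m. a (q m)) (\<lambda>m. s (q m) + of_bool e * a (q m)) \<longleftrightarrow> glue_code a s"
  shows "lattice_isometry neg_form niemeier_D6_4 neg_form niemeier_D6_4
    (\<lambda>x. \<chi> k. frame_map (h k) (x $ q k))" (is "lattice_isometry _ _ _ _ ?g")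
proof -
  have lin: "linear ?g"
    by (rule linearI) (simp_all add: vec_eq_iff linear_add[OF frame_map_linear] linear_scale[OF frame_map_linear])
  have inner: "?g x \<bullet> ?g y = x \<bullet> y" for x y
  proof -
    have "?g x \<bullet> ?g y = (\<Sum>k\<in>UNIV. x $ q k \<bullet> y $ q k)"
      by (simp add: inner_vec_def[of "?g x"] frame_map_inner[OF h(1)])
    also have "\<dots> = (\<Sum>k\<in>UNIV. x $ k \<bullet> y $ k)"
      by (rule sum.reindex_bij_betw[OF q(1)])
    finally show ?thesis by (simp add: inner_vec_def[of x])
  qed
  have inj: "inj ?g"
  proof (rule injI)
    fix x y assume "?g x = ?g y"
    moreover have "?g (x - y) = ?g x - ?g y" by (rule linear_diff[OF lin])
    ultimately have "?g (x - y) = 0" by (simp only: diff_self)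
    then have "(x - y) \<bullet> (x - y) = 0" using inner[of "x - y" "x - y"] by (simp only: inner_zero_left)
    then show "x = y" by simp
  qed
  have surj: "surj ?g" using linear_injective_imp_surjective[OF lin inj] by simp
  have mem: "?g x \<in> niemeier_D6_4 \<longleftrightarrow> x \<in> niemeier_D6_4" for x
  proof -
    have all: "(\<forall>k. x $ q k \<in> D6_dual) \<longleftrightarrow> (\<forall>k. x $ k \<in> D6_dual)"
      using q(1) by (metis bij_pointE)
    have "glue_code (\<lambda>k. half (?g x $ k)) (\<lambda>k. coord_sum (?g x $ k)) \<longleftrightarrow>
        glue_code (\<lambda>k. half (x $ k)) (\<lambda>k. coord_sum (x $ k))" if d: "\<forall>k. x $ q k \<in> D6_dual"
    proof -
      have "glue_code (\<lambda>k. half (?g x $ k)) (\<lambda>k. coord_sum (?g x $ k)) \<longleftrightarrow>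
        glue_code (\<lambda>k. half (x $ q k)) (\<lambda>k. coord_sum (x $ q k) + of_bool e * half (x $ q k))"
        using d frame_map_half[OF h(1)] frame_map_coord_sum[OF h(1)] by (intro glue_code_cong) (simp_all add: h(2))
      then show ?thesis by (simp only: q(2)[of "\<lambda>k. half (x $ k)" "\<lambda>k. coord_sum (x $ k)"])
    qed
    then show ?thesis
      unfolding niemeier_eq niemeier_coords_def mem_Collect_eq
      by (simp add: frame_map_D6_dual[OF h(1)] all cong: conj_cong)
  qed
  have "bij_betw ?g niemeier_D6_4 niemeier_D6_4"
    unfolding bij_betw_def
  proof
    show "inj_on ?g niemeier_D6_4" using inj by (rule inj_on_subset) simp
    show "?g ` niemeier_D6_4 = niemeier_D6_4"
      using mem surj by (metis (no_types, lifting) image_iff subsetI subset_antisym surjD)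
  qed
  then show ?thesis
    unfolding lattice_isometry_def neg_form_def using linear_add[OF lin] inner by simp
qed

lemma signed_frame_sum_nonzero:
  assumes "signed_frame h" shows "(\<Sum>i\<in>UNIV. h j $ i) \<noteq> 0"
proof -
  have "h j \<in> signed_axes" using assms by (simp add: signed_frame_def)
  then obtain i where "h j = axis i 1 \<or> h j = - axis i 1" by (auto simp: signed_axes_def)
  then have "(\<Sum>i\<in>UNIV. h j $ i) = 1 \<or> (\<Sum>i\<in>UNIV. h j $ i) = -1"
    by (elim disjE) (simp_all add: axis_nth sum_negf)
  then show ?thesis by linarith
qed

lemma signed_frame_flip:
  fixes h :: "'n::finite \<Rightarrow> real ^ 'n"
  assumes h: "signed_frame h"
  shows "signed_frame (h(a := - h a))" "odd_signs (h(a := - h a)) \<longleftrightarrow> \<not> odd_signs h"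
proof -
  show "signed_frame (h(a := - h a))" using h by (simp add: signed_frame_def)
  define N where "N = {j. (\<Sum>i\<in>UNIV. h j $ i) < 0}"
  have "(\<Sum>i\<in>UNIV. (- h a) $ i) < 0 \<longleftrightarrow> a \<notin> N"
    using signed_frame_sum_nonzero[OF h, of a] unfolding N_def by (simp add: sum_negf linorder_neq_iff) linarith
  then have iff: "j \<in> {j. (\<Sum>i\<in>UNIV. (h(a := - h a)) j $ i) < 0} \<longleftrightarrow>
      j \<in> (if a \<in> N then N - {a} else insert a N)" for j
    by (cases "j = a") (simp_all add: N_def)
  have "{j. (\<Sum>i\<in>UNIV. (h(a := - h a)) j $ i) < 0} = (if a \<in> N then N - {a} else insert a N)"
    by (rule Set.set_eqI) (rule iff)
  moreover have "odd (card (if a \<in> N then N - {a} else insert a N)) \<longleftrightarrow> \<not> odd (card N)"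
  proof (cases "a \<in> N")
    case True
    then have "card N = Suc (card (N - {a}))" by (intro card.remove) simp_all
    then have "odd (card (N - {a})) \<longleftrightarrow> \<not> odd (card N)" by presburger
    then show ?thesis unfolding if_P[OF True] .
  qed simp
  ultimately show "odd_signs (h(a := - h a)) \<longleftrightarrow> \<not> odd_signs h"
    by (simp add: odd_signs_def N_def)
qed

text \<open>Four images remain free once those of the axes 5 and 6 are prescribed, and a sign change
  at one of them corrects the parity.\<close>

lemma signed_frame_extend:
  fixes u w :: "real ^ 6"
  assumes "u \<in> signed_axes" "w \<in> signed_axes" "u \<bullet> w = 0"
  obtains h where "signed_frame h" "h 5 = u" "h 6 = w" "odd_signs h \<longleftrightarrow> e"
proof -
  have "\<exists>i s. (s = 1 \<or> s = -1) \<and> v = s *\<^sub>R axis i 1" if "v \<in> signed_axes" for v :: "real ^ 6"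
  proof -
    obtain i where "v = axis i 1 \<or> v = - axis i 1" using \<open>v \<in> _\<close> by (auto simp: signed_axes_def)
    then have "v = 1 *\<^sub>R axis i 1 \<or> v = (-1) *\<^sub>R axis i 1" by simp
    then show ?thesis by blast
  qed
  then obtain i s j t where u: "s = 1 \<or> s = -1" "u = s *\<^sub>R axis i 1"
    and w: "t = 1 \<or> t = -1" "w = t *\<^sub>R axis j 1"
    using assms(1,2) by metis
  have ij: "i \<noteq> j" using assms(3) u w by (auto simp: inner_axis_axis)
  \<comment> \<open>The first transposition takes 5 to \<open>i\<close>; the second moves the image
    of 6 to \<open>j\<close> and leaves \<open>i\<close> in place.\<close>
  define \<tau> where "\<tau> = Transposition.transpose (Transposition.transpose 5 i 6) j \<circ> Transposition.transpose 5 i"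
  have inj: "inj \<tau>" unfolding \<tau>_def by (intro inj_compose bij_is_inj bij_transpose)
  have "Transposition.transpose 5 i 6 \<noteq> i" by (cases "i = 6") (simp_all add: transpose_def)
  then have \<tau>: "\<tau> 5 = i" "\<tau> 6 = j" using ij by (simp_all add: \<tau>_def transpose_def)
  define h where "h m = (if m = 5 then s else if m = 6 then t else 1) *\<^sub>R axis (\<tau> m) (1::real)" for m
  have h: "signed_frame h"
    unfolding signed_frame_def
  proof (intro conjI allI impI)
    fix m show "h m \<in> signed_axes" using u(1) w(1) by (auto simp: h_def signed_axes_def)
    fix n assume "m \<noteq> n"
    then have "\<tau> m \<noteq> \<tau> n" using inj by (simp add: inj_eq)
    then show "h m \<bullet> h n = 0" by (simp add: h_def inner_axis_axis)
  qed
  have h56: "h 5 = u" "h 6 = w" by (simp_all add: h_def \<tau> u w)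
  show ?thesis
  proof (cases "odd_signs h \<longleftrightarrow> e")
    case True
    then show ?thesis using that h h56 by blast
  next
    case False
    then show ?thesis
      using that[of "h(1 := - h 1)"] signed_frame_flip[OF h, of 1] h56 by simp
  qed
qed

lemma axis_in_signed_axes: "axis i 1 \<in> signed_axes"
  by (auto simp: signed_axes_def)

text \<open>Two permutations take \<open>k\<close> to 1 and \<open>l\<close> to 2, one even and one
  odd. The even one preserves the code as it stands, the odd one after the alteration of
  \<open>s\<close> by an odd number of sign changes.\<close>

lemma glue_code_transitive:
  assumes "k \<noteq> l"
  obtains q :: "4 \<Rightarrow> 4" where "bij q" "q k = 1" "q l = 2"
    "\<And>a s. glue_code (\<lambda>m. a (q m)) (\<lambda>m. s (q m) + of_bool e * a (q m)) \<longleftrightarrow> glue_code a s"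
proof -
  define q where "q n m = (if m = k then 1 else if m = l then 2 else if m = n then 3 else (4::4))" for n m
  have bij: "bij (q n)" if "n \<noteq> k" "n \<noteq> l" for n
  proof -
    have "surj (q n)"
    proof -
      have "1 \<in> range (q n)" "2 \<in> range (q n)" "3 \<in> range (q n)"
        using assms that by (auto simp: q_def image_iff)
      moreover have "\<exists>m. m \<noteq> k \<and> m \<noteq> l \<and> m \<noteq> n"
      proof (rule ccontr)
        assume "\<not> ?thesis"
        then have "(UNIV :: 4 set) \<subseteq> {k, l, n}" by blast
        then have "card (UNIV :: 4 set) \<le> card {k, l, n}" by (intro card_mono) auto
        also have "\<dots> \<le> 3" by (simp add: card_insert_if)
        finally show False by simp
      qed
      then have "4 \<in> range (q n)" by (auto simp: q_def image_iff)
      ultimately have "x \<in> range (q n)" for x using exhaust_4[of x] by (elim disjE) simp_all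
      then show ?thesis by blast
    qed
    then show ?thesis by (simp add: bij_def finite_UNIV_surj_inj)
  qed
  have "\<exists>n. n \<noteq> k \<and> n \<noteq> l \<and> (\<forall>a s. glue_code (\<lambda>m. a (q n m)) (\<lambda>m. s (q n m) + of_bool e * a (q n m)) \<longleftrightarrow> glue_code a s)"
  proof -
    \<comment> \<open>Sums of parities become nested equalities of truth values, after which each
      permutation is a propositional check.\<close>
    have parity: "glue_code (\<lambda>m. a (p m)) (\<lambda>m. s (p m) + of_bool e * a (p m)) \<longleftrightarrow>
      (let A = \<lambda>m. even (a m); S = \<lambda>m. even (s m); T = (\<lambda>m. S m = (e \<longrightarrow> A m)) in
       (((A (p 1) = A (p 2)) = A (p 3)) = A (p 4)) \<and>
       (((T (p 1) = T (p 2)) = A (p 1)) = A (p 4)) \<and>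
       (((T (p 1) = T (p 3)) = A (p 1)) = A (p 2)) \<and>
       (((T (p 1) = T (p 4)) = A (p 1)) = A (p 3)))" for a s and p :: "4 \<Rightarrow> 4"
      by (cases e) (simp_all only: glue_code_def even_add Let_def of_bool_eq mult_1 mult_zero_left even_zero simp_thms)
    show ?thesis
    proof (cases e)
      case False
      \<comment> \<open>The third entry is the copy that the even permutation with \<open>k\<close>
        to 1 and \<open>l\<close> to 2 sends to 3.\<close>
      have "(k, l) \<in> (\<lambda>(k, l, n::4). (k, l)) ` {(1, 2, 3), (1, 3, 4), (1, 4, 2), (2, 1, 4), (2, 3, 1), (2, 4, 3), (3, 1, 2), (3, 2, 4), (3, 4, 1), (4, 1, 3), (4, 2, 1), (4, 3, 2)}"
        using exhaust_4[of k] exhaust_4[of l] assms by (elim disjE) simp_all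
      then obtain n :: 4 where "(k, l, n) \<in> {(1, 2, 3), (1, 3, 4), (1, 4, 2), (2, 1, 4), (2, 3, 1), (2, 4, 3), (3, 1, 2), (3, 2, 4), (3, 4, 1), (4, 1, 3), (4, 2, 1), (4, 3, 2)}" by force
      then have "n \<noteq> k \<and> n \<noteq> l \<and> (\<forall>a s. glue_code (\<lambda>m. a (q n m)) (\<lambda>m. s (q n m) + of_bool e * a (q n m)) \<longleftrightarrow> glue_code a s)"
        unfolding parity
        by (elim insertE emptyE Pair_inject)
          (simp_all add: False glue_code_def Let_def q_def, (intro allI, argo)+)
      then show ?thesis by blast
    next
      case True
      \<comment> \<open>The odd permutations: the two remaining copies change places.\<close>
      have "(k, l) \<in> (\<lambda>(k, l, n::4). (k, l)) ` {(1, 2, 4), (1, 3, 2), (1, 4, 3), (2, 1, 3), (2, 3, 4), (2, 4, 1), (3, 1, 4), (3, 2, 1), (3, 4, 2), (4, 1, 2), (4, 2, 3), (4, 3, 1)}"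
        using exhaust_4[of k] exhaust_4[of l] assms by (elim disjE) simp_all
      then obtain n :: 4 where "(k, l, n) \<in> {(1, 2, 4), (1, 3, 2), (1, 4, 3), (2, 1, 3), (2, 3, 4), (2, 4, 1), (3, 1, 4), (3, 2, 1), (3, 4, 2), (4, 1, 2), (4, 2, 3), (4, 3, 1)}" by force
      then have "n \<noteq> k \<and> n \<noteq> l \<and> (\<forall>a s. glue_code (\<lambda>m. a (q n m)) (\<lambda>m. s (q n m) + of_bool e * a (q n m)) \<longleftrightarrow> glue_code a s)"
        unfolding parity
        by (elim insertE emptyE Pair_inject)
          (simp_all add: True glue_code_def Let_def q_def, (intro allI, argo)+)
      then show ?thesis by blast
    qed
  qed
  then obtain n where n: "n \<noteq> k" "n \<noteq> l"
    "\<And>a s. glue_code (\<lambda>m. a (q n m)) (\<lambda>m. s (q n m) + of_bool e * a (q n m)) \<longleftrightarrow> glue_code a s"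
    by blast
  show ?thesis
  proof (rule that[of "q n"])
    show "bij (q n)" using bij n by blast
    show "q n k = 1" "q n l = 2" using assms by (simp_all add: q_def)
  qed (rule n(3))
qed

section \<open>Conjugacy of all embeddings\<close>

lemma simple_roots_A5:
  assumes "simple_roots b (Dynkin_A 5) vs"
  obtains v1 v2 v3 v4 v5 where "vs = [v1, v2, v3, v4, v5]"
    "b v1 v1 = -2" "b v2 v2 = -2" "b v3 v3 = -2" "b v4 v4 = -2" "b v5 v5 = -2"
    "b v1 v2 = 1" "b v2 v3 = 1" "b v3 v4 = 1" "b v4 v5 = 1"
    "b v1 v3 = 0" "b v1 v4 = 0" "b v1 v5 = 0" "b v2 v4 = 0" "b v2 v5 = 0" "b v3 v5 = 0"
proof -
  have len: "length vs = 5" using assms by (simp add: simple_roots_def)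
  have gram: "b (vs ! i) (vs ! j) = dynkin_gram (Dynkin_A 5) (i + 1) (j + 1)" if "i < 5" "j < 5" for i j
    using assms that by (simp add: simple_roots_def)
  obtain v1 v2 v3 v4 v5 where vs: "vs = [v1, v2, v3, v4, v5]"
    using len by (auto simp: numeral_eq_Suc length_Suc_conv)
  show ?thesis
    by (rule that[OF vs])
      (use gram[of 0 0] gram[of 1 1] gram[of 2 2] gram[of 3 3] gram[of 4 4]
          gram[of 0 1] gram[of 1 2] gram[of 2 3] gram[of 3 4]
          gram[of 0 2] gram[of 0 3] gram[of 0 4] gram[of 1 3] gram[of 1 4] gram[of 2 4] in
        \<open>simp_all add: vs dynkin_gram_A\<close>)
qed

lemma inner_in_copy: "in_copy k v \<bullet> in_copy l w = (if k = l then v \<bullet> w else 0)"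
  by (auto simp: in_copy_def inner_axis_axis)

lemma niemeier_root_in_copy:
  assumes "x \<in> niemeier_D6_4" "neg_form x x = -2"
  obtains k v where "x = in_copy k v" "v \<in> axis_pairs"
proof -
  obtain k u w where "x = in_copy k (u + w)" "u \<in> signed_axes" "w \<in> signed_axes" "u \<bullet> w = 0"
    using niemeier_root[OF assms] .
  moreover from this have "u + w \<in> axis_pairs" unfolding axis_pairs_def by blast
  ultimately show ?thesis using that[of k "u + w"] by simp
qed

lemma embedding_unique:
  assumes "root_embedding neg_form niemeier_D6_4 [Dynkin_A 5, Dynkin_A 1] psi"
  shows "\<exists>g. lattice_isometry neg_form niemeier_D6_4 neg_form niemeier_D6_4 g \<and> psi = map (map g) phi"
proof -
  let ?N = niemeier_D6_4
  obtain vs ws where psi: "psi = [vs, ws]" and vs: "simple_roots neg_form (Dynkin_A 5) vs"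
    and ws: "simple_roots neg_form (Dynkin_A 1) ws" and sub: "set vs \<subseteq> ?N" "set ws \<subseteq> ?N"
    using assms by (auto simp: root_embedding_def list_all2_Cons1)
  have orth: "\<And>x y. x \<in> set vs \<Longrightarrow> y \<in> set ws \<Longrightarrow> neg_form x y = 0"
  proof -
    have "\<forall>k<length psi. \<forall>l<length psi. k \<noteq> l \<longrightarrow>
        (\<forall>x\<in>set (psi ! k). \<forall>y\<in>set (psi ! l). neg_form x y = 0)"
      using assms by (simp add: root_embedding_def)
    from this[rule_format, of 0 1] show "\<And>x y. x \<in> set vs \<Longrightarrow> y \<in> set ws \<Longrightarrow> neg_form x y = 0"
      by (simp add: psi)
  qed
  obtain z where z: "ws = [z]" and zz: "neg_form z z = -2"
  proof -
    have "length ws = 1" using ws by (simp add: simple_roots_def)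
    then obtain z where "ws = [z]" by (auto simp: length_Suc_conv)
    moreover have "neg_form z z = -2"
      using ws \<open>ws = [z]\<close> by (simp add: simple_roots_def dynkin_gram_def)
    ultimately show ?thesis using that by blast
  qed
  obtain x1 x2 x3 x4 x5 where x: "vs = [x1, x2, x3, x4, x5]"
    and norm: "neg_form x1 x1 = -2" "neg_form x2 x2 = -2" "neg_form x3 x3 = -2" "neg_form x4 x4 = -2" "neg_form x5 x5 = -2"
    and adj: "neg_form x1 x2 = 1" "neg_form x2 x3 = 1" "neg_form x3 x4 = 1" "neg_form x4 x5 = 1"
    and nonadj: "neg_form x1 x3 = 0" "neg_form x1 x4 = 0" "neg_form x1 x5 = 0" "neg_form x2 x4 = 0" "neg_form x2 x5 = 0" "neg_form x3 x5 = 0"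
    using simple_roots_A5[OF vs] .
  have mem: "x1 \<in> ?N" "x2 \<in> ?N" "x3 \<in> ?N" "x4 \<in> ?N" "x5 \<in> ?N" "z \<in> ?N"
    using sub by (simp_all add: x z)
  obtain k v1 where v1: "x1 = in_copy k v1" "v1 \<in> axis_pairs" by (rule niemeier_root_in_copy[OF mem(1) norm(1)])
  obtain k2 v2 where v2: "x2 = in_copy k2 v2" "v2 \<in> axis_pairs" by (rule niemeier_root_in_copy[OF mem(2) norm(2)])
  obtain k3 v3 where v3: "x3 = in_copy k3 v3" "v3 \<in> axis_pairs" by (rule niemeier_root_in_copy[OF mem(3) norm(3)])
  obtain k4 v4 where v4: "x4 = in_copy k4 v4" "v4 \<in> axis_pairs" by (rule niemeier_root_in_copy[OF mem(4) norm(4)])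
  obtain k5 v5 where v5: "x5 = in_copy k5 v5" "v5 \<in> axis_pairs" by (rule niemeier_root_in_copy[OF mem(5) norm(5)])
  obtain l y where y: "z = in_copy l y" "y \<in> axis_pairs" by (rule niemeier_root_in_copy[OF mem(6) zz])
  have same: "k = k2" "k2 = k3" "k3 = k4" "k4 = k5"
    using adj by (auto simp: v1 v2 v3 v4 v5 neg_form_def inner_in_copy split: if_splits)
  then have k: "k2 = k" "k3 = k" "k4 = k" "k5 = k" by simp_all
  have adj': "v1 \<bullet> v2 = -1" "v2 \<bullet> v3 = -1" "v3 \<bullet> v4 = -1" "v4 \<bullet> v5 = -1"
    and nonadj': "v1 \<bullet> v3 = 0" "v1 \<bullet> v4 = 0" "v1 \<bullet> v5 = 0" "v2 \<bullet> v4 = 0" "v2 \<bullet> v5 = 0" "v3 \<bullet> v5 = 0"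
    using adj nonadj by (simp_all add: v1 v2 v3 v4 v5 k neg_form_def inner_in_copy)
  obtain f1 f2 f3 f4 f5 f6 where f: "{f1, f2, f3, f4, f5, f6} \<subseteq> signed_axes"
    "f1 \<bullet> f2 = 0" "f1 \<bullet> f3 = 0" "f1 \<bullet> f4 = 0" "f1 \<bullet> f5 = 0" "f1 \<bullet> f6 = 0"
    "f2 \<bullet> f3 = 0" "f2 \<bullet> f4 = 0" "f2 \<bullet> f5 = 0" "f2 \<bullet> f6 = 0"
    "f3 \<bullet> f4 = 0" "f3 \<bullet> f5 = 0" "f3 \<bullet> f6 = 0" "f4 \<bullet> f5 = 0" "f4 \<bullet> f6 = 0" "f5 \<bullet> f6 = 0"
    and vf: "v1 = f1 - f2" "v2 = f2 - f3" "v3 = f3 - f4" "v4 = f4 - f5" "v5 = f5 - f6"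
    using A5_in_axis_pairs[OF v1(2) v2(2) v3(2) v4(2) v5(2) adj' nonadj'] .
  \<comment> \<open>\<open>phi\<close> lists \<open>d 5\<close> down to \<open>d 1\<close>, so the
    difference of the axes \<open>6 - i\<close> and \<open>7 - i\<close> has to go to
    \<open>f_i - f_(i+1)\<close>. Hence axis \<open>j\<close> goes to minus
    \<open>f_(7-j)\<close>.\<close>
  define h1 where "h1 j = - (if j = 1 then f6 else if j = 2 then f5 else if j = 3 then f4
    else if j = 4 then f3 else if j = 5 then f2 else f1)" for j :: 6
  have h1: "signed_frame h1"
  proof -
    have "\<forall>j. h1 j \<in> signed_axes" using f(1) by (simp add: forall_6 h1_def)
    moreover have "f2 \<bullet> f1 = 0" "f3 \<bullet> f1 = 0" "f4 \<bullet> f1 = 0" "f5 \<bullet> f1 = 0" "f6 \<bullet> f1 = 0"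
      "f3 \<bullet> f2 = 0" "f4 \<bullet> f2 = 0" "f5 \<bullet> f2 = 0" "f6 \<bullet> f2 = 0"
      "f4 \<bullet> f3 = 0" "f5 \<bullet> f3 = 0" "f6 \<bullet> f3 = 0" "f5 \<bullet> f4 = 0" "f6 \<bullet> f4 = 0" "f6 \<bullet> f5 = 0"
      using f(2-) by (simp_all only: inner_commute)
    then have "\<forall>i j. i \<noteq> j \<longrightarrow> h1 i \<bullet> h1 j = 0"
      using f(2-) unfolding forall_6 h1_def by simp
    ultimately show ?thesis by (simp add: signed_frame_def)
  qed
  \<comment> \<open>A root in the copy of the A5 and orthogonal to it would have equal coordinates
    in the frame \<open>h1\<close>; its norm would be six times the square of an integer, which is
    never 2.\<close>
  have kl: "k \<noteq> l"
  proof
    assume kl: "k = l"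
    have "neg_form x1 z = 0" "neg_form x2 z = 0" "neg_form x3 z = 0" "neg_form x4 z = 0" "neg_form x5 z = 0"
      using orth by (simp_all add: x z)
    then have eq: "f1 \<bullet> y = f2 \<bullet> y" "f2 \<bullet> y = f3 \<bullet> y" "f3 \<bullet> y = f4 \<bullet> y" "f4 \<bullet> y = f5 \<bullet> y" "f5 \<bullet> y = f6 \<bullet> y"
      by (simp_all add: v1 v2 v3 v4 v5 y k kl neg_form_def inner_in_copy vf inner_diff_left)
    obtain t where t: "y = frame_map h1 t" using frame_map_surj[OF h1] by (metis surjD)
    have tj: "t $ j = h1 j \<bullet> y" for j
      unfolding t frame_map_axis[symmetric] frame_map_inner[OF h1] by (simp add: inner_axis')
    have tc: "t $ j = - (f1 \<bullet> y)" for j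
      using exhaust_6[of j] eq unfolding tj h1_def by (elim disjE) simp_all
    have "y \<bullet> y = 2" using zz by (simp add: y neg_form_def inner_in_copy)
    moreover have "y \<bullet> y = t \<bullet> t" unfolding t by (rule frame_map_inner[OF h1])
    moreover have "t \<bullet> t = 6 * (f1 \<bullet> y)\<^sup>2"
      unfolding inner_vec_sum[of t t] tc by (simp add: power2_eq_square)
    ultimately have "6 * (f1 \<bullet> y)\<^sup>2 = 2" by simp
    moreover have "f1 \<bullet> y \<in> \<int>"
    proof -
      obtain u w where uw: "u \<in> signed_axes" "w \<in> signed_axes" "y = u + w"
        using y(2) by (auto simp: axis_pairs_def)
      have "f1 \<in> signed_axes" using f(1) by simp
      then have "f1 \<bullet> u \<in> {1, -1, 0}" "f1 \<bullet> w \<in> {1, -1, 0}"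
        using signed_axes_inner[of f1 u] signed_axes_inner[of f1 w] uw by auto
      then show ?thesis by (auto simp: uw inner_add_right)
    qed
    then obtain m where m: "f1 \<bullet> y = of_int m" by (auto elim: Ints_cases)
    ultimately have "real_of_int (6 * m\<^sup>2) = of_int 2" by simp
    then have "6 * m\<^sup>2 = 2" by (simp only: of_int_eq_iff)
    then show False by presburger
  qed
  obtain u w where uw: "u \<in> signed_axes" "w \<in> signed_axes" "u \<bullet> w = 0" "y = u + w"
    using y(2) by (auto simp: axis_pairs_def)
  \<comment> \<open>The A5 fixes the parity; the frames of the other copies are adapted to
    it.\<close>
  define e where "e = odd_signs h1"
  obtain h2 where h2: "signed_frame h2" "h2 5 = u" "h2 6 = w" "odd_signs h2 \<longleftrightarrow> e"
    by (rule signed_frame_extend[OF uw(1-3)])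
  \<comment> \<open>On the two copies that the embedding does not meet, any frame of this parity
    will do.\<close>
  obtain h3 :: "6 \<Rightarrow> real ^ 6" where h3: "signed_frame h3" "odd_signs h3 \<longleftrightarrow> e"
    by (rule signed_frame_extend[OF axis_in_signed_axes[of 5] axis_in_signed_axes[of 6]])
      (simp add: inner_axis_axis)
  define h where "h m = (if m = k then h1 else if m = l then h2 else h3)" for m
  have h: "signed_frame (h m)" "odd_signs (h m) \<longleftrightarrow> e" for m
    using h1 h2 h3 by (simp_all add: h_def e_def)
  obtain q where q: "bij q" "q k = 1" "q l = 2"
    "\<And>a s. glue_code (\<lambda>m. a (q m)) (\<lambda>m. s (q m) + of_bool e * a (q m)) \<longleftrightarrow> glue_code a s"
    using glue_code_transitive[OF kl] by metis
  \<comment> \<open>\<open>q\<close> points backwards: copy \<open>m\<close> of the image is filled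
    from copy \<open>q m\<close>, which is why \<open>q\<close> takes \<open>k\<close> to 1 and
    \<open>l\<close> to 2.\<close>
  let ?g = "\<lambda>x. \<chi> m. frame_map (h m) (x $ q m)"
  have iso: "lattice_isometry neg_form ?N neg_form ?N ?g"
    by (rule niemeier_isometry[OF h q(1,4)])
  have qk: "q m = 1 \<longleftrightarrow> m = k" "q m = 2 \<longleftrightarrow> m = l" for m
    using q(2,3) injD[OF bij_is_inj[OF q(1)]] by metis+
  have map0: "frame_map g 0 = 0" for g :: "6 \<Rightarrow> real ^ 6"
    by (rule linear_0[OF frame_map_linear])
  have g1: "?g (in_copy 1 v) = in_copy k (frame_map h1 v)" for v
    by (simp add: vec_eq_iff in_copy_nth qk h_def map0)
  have g2: "?g (in_copy 2 v) = in_copy l (frame_map h2 v)" for v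
    using kl by (auto simp: vec_eq_iff in_copy_nth qk h_def map0)
  note frame_d = d_simps linear_diff[OF frame_map_linear] linear_add[OF frame_map_linear] frame_map_axis
  have A5: "?g (in_copy 1 (d 5)) = x1" "?g (in_copy 1 (d 4)) = x2" "?g (in_copy 1 (d 3)) = x3"
    "?g (in_copy 1 (d 2)) = x4" "?g (in_copy 1 (d 1)) = x5"
    unfolding g1 v1(1) v2(1) v3(1) v4(1) v5(1) k vf frame_d h1_def by simp_all
  have A1: "?g (in_copy 2 (d 6)) = z"
    unfolding g2 y(1) uw(4) frame_d h2(2,3) ..
  have "psi = map (map ?g) phi"
    unfolding phi_def psi x z list.map A5 A1 ..
  then show ?thesis
    by (rule exI[of "\<lambda>g. lattice_isometry neg_form ?N neg_form ?N g \<and> psi = map (map g) phi" ?g, OF conjI[OF iso]])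
qed

section \<open>Quotients of lattices\<close>

locale quotient_lattice =
  fixes W R :: "'v::real_vector set"
  assumes subspace_W: "int_module.subspace W" and subspace_R: "int_module.subspace R" and R_le: "R \<subseteq> W"
begin

abbreviation G where "G \<equiv> lattice_group W"
abbreviation coset where "coset x \<equiv> R #>\<^bsub>G\<^esub> x"

lemma carrier_G [simp]: "carrier G = W" and mult_G [simp]: "x \<otimes>\<^bsub>G\<^esub> y = x + y" and one_G [simp]: "\<one>\<^bsub>G\<^esub> = 0"
  by (simp_all add: lattice_group_def)

lemma comm_group_G: "comm_group G"
proof (rule comm_groupI)
  fix x assume "x \<in> carrier G"
  then show "\<exists>y\<in>carrier G. y \<otimes>\<^bsub>G\<^esub> x = \<one>\<^bsub>G\<^esub>"
    using int_module.subspace_neg[OF subspace_W] by (intro bexI[of _ "- x"]) auto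
qed (use subspace_W in \<open>auto simp: int_module.subspace_def algebra_simps\<close>)

sublocale G: comm_group G by (rule comm_group_G)

lemma subgroup_R: "subgroup R G"
proof (rule G.subgroupI)
  show "inv\<^bsub>G\<^esub> x \<in> R" if "x \<in> R" for x
  proof -
    have "inv\<^bsub>G\<^esub> x = - x"
      using that R_le int_module.subspace_neg[OF subspace_W] by (intro G.inv_equality) auto
    then show ?thesis using that int_module.subspace_neg[OF subspace_R] by simp
  qed
qed (use R_le subspace_R in \<open>auto simp: int_module.subspace_def\<close>)

sublocale normal R G
  using subgroup_R by (rule G.subgroup_imp_normal)

sublocale Q: comm_group "G Mod R"
  using G.abelian_FactGroup[OF subgroup_R] .

lemma coset_def: "coset x = (\<lambda>r. r + x) ` R"
  by (auto simp: r_coset_def)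

lemma coset_eq_iff: "coset x = coset y \<longleftrightarrow> x - y \<in> R"
proof
  assume "coset x = coset y"
  moreover have "x \<in> coset x"
    unfolding coset_def using int_module.subspace_0[OF subspace_R] by (intro image_eqI[of _ _ 0]) auto
  ultimately show "x - y \<in> R" by (auto simp: coset_def)
next
  assume xy: "x - y \<in> R"
  then have yx: "y - x \<in> R" using int_module.subspace_neg[OF subspace_R xy] by simp
  show "coset x = coset y"
    unfolding coset_def
  proof (intro equalityI image_subsetI)
    fix r assume r: "r \<in> R"
    show "r + x \<in> (\<lambda>r. r + y) ` R"
      using int_module.subspace_add[OF subspace_R r xy] by (intro image_eqI[of _ _ "r + (x - y)"]) auto
    show "r + y \<in> (\<lambda>r. r + x) ` R"
      using int_module.subspace_add[OF subspace_R r yx] by (intro image_eqI[of _ _ "r + (y - x)"]) auto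
  qed
qed

lemma coset_one: "coset x = \<one>\<^bsub>G Mod R\<^esub> \<longleftrightarrow> x \<in> R"
proof -
  have "coset 0 = R" by (simp add: coset_def)
  then show ?thesis using coset_eq_iff[of x 0] by simp
qed

lemma carrier_Q: "carrier (G Mod R) = coset ` W"
  by (simp add: carrier_FactGroup)

lemma int_pow_G: "x \<in> W \<Longrightarrow> x [^]\<^bsub>G\<^esub> (k::int) = of_int k *\<^sub>R x"
proof -
  assume x: "x \<in> W"
  have nat: "x [^]\<^bsub>G\<^esub> (n::nat) = of_nat n *\<^sub>R x" for n
    by (induction n) (simp_all add: nat_pow_def scaleR_left_distrib add.commute)
  have inv: "inv\<^bsub>G\<^esub> y = - y" if "y \<in> W" for y
    using that int_module.subspace_neg[OF subspace_W] by (intro G.inv_equality) auto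
  have W: "of_nat n *\<^sub>R x \<in> W" for n
    using int_module.subspace_scale[OF subspace_W x, of "int n"] by simp
  show ?thesis
  proof (cases "k < 0")
    case True
    then have "x [^]\<^bsub>G\<^esub> k = inv\<^bsub>G\<^esub> (of_nat (nat (- k)) *\<^sub>R x)"
      unfolding int_pow_def2 nat by (simp only: if_True)
    also have "\<dots> = - (of_nat (nat (- k)) *\<^sub>R x)" by (rule inv[OF W])
    finally show ?thesis using True by simp
  qed (simp add: int_pow_def2 nat)
qed

lemma group_hom_coset: "group_hom G (G Mod R) coset"
  by (simp add: group_hom_def group_hom_axioms_def G.is_group Q.is_group r_coset_hom_Mod)

lemma int_pow_coset: "x \<in> W \<Longrightarrow> coset x [^]\<^bsub>G Mod R\<^esub> (k::int) = coset (of_int k *\<^sub>R x)"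
  using group_hom.hom_int_pow[OF group_hom_coset, of x k] by (simp add: int_pow_G)

lemma nat_pow_coset: "x \<in> W \<Longrightarrow> coset x [^]\<^bsub>G Mod R\<^esub> (n::nat) = coset (of_nat n *\<^sub>R x)"
  using int_pow_coset[of x "int n"] by (simp add: int_pow_int)

lemma generate_coset:
  assumes "w \<in> W"
  shows "generate (G Mod R) {coset w} = range (\<lambda>k::int. coset (of_int k *\<^sub>R w))"
proof -
  have "coset w \<in> carrier (G Mod R)" using assms by (simp add: carrier_Q)
  then show ?thesis
    by (auto simp: Q.generate_pow int_pow_coset[OF assms])
qed

lemma torsion_elements_Q:
  "torsion_elements (G Mod R) = coset ` {x \<in> W. \<exists>n::nat. n > 0 \<and> of_nat n *\<^sub>R x \<in> R}"
proof (intro equalityI subsetI)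
  fix c assume "c \<in> torsion_elements (G Mod R)"
  then obtain x n where "x \<in> W" "c = coset x" "n > 0" "c [^]\<^bsub>G Mod R\<^esub> (n::nat) = \<one>\<^bsub>G Mod R\<^esub>"
    by (auto simp: torsion_elements_def carrier_Q simp del: one_FactGroup)
  moreover from this have "of_nat n *\<^sub>R x \<in> R"
    unfolding coset_one[symmetric] by (simp add: nat_pow_coset del: one_FactGroup)
  ultimately show "c \<in> coset ` {x \<in> W. \<exists>n::nat. n > 0 \<and> of_nat n *\<^sub>R x \<in> R}" by blast
next
  fix c assume "c \<in> coset ` {x \<in> W. \<exists>n::nat. n > 0 \<and> of_nat n *\<^sub>R x \<in> R}"
  then obtain x n where x: "x \<in> W" "c = coset x" "n > (0::nat)" "of_nat n *\<^sub>R x \<in> R" by blast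
  then have "c [^]\<^bsub>G Mod R\<^esub> n = \<one>\<^bsub>G Mod R\<^esub>"
    using x(4) unfolding coset_one[symmetric] by (simp add: nat_pow_coset del: one_FactGroup)
  then show "c \<in> torsion_elements (G Mod R)"
    using x unfolding torsion_elements_def carrier_Q by blast
qed

end

text \<open>
  Coordinates on a lattice \<open>W\<close> in which \<open>R\<close> is cut out by one integer and two parities, so that
  \<open>W/R\<close> is isomorphic to \<open>\<int> \<times> \<int>/2 \<times> \<int>/2\<close>.
\<close>

locale lattice_coordinates = quotient_lattice +
  fixes a p q :: "'a \<Rightarrow> int" and w e1 e2 :: 'a
  assumes add: "\<And>x y. x \<in> W \<Longrightarrow> y \<in> W \<Longrightarrow> a (x + y) = a x + a y"
    "\<And>x y. x \<in> W \<Longrightarrow> y \<in> W \<Longrightarrow> p (x + y) = p x + p y"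
    "\<And>x y. x \<in> W \<Longrightarrow> y \<in> W \<Longrightarrow> q (x + y) = q x + q y"
    and R_eq: "R = {x \<in> W. a x = 0 \<and> even (p x) \<and> even (q x)}"
    and w: "w \<in> W" "a w = 1"
    and e1: "e1 \<in> W" "a e1 = 0" "odd (p e1)" "even (q e1)"
    and e2: "e2 \<in> W" "a e2 = 0" "even (p e2)" "odd (q e2)"
begin

text \<open>Integer multiples are derived from additivity on \<open>W\<close>, outside of which
  nothing is known about the coordinate functions.\<close>

lemma scale:
  assumes add: "\<And>x y. x \<in> W \<Longrightarrow> y \<in> W \<Longrightarrow> f (x + y) = f x + (f y :: int)" and x: "x \<in> W"
  shows "f (of_int k *\<^sub>R x) = k * f x"
proof -
  have zero: "f 0 = 0" using add[of 0 0] int_module.subspace_0[OF subspace_W] by simp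
  have nat: "f (of_nat n *\<^sub>R y) = int n * f y" if y: "y \<in> W" for n y
  proof (induction n)
    case (Suc n)
    have "of_nat n *\<^sub>R y \<in> W" using int_module.subspace_scale[OF subspace_W y, of "int n"] by simp
    then have "f (of_nat n *\<^sub>R y + y) = f (of_nat n *\<^sub>R y) + f y" using y by (rule add)
    then show ?case using Suc by (simp add: algebra_simps)
  qed (simp add: zero)
  have neg: "f (- y) = - f y" if y: "y \<in> W" for y
    using add[OF y int_module.subspace_neg[OF subspace_W y]] zero by simp
  show ?thesis
  proof (cases "k \<ge> 0")
    case True
    then show ?thesis using nat[OF x, of "nat k"] by simp
  next
    case False
    then have "of_int k *\<^sub>R x = of_nat (nat (- k)) *\<^sub>R (- x)" by simp
    then show ?thesis using nat[OF int_module.subspace_neg[OF subspace_W x], of "nat (- k)"] neg[OF x] False by simp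
  qed
qed

lemma scale_a: "x \<in> W \<Longrightarrow> a (of_int k *\<^sub>R x) = k * a x"
  and scale_p: "x \<in> W \<Longrightarrow> p (of_int k *\<^sub>R x) = k * p x"
  and scale_q: "x \<in> W \<Longrightarrow> q (of_int k *\<^sub>R x) = k * q x"
  by (rule scale; simp add: add)+

lemma W_scale: "x \<in> W \<Longrightarrow> of_int k *\<^sub>R x \<in> W"
  by (rule int_module.subspace_scale[OF subspace_W])

lemma double_in_R: "x \<in> W \<Longrightarrow> a x = 0 \<Longrightarrow> 2 *\<^sub>R x \<in> R"
  using W_scale[of x 2] scale_a[of x 2] scale_p[of x 2] scale_q[of x 2] by (simp add: R_eq)

text \<open>Doubling kills both parities, so this is at once the primitive closure of
  \<open>R\<close> and the preimage of the torsion of W/R.\<close>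

definition P where "P = {x \<in> W. a x = 0}"

lemma hull_iff: assumes "x \<in> W" shows "(\<exists>k::int. k \<noteq> 0 \<and> of_int k *\<^sub>R x \<in> R) \<longleftrightarrow> x \<in> P"
proof
  assume "\<exists>k::int. k \<noteq> 0 \<and> of_int k *\<^sub>R x \<in> R"
  then show "x \<in> P" using assms scale_a[OF assms] by (auto simp: R_eq P_def)
next
  assume "x \<in> P"
  then show "\<exists>k::int. k \<noteq> 0 \<and> of_int k *\<^sub>R x \<in> R"
    using double_in_R by (intro exI[of _ 2]) (simp add: P_def)
qed

lemma primitive_closure_R: "primitive_closure W R = P"
  using hull_iff by (auto simp: primitive_closure_def rational_hull_def P_def)

lemma subspace_P: "int_module.subspace P"
proof (rule int_subspaceI)
  show "0 \<in> P" using int_module.subspace_0[OF subspace_R] by (simp add: R_eq P_def)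
  show "x + y \<in> P" if "x \<in> P" "y \<in> P" for x y
    using that add(1) int_module.subspace_add[OF subspace_W] by (simp add: P_def)
  show "- x \<in> P" if "x \<in> P" for x
    using that scale_a[of x "-1"] int_module.subspace_neg[OF subspace_W] by (simp add: P_def)
qed

lemma torsion_P: "torsion_elements (G Mod R) = coset ` P"
proof -
  have "{x \<in> W. \<exists>n::nat. n > 0 \<and> of_nat n *\<^sub>R x \<in> R} = P"
  proof (intro equalityI subsetI)
    fix x assume "x \<in> {x \<in> W. \<exists>n::nat. n > 0 \<and> of_nat n *\<^sub>R x \<in> R}"
    then obtain n where "x \<in> W" "n > (0::nat)" "of_nat n *\<^sub>R x \<in> R" by blast
    then show "x \<in> P" using hull_iff[of x] by (auto intro!: exI[of _ "int n"])
  next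
    fix x assume "x \<in> P"
    then show "x \<in> {x \<in> W. \<exists>n::nat. n > 0 \<and> of_nat n *\<^sub>R x \<in> R}"
      using double_in_R[of x] by (auto simp: P_def intro!: exI[of _ 2])
  qed
  then show ?thesis by (simp add: torsion_elements_Q)
qed

lemma diff_in_P: assumes "x \<in> W" shows "x - of_int (a x) *\<^sub>R w \<in> P"
proof -
  have W: "of_int (- a x) *\<^sub>R w \<in> W" using w by (intro W_scale)
  then have "x + of_int (- a x) *\<^sub>R w \<in> W" using assms by (intro int_module.subspace_add[OF subspace_W])
  moreover have "a (x + of_int (- a x) *\<^sub>R w) = 0"
    using assms w W scale_a[OF w(1), of "- a x"] add(1)[OF assms W] by simp
  ultimately show ?thesis by (simp add: P_def)
qed

lemma has_rank_Q: "has_rank (G Mod R) 1"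
  unfolding has_rank_def
proof (intro exI conjI)
  let ?S = "{coset w}"
  show "?S \<subseteq> carrier (G Mod R)" using w by (simp add: carrier_Q)
  then have c: "coset w [^]\<^bsub>G Mod R\<^esub> k \<in> carrier (G Mod R)" for k :: int by (intro Q.int_pow_closed) simp
  show "finite ?S" "card ?S = 1" by simp_all
  show "\<forall>c::'a set \<Rightarrow> int. (\<Otimes>\<^bsub>G Mod R\<^esub>s\<in>?S. s [^]\<^bsub>G Mod R\<^esub> c s) = \<one>\<^bsub>G Mod R\<^esub> \<longrightarrow> (\<forall>s\<in>?S. c s = 0)"
  proof (intro allI impI)
    fix c :: "'a set \<Rightarrow> int"
    assume "(\<Otimes>\<^bsub>G Mod R\<^esub>s\<in>?S. s [^]\<^bsub>G Mod R\<^esub> c s) = \<one>\<^bsub>G Mod R\<^esub>"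
    moreover have "(\<Otimes>\<^bsub>G Mod R\<^esub>s\<in>?S. s [^]\<^bsub>G Mod R\<^esub> c s) = coset w [^]\<^bsub>G Mod R\<^esub> c (coset w)"
      using c by (subst Q.finprod_insert) (auto simp del: one_FactGroup mult_FactGroup)
    ultimately have "of_int (c (coset w)) *\<^sub>R w \<in> R"
      using coset_one int_pow_coset[OF w(1)] by simp
    then have "a (of_int (c (coset w)) *\<^sub>R w) = 0" by (simp only: R_eq mem_Collect_eq)
    then have "c (coset w) = 0" unfolding scale_a[OF w(1)] by (simp add: w(2))
    then show "\<forall>s\<in>?S. c s = 0" by simp
  qed
  show "\<forall>g\<in>carrier (G Mod R). \<exists>n::nat. n > 0 \<and> g [^]\<^bsub>G Mod R\<^esub> n \<in> generate (G Mod R) ?S"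
  proof
    fix g assume "g \<in> carrier (G Mod R)"
    then obtain x where x: "x \<in> W" "g = coset x" by (auto simp: carrier_Q)
    \<comment> \<open>\<open>w\<close> generates the quotient up to torsion, and the torsion has
      exponent 2; hence the power 2 of \<open>g\<close>.\<close>
    have "2 *\<^sub>R (x - of_int (a x) *\<^sub>R w) \<in> R" using diff_in_P[OF x(1)] double_in_R by (simp add: P_def)
    then have "2 *\<^sub>R x - of_int (2 * a x) *\<^sub>R w \<in> R" by (simp add: scaleR_right_diff_distrib)
    then have "coset (2 *\<^sub>R x) = coset (of_int (2 * a x) *\<^sub>R w)" by (simp only: coset_eq_iff)
    moreover have "g [^]\<^bsub>G Mod R\<^esub> (2::nat) = coset (2 *\<^sub>R x)"
      by (simp add: x nat_pow_coset)
    ultimately have "g [^]\<^bsub>G Mod R\<^esub> (2::nat) \<in> generate (G Mod R) ?S"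
      unfolding generate_coset[OF w(1)] by (intro range_eqI) (rule trans)
    then show "\<exists>n::nat. n > 0 \<and> g [^]\<^bsub>G Mod R\<^esub> n \<in> generate (G Mod R) ?S"
      by (intro exI[of _ 2]) simp
  qed
qed

lemma w_not_torsion: "coset w \<notin> torsion_elements (G Mod R)"
proof
  assume "coset w \<in> torsion_elements (G Mod R)"
  then obtain x where x: "x \<in> P" "coset w = coset x" by (auto simp: torsion_P)
  then have "w - x \<in> R" by (simp add: coset_eq_iff)
  then have "a (w - x + x) = a (w - x) + a x" using x by (intro add(1)) (auto simp: R_eq P_def)
  then show False using \<open>w - x \<in> R\<close> x w by (simp add: R_eq P_def)
qed

lemma generate_mod_P:
  "carrier (lattice_group W Mod P) = generate (lattice_group W Mod P) {P #>\<^bsub>lattice_group W\<^esub> w}"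
proof -
  interpret P: quotient_lattice W P
    by unfold_locales (use subspace_W subspace_P in \<open>auto simp: P_def\<close>)
  show ?thesis
    unfolding P.generate_coset[OF w(1)] P.carrier_Q
  proof (intro equalityI image_subsetI)
    fix x assume x: "x \<in> W"
    have "P.coset x = P.coset (of_int (a x) *\<^sub>R w)"
      using diff_in_P[OF x] by (simp only: P.coset_eq_iff)
    then show "P.coset x \<in> range (\<lambda>k::int. P.coset (of_int k *\<^sub>R w))" by (rule range_eqI)
  next
    fix k :: int show "P.coset (of_int k *\<^sub>R w) \<in> P.coset ` W" using W_scale[OF w(1)] by simp
  qed
qed

text \<open>The first isomorphism theorem for the pair of parities on \<open>P\<close>, with
  \<open>e1\<close> and \<open>e2\<close> supplying surjectivity.\<close>

lemma torsion_iso: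
  "(G Mod R)\<lparr>carrier := torsion_elements (G Mod R)\<rparr> \<cong> integer_mod_group 2 \<times>\<times> integer_mod_group 2"
proof -
  let ?Z = "integer_mod_group 2 \<times>\<times> integer_mod_group 2"
  interpret P: quotient_lattice P R
    by unfold_locales (use subspace_P subspace_R in \<open>auto simp: P_def R_eq\<close>)
  define h where "h x = (p x mod 2, q x mod 2)" for x
  have "group ?Z" by (intro DirProd_group group_integer_mod_group)
  moreover have "h \<in> hom P.G ?Z"
  proof (rule homI)
    fix x assume "x \<in> carrier P.G"
    then show "h x \<in> carrier ?Z" by (simp add: h_def carrier_integer_mod_group)
  next
    fix x y assume "x \<in> carrier P.G" "y \<in> carrier P.G"
    then have "x \<in> W" "y \<in> W" unfolding P.carrier_G by (simp_all add: P_def)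
    then show "h (x \<otimes>\<^bsub>P.G\<^esub> y) = h x \<otimes>\<^bsub>?Z\<^esub> h y"
      by (simp add: h_def add mod_add_eq)
  qed
  ultimately have hom: "group_hom P.G ?Z h"
    by (simp add: group_hom_def group_hom_axioms_def P.G.is_group)
  have "carrier ?Z \<subseteq> h ` carrier P.G"
  proof
    fix z assume "z \<in> carrier ?Z"
    then have z: "z \<in> {(0, 0), (1, 0), (0, 1), (1, 1)}"
      by (cases z) (auto simp: carrier_integer_mod_group)
    have P: "0 \<in> P" "e1 \<in> P" "e2 \<in> P" "e1 + e2 \<in> P"
      using e1 e2 int_module.subspace_0[OF subspace_P] int_module.subspace_add[OF subspace_P, of e1 e2]
      by (simp_all add: P_def)
    have "0 \<in> R" by (rule int_module.subspace_0[OF subspace_R])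
    then have "h 0 = (0, 0)" by (simp add: h_def R_eq)
    moreover have "h e1 = (1, 0)" "h e2 = (0, 1)" "h (e1 + e2) = (1, 1)"
      using e1 e2 by (simp_all add: h_def add odd_iff_mod_2_eq_one[symmetric])
    ultimately show "z \<in> h ` carrier P.G"
      using z P by (auto intro: image_eqI[of _ _ 0] image_eqI[of _ _ e1] image_eqI[of _ _ e2] image_eqI[of _ _ "e1 + e2"])
  qed
  then have "h ` carrier P.G = carrier ?Z"
    using group_hom.hom_closed[OF hom] by blast
  moreover have "kernel P.G ?Z h = R"
  proof -
    have "x \<in> R \<longleftrightarrow> x \<in> P \<and> even (p x) \<and> even (q x)" for x by (auto simp: R_eq P_def)
    then show ?thesis by (auto simp: kernel_def h_def)
  qed
  ultimately have "P.G Mod R \<cong> ?Z"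
    using group_hom.FactGroup_iso[OF hom] by simp
  \<comment> \<open>Cosets and their products are formed by the group operation alone, so P/R is
    equal, not only isomorphic, to the torsion part of W/R.\<close>
  moreover have "P.G Mod R = (G Mod R)\<lparr>carrier := torsion_elements (G Mod R)\<rparr>"
  proof -
    have "rcosets\<^bsub>P.G\<^esub> R = torsion_elements (G Mod R)"
      unfolding torsion_P RCOSETS_def by (auto simp: r_coset_def)
    moreover have "set_mult P.G = set_mult G"
      by (simp add: set_mult_def fun_eq_iff)
    ultimately show ?thesis by (simp add: FactGroup_def)
  qed
  ultimately show ?thesis by simp
qed

end

text \<open>Two candidates differ by a vector orthogonal to the root sublattice with a nonzero
  integer multiple inside it, and definiteness makes this vector zero. That is the uniqueness hidden
  in the \<open>THE\<close> of \<open>root_orth_proj\<close>.\<close>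

lemma root_orth_proj_eq:
  fixes b :: "'v::real_vector \<Rightarrow> 'v \<Rightarrow> real"
  assumes b: "\<And>x. linear (b x)" "\<And>x y. b x y = b y x"
    and definite: "\<And>x. x \<in> root_sublattice b W \<Longrightarrow> b x x = 0 \<Longrightarrow> x = 0"
    and y: "y \<in> orth_compl b (rational_hull W) (root_sublattice b W)"
      "x - y \<in> rational_hull (root_sublattice b W)"
  shows "root_orth_proj b W x = y"
  unfolding root_orth_proj_def
proof (rule the_equality)
  let ?R = "root_sublattice b W"
  show "y \<in> orth_compl b (rational_hull W) ?R \<and> x - y \<in> rational_hull ?R" using y by blast
  fix z assume z: "z \<in> orth_compl b (rational_hull W) ?R \<and> x - z \<in> rational_hull ?R"
  obtain k l :: int where kl: "k \<noteq> 0" "of_int k *\<^sub>R (x - y) \<in> ?R" "l \<noteq> 0" "of_int l *\<^sub>R (x - z) \<in> ?R"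
    using y z by (auto simp: rational_hull_def)
  have sub: "int_module.subspace ?R" unfolding root_sublattice_def by (rule int_module.subspace_span)
  \<comment> \<open>The factor \<open>k * l\<close> clears the denominators of both differences at
    once.\<close>
  have "of_int l *\<^sub>R of_int k *\<^sub>R (x - y) - of_int k *\<^sub>R of_int l *\<^sub>R (x - z) \<in> ?R"
    by (rule int_module.subspace_diff[OF sub int_module.subspace_scale[OF sub kl(2), of l]
          int_module.subspace_scale[OF sub kl(4), of k]])
  moreover have eq: "of_int l *\<^sub>R of_int k *\<^sub>R (x - y) - of_int k *\<^sub>R of_int l *\<^sub>R (x - z)
      = of_int (k * l) *\<^sub>R (z - y)"
    by (simp add: algebra_simps)
  ultimately have in_R: "of_int (k * l) *\<^sub>R (z - y) \<in> ?R" by simp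
  have zero: "b r z = 0" "b r y = 0" if "r \<in> ?R" for r
    using y z that b(2)[of r] by (auto simp: orth_compl_def)
  have "b r (of_int (k * l) *\<^sub>R (z - y)) = of_int (k * l) * (b r z - b r y)" for r
    by (simp only: linear_diff[OF b(1)] linear_scale[OF b(1)] real_scaleR_def)
  then have "b (of_int (k * l) *\<^sub>R (z - y)) (of_int (k * l) *\<^sub>R (z - y)) = 0"
    using zero[OF in_R] by simp
  then have "of_int (k * l) *\<^sub>R (z - y) = 0" by (rule definite[OF in_R])
  then show "z = y" using kl by simp
qed

section \<open>The orthogonal complement of the embedding\<close>

lemma symmetric_form_neg_form: "symmetric_form neg_form"
  by unfold_locales (auto simp: neg_form_def inner_commute inner_add_right intro!: linearI)

lemma inner_in_copy_right: "x \<bullet> in_copy k v = x $ k \<bullet> v"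
  by (simp add: in_copy_def inner_axis)

lemma neg_form_in_copy: "neg_form (in_copy k u) (in_copy l v) = (if k = l then - (u \<bullet> v) else 0)"
  by (simp add: neg_form_def inner_in_copy)

lemma d_gram:
  assumes "i \<in> {1..6}" "j \<in> {1..6}"
  shows "- (d i \<bullet> d j) = dynkin_gram (Dynkin_D 6) i j"
  using assms unfolding atLeastAtMost_1_6
  by (elim insertE emptyE) (simp_all add: d_simps inner_simps inner_axis_axis dynkin_gram_D)

lemma d_in_D6: "i \<in> {1..6} \<Longrightarrow> d i \<in> D6_root_lattice"
  unfolding D6_root_lattice_eq by (intro int_module.span_base imageI)

lemma d_in_niemeier: "i \<in> {1..6} \<Longrightarrow> in_copy k (d i) \<in> niemeier_D6_4"
  by (intro in_copy_D6 d_in_D6)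

lemma set_concat_phi:
  "set (concat phi) = {in_copy 1 (d 5), in_copy 1 (d 4), in_copy 1 (d 3), in_copy 1 (d 2), in_copy 1 (d 1), in_copy 2 (d 6)}"
  by (auto simp: phi_def)

lemma root_embedding_phi: "root_embedding neg_form niemeier_D6_4 [Dynkin_A 5, Dynkin_A 1] phi"
proof -
  have "set (concat phi) \<subseteq> niemeier_D6_4"
    unfolding set_concat_phi by (simp only: insert_subset empty_subsetI simp_thms d_in_niemeier[simplified]) (simp add: d_in_niemeier)
  moreover have "simple_roots neg_form (Dynkin_A 5) (phi ! 0)"
  proof -
    have "neg_form (phi ! 0 ! i) (phi ! 0 ! j) = dynkin_gram (Dynkin_A 5) (i + 1) (j + 1)"
      if "i \<in> {0, 1, 2, 3, 4}" "j \<in> {0, 1, 2, 3, 4}" for i j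
      using that
      by (elim insertE emptyE)
        (simp_all add: phi_def neg_form_in_copy d_simps inner_simps inner_axis_axis dynkin_gram_A)
    moreover have "i \<in> {0, 1, 2, 3, 4}" if "i < 5" for i :: nat using that by auto
    ultimately show ?thesis by (simp add: simple_roots_def phi_def)
  qed
  moreover have "simple_roots neg_form (Dynkin_A 1) (phi ! 1)"
    by (simp add: simple_roots_def phi_def neg_form_in_copy d_simps inner_simps inner_axis_axis dynkin_gram_A)
  ultimately have "set (concat phi) \<subseteq> niemeier_D6_4"
    "list_all2 (simple_roots neg_form) [Dynkin_A 5, Dynkin_A 1] phi"
    by (simp_all add: phi_def)
  moreover have "neg_form x y = 0" if "k < 2" "l < 2" "k \<noteq> l" "x \<in> set (phi ! k)" "y \<in> set (phi ! l)" for k l x y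
  proof -
    have "k = 0 \<and> l = 1 \<or> k = 1 \<and> l = 0" using that by auto
    then show ?thesis using that(4,5) by (auto simp: phi_def neg_form_in_copy)
  qed
  moreover have "length phi = 2" by (simp add: phi_def)
  ultimately show ?thesis unfolding root_embedding_def by simp
qed

lemma int_vec_coords:
  fixes v :: "real ^ 6"
  assumes "v \<in> D6_dual" "even (half v)"
  obtains z :: "6 \<Rightarrow> int" where "\<And>i. v $ i = of_int (z i)"
proof -
  have "\<exists>z. \<forall>i. v $ i = of_int (z i)"
    using D6_dual_Ints[OF assms] unfolding Ints_def by (intro choice) blast
  then show ?thesis using that by blast
qed

text \<open>The real subspace \<open>J\<close> meets the Niemeier lattice exactly in the image, and
  a subspace is closed under division by integers.\<close>

lemma primitive_phi: "primitive_sublattice niemeier_D6_4 (embedding_image phi)"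
proof -
  let ?I = "embedding_image phi"
  have sub: "?I \<subseteq> niemeier_D6_4"
    unfolding embedding_image_def
    by (rule int_module.span_minimal)
      (use root_embedding_phi in \<open>auto simp: root_embedding_def niemeier_D6_4_def\<close>)
  define J where "J = {x :: real ^ 6 ^ 4. (\<Sum>i\<in>UNIV. x $ 1 $ i) = 0 \<and> x $ 2 $ 1 = 0 \<and> x $ 2 $ 2 = 0 \<and>
    x $ 2 $ 3 = 0 \<and> x $ 2 $ 4 = 0 \<and> x $ 2 $ 5 = x $ 2 $ 6 \<and> x $ 3 = 0 \<and> x $ 4 = 0}"
  have "?I \<subseteq> J"
    unfolding embedding_image_def
  proof (rule int_module.span_minimal)
    show "int_module.subspace J"
      by (rule int_subspaceI) (auto simp: J_def sum.distrib sum_negf)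
    show "set (concat phi) \<subseteq> J"
      unfolding set_concat_phi by (simp add: J_def in_copy_nth d_simps axis_nth sum_6)
  qed
  moreover have "x \<in> J" if "of_int k *\<^sub>R x \<in> J" "k \<noteq> 0" for x and k :: int
    using that by (auto simp: J_def sum_distrib_left[symmetric])
  moreover have "x \<in> ?I" if x: "x \<in> niemeier_D6_4" "x \<in> J" for x
  proof -
    have dual: "x $ k \<in> D6_dual" for k using x(1) by (simp add: niemeier_eq niemeier_coords_def)
    have code: "glue_code (\<lambda>k. half (x $ k)) (\<lambda>k. coord_sum (x $ k))"
      using x(1) by (simp add: niemeier_eq niemeier_coords_def)
    have zero: "half (x $ 2) = 0" "half (x $ 3) = 0" "half (x $ 4) = 0" "coord_sum (x $ 1) = 0" "coord_sum (x $ 3) = 0"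
      using x(2) by (simp_all add: J_def half_def coord_sum_def)
    \<comment> \<open>The first equation of the code excludes a half-integral first component,
      because \<open>half\<close> vanishes on the other three.\<close>
    have "even (half (x $ 1))" using code zero by (simp add: glue_code_def)
    then obtain z where z: "\<And>i. x $ 1 $ i = of_int (z i)"
      using int_vec_coords[OF dual] by metis
    obtain y where y: "\<And>i. x $ 2 $ i = of_int (y i)"
      using int_vec_coords[OF dual[of 2]] zero by (metis even_zero)
    have "real_of_int (\<Sum>i\<in>UNIV. z i) = of_int 0" using x(2) by (simp add: J_def z)
    then have "(\<Sum>i\<in>UNIV. z i) = 0" by (simp only: of_int_eq_iff)
    then have z6: "z 6 = - (z 1 + z 2 + z 3 + z 4 + z 5)" by (simp add: sum_6)
    have J2: "y 1 = 0" "y 2 = 0" "y 3 = 0" "y 4 = 0" "y 5 = y 6" "x $ 3 = 0" "x $ 4 = 0"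
      using x(2) by (simp_all add: J_def y)
    \<comment> \<open>Partial sums along the chain; a vector of coordinate sum 0 closes up at
      \<open>d 5\<close>.\<close>
    have "x = of_int (z 1) *\<^sub>R in_copy 1 (d 1) + of_int (z 1 + z 2) *\<^sub>R in_copy 1 (d 2)
        + of_int (z 1 + z 2 + z 3) *\<^sub>R in_copy 1 (d 3) + of_int (z 1 + z 2 + z 3 + z 4) *\<^sub>R in_copy 1 (d 4)
        + of_int (z 1 + z 2 + z 3 + z 4 + z 5) *\<^sub>R in_copy 1 (d 5) + of_int (y 6) *\<^sub>R in_copy 2 (d 6)"
      (is "x = ?x")
      by (simp add: vec_eq_iff forall_4 forall_6 in_copy_nth d_simps axis_nth z y z6 J2)
    moreover have "?x \<in> ?I"
      unfolding embedding_image_def set_concat_phi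
      by (intro int_module.span_add int_module.span_scale int_module.span_base) simp_all
    ultimately show ?thesis by simp
  qed
  ultimately have "primitive_closure niemeier_D6_4 ?I \<subseteq> ?I"
    by (auto simp: primitive_closure_def rational_hull_def subset_iff)
  moreover have "?I \<subseteq> primitive_closure niemeier_D6_4 ?I"
    using sub by (auto simp: primitive_closure_def rational_hull_def intro!: exI[of _ 1])
  ultimately show ?thesis using sub by (simp add: primitive_sublattice_def)
qed

section \<open>The complement and its root sublattice\<close>

definition phi_perp :: "(real ^ 6 ^ 4) set" where
  "phi_perp = orth_compl neg_form niemeier_D6_4 (embedding_image phi)"

lemma phi_perp_iff:
  "x \<in> phi_perp \<longleftrightarrow> x \<in> niemeier_coords \<and> (\<forall>i. x $ 1 $ i = x $ 1 $ 1) \<and> x $ 2 $ 6 = - (x $ 2 $ 5)"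
proof -
  have "(\<forall>y\<in>embedding_image phi. neg_form x y = 0) \<longleftrightarrow> (\<forall>y\<in>set (concat phi). neg_form x y = 0)"
  proof
    assume *: "\<forall>y\<in>set (concat phi). neg_form x y = 0"
    show "\<forall>y\<in>embedding_image phi. neg_form x y = 0"
    proof
      fix y assume "y \<in> embedding_image phi"
      then have y: "y \<in> zspan (set (concat phi))" by (simp add: embedding_image_def)
      show "neg_form x y = 0"
      proof (rule symmetric_form.orth_zspan[OF symmetric_form_neg_form _ int_module.span_base y])
        show "x \<in> {x}" by simp
      qed (use * in blast)
    qed
  qed (auto simp: embedding_image_def intro: int_module.span_base)
  also have "\<dots> \<longleftrightarrow> (\<forall>i. x $ 1 $ i = x $ 1 $ 1) \<and> x $ 2 $ 6 = - (x $ 2 $ 5)"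
    unfolding set_concat_phi neg_form_def
    by (auto simp: inner_in_copy_right d_simps inner_simps inner_axis forall_6)
  finally show ?thesis by (auto simp: phi_perp_def orth_compl_def niemeier_eq)
qed

text \<open>The explicit form of the root sublattice, confirmed in
  \<open>root_sublattice_phi_perp\<close>. The parity in the fourth copy follows from the glue
  code.\<close>

definition phi_perp_root :: "(real ^ 6 ^ 4) set" where
  "phi_perp_root = {x \<in> phi_perp. half (x $ 1) = 0 \<and> even (half (x $ 2)) \<and> even (half (x $ 3))}"

text \<open>In the second copy the complement of \<open>d 6\<close> in D6 is the sum of the A1
  spanned by \<open>d 5\<close> and this D4 on the first four axes.\<close>

definition D4_roots :: "(real ^ 6) list" where
  "D4_roots = [axis 1 1 - axis 2 1, axis 2 1 - axis 3 1, axis 3 1 - axis 4 1, axis 3 1 + axis 4 1]"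

definition phi_perp_roots :: "(real ^ 6 ^ 4) list list" where
  "phi_perp_roots = [[in_copy 2 (d 5)], map (in_copy 2) D4_roots,
     map (\<lambda>i. in_copy 3 (d i)) [1, 2, 3, 4, 5, 6], map (\<lambda>i. in_copy 4 (d i)) [1, 2, 3, 4, 5, 6]]"

lemma phi_perp_dual: "x \<in> phi_perp \<Longrightarrow> x $ k \<in> D6_dual"
  by (simp add: phi_perp_iff niemeier_coords_def)

lemma subspace_phi_perp: "int_module.subspace phi_perp"
proof (rule int_subspaceI)
  show "0 \<in> phi_perp"
    using int_module.subspace_0[OF subspace_niemeier_coords] by (simp add: phi_perp_iff)
  show "x + y \<in> phi_perp" if "x \<in> phi_perp" "y \<in> phi_perp" for x y
  proof -
    have "(x + y) $ 1 $ i = (x + y) $ 1 $ 1" for i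
      using that unfolding phi_perp_iff vector_add_component by metis
    then show ?thesis
      using that int_module.subspace_add[OF subspace_niemeier_coords] by (simp add: phi_perp_iff)
  qed
  show "- x \<in> phi_perp" if "x \<in> phi_perp" for x
  proof -
    have "(- x) $ 1 $ i = (- x) $ 1 $ 1" for i
      using that unfolding phi_perp_iff vector_uminus_component by metis
    then show ?thesis
      using that int_module.subspace_neg[OF subspace_niemeier_coords] by (simp add: phi_perp_iff)
  qed
qed

lemma phi_perp_half_add:
  "x \<in> phi_perp \<Longrightarrow> y \<in> phi_perp \<Longrightarrow> half ((x + y) $ k) = half (x $ k) + half (y $ k)"
  by (simp add: half_add phi_perp_dual)

lemma phi_perp_half_uminus: "x \<in> phi_perp \<Longrightarrow> half ((- x) $ k) = - half (x $ k)"
  by (simp add: half_uminus phi_perp_dual)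

lemma subspace_phi_perp_root: "int_module.subspace phi_perp_root"
proof (rule int_subspaceI)
  show "0 \<in> phi_perp_root"
    using int_module.subspace_0[OF subspace_phi_perp] by (simp add: phi_perp_root_def)
  show "x + y \<in> phi_perp_root" if "x \<in> phi_perp_root" "y \<in> phi_perp_root" for x y
    using that int_module.subspace_add[OF subspace_phi_perp] phi_perp_half_add
    by (simp add: phi_perp_root_def del: vector_add_component)
  show "- x \<in> phi_perp_root" if "x \<in> phi_perp_root" for x
    using that int_module.subspace_neg[OF subspace_phi_perp] phi_perp_half_uminus
    by (simp add: phi_perp_root_def del: vector_uminus_component)
qed

text \<open>With all \<open>half\<close> even, the code carries the even coordinate sum of the zero
  first component over to the other copies.\<close>

lemma phi_perp_root_D6:
  assumes "x \<in> phi_perp_root"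
  shows "x $ 1 = 0" "x $ k \<in> D6_root_lattice"
proof -
  have x: "x \<in> phi_perp" and h: "half (x $ 1) = 0" "even (half (x $ 2))" "even (half (x $ 3))"
    using assms by (simp_all add: phi_perp_root_def)
  have const: "x $ 1 $ i = x $ 1 $ 1" for i using x unfolding phi_perp_iff by blast
  have "x $ 1 $ 1 = 0" using of_int_half[OF phi_perp_dual[OF x], of 1] h(1) by simp
  then show x1: "x $ 1 = 0" using const by (simp add: vec_eq_iff)
  have code: "glue_code (\<lambda>k. half (x $ k)) (\<lambda>k. coord_sum (x $ k))"
    using x by (simp add: phi_perp_iff niemeier_coords_def)
  have "even (half (x $ 4))" using code h by (simp add: glue_code_def)
  moreover have "even (coord_sum (x $ 2))" "even (coord_sum (x $ 3))" "even (coord_sum (x $ 4))"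
    using code h x1 \<open>even (half (x $ 4))\<close> by (simp_all add: glue_code_def)
  ultimately have "\<forall>k. even (half (x $ k)) \<and> even (coord_sum (x $ k))"
    using h x1 by (simp add: forall_4)
  then show "x $ k \<in> D6_root_lattice"
    using phi_perp_dual[OF x] by (simp add: D6_root_lattice_def)
qed

lemma phi_perp_roots_subset: "set (concat phi_perp_roots) \<subseteq> {x \<in> phi_perp. neg_form x x = -2}"
proof -
  have D4: "v \<in> D6_root_lattice \<and> v \<bullet> v = 2 \<and> v $ 6 = - v $ 5" if "v \<in> set D4_roots" for v
  proof -
    \<comment> \<open>The highest root of the D4 spanned by the last four simple roots of
      D6.\<close>
    have last: "axis 3 1 + axis 4 1 = d 3 + (d 4 + (d 4 + (d 5 + d 6)))"
      by (simp add: vec_eq_iff forall_6 d_simps axis_nth)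
    have "axis 3 1 + axis 4 1 \<in> D6_root_lattice"
      unfolding last D6_root_lattice_eq by (intro int_module.span_add int_module.span_base imageI) simp_all
    moreover have "d 1 \<in> D6_root_lattice" "d 2 \<in> D6_root_lattice" "d 3 \<in> D6_root_lattice"
      by (intro d_in_D6; simp)+
    ultimately have "v \<in> D6_root_lattice" using that by (auto simp: D4_roots_def d_simps)
    moreover have "v \<bullet> v = 2 \<and> v $ 6 = - v $ 5"
      using that by (auto simp: D4_roots_def inner_simps inner_axis_axis axis_nth)
    ultimately show ?thesis by blast
  qed
  have copy: "in_copy k v \<in> phi_perp" if "v \<in> D6_root_lattice" "k = 2 \<and> v $ 6 = - v $ 5 \<or> k = 3 \<or> k = 4" for k v
    using in_copy_D6[OF that(1), of k] that(2) unfolding niemeier_eq phi_perp_iff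
    by (auto simp: in_copy_nth)
  have D6: "d i \<in> D6_root_lattice \<and> d i \<bullet> d i = 2" if "i \<in> {1..6}" for i
    using d_in_D6[OF that] d_gram[OF that that] by (simp add: dynkin_gram_def)
  have "d 5 $ 6 = - d 5 $ 5" by (simp add: d_simps axis_nth)
  then have "x \<in> phi_perp \<and> neg_form x x = -2" if "x \<in> set l" "l \<in> set phi_perp_roots" for x l
    using that D4 D6 copy by (auto simp: phi_perp_roots_def neg_form_in_copy)
  then show ?thesis by auto
qed

text \<open>A root in the first copy would be constant and integral, with norm six times a square.
  In the other copies a root is integral and therefore has even \<open>half\<close>.\<close>

lemma phi_perp_root_roots:
  assumes "x \<in> phi_perp" "neg_form x x = -2"
  shows "x \<in> phi_perp_root"
proof -
  have x: "x \<in> niemeier_D6_4" using assms(1) by (simp add: niemeier_eq phi_perp_iff)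
  obtain k v where kv: "x = in_copy k v" "v \<in> axis_pairs"
    by (rule niemeier_root_in_copy[OF x assms(2)])
  have ints: "v $ i \<in> \<int>" for i
    using kv(2) by (auto simp: axis_pairs_def signed_axes_def axis_nth intro!: Ints_add)
  have "v \<bullet> v = 2" using assms(2) by (simp add: kv neg_form_in_copy)
  have "k \<noteq> 1"
  proof
    assume "k = 1"
    then have const: "v $ i = v $ 1" for i using assms(1) by (simp add: phi_perp_iff kv in_copy_nth)
    have "v \<bullet> v = (\<Sum>i\<in>(UNIV :: 6 set). (v $ 1)\<^sup>2)"
      unfolding inner_vec_sum by (intro sum.cong refl) (metis const power2_eq_square)
    then have "v \<bullet> v = 6 * (v $ 1)\<^sup>2" by simp
    moreover obtain m where "v $ 1 = of_int m" using ints by (auto elim: Ints_cases)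
    ultimately have "real_of_int (6 * m\<^sup>2) = of_int 2" using \<open>v \<bullet> v = 2\<close> by simp
    then have "6 * m\<^sup>2 = 2" by (simp only: of_int_eq_iff)
    then show False by presburger
  qed
  moreover have "even (half v)"
  proof -
    obtain m where "v $ 1 = of_int m" using ints by (auto elim: Ints_cases)
    then have "half v = 2 * m" unfolding half_def by (metis floor_of_int of_int_mult of_int_numeral)
    then show ?thesis by simp
  qed
  ultimately show ?thesis
    using assms(1) by (simp add: phi_perp_root_def kv in_copy_nth)
qed

lemma phi_perp_root_span: "phi_perp_root \<subseteq> zspan (set (concat phi_perp_roots))"
proof
  fix x assume x: "x \<in> phi_perp_root"
  note D6 = phi_perp_root_D6[OF x]
  have copy: "in_copy k v \<in> zspan (set (concat phi_perp_roots))"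
    if "v \<in> zspan A" "in_copy k ` A \<subseteq> set (concat phi_perp_roots)" for k v A
    using that(1)
  proof (induction rule: int_module.span_induct_alt)
    case base
    then show ?case by (simp add: linear_0[OF in_copy_linear] int_module.span_zero)
  next
    case (step c u w)
    have "in_copy k u \<in> set (concat phi_perp_roots)" using step(1) that(2) by blast
    then show ?case
      unfolding linear_add[OF in_copy_linear] linear_scale[OF in_copy_linear]
      by (intro int_module.span_add[OF int_module.span_scale[OF int_module.span_base] step(2)])
  qed
  have img: "in_copy k ` d ` {1..6} \<subseteq> set (concat phi_perp_roots)" if "k = 3 \<or> k = 4" for k
    using that unfolding atLeastAtMost_1_6 by (auto simp: phi_perp_roots_def)
  have "in_copy 3 (x $ 3) \<in> zspan (set (concat phi_perp_roots))"
    "in_copy 4 (x $ 4) \<in> zspan (set (concat phi_perp_roots))"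
    using D6(2)[of 3] D6(2)[of 4] img unfolding D6_root_lattice_eq by (blast intro: copy)+
  moreover have "in_copy 2 (x $ 2) \<in> zspan (set (concat phi_perp_roots))"
  proof (rule copy)
    show "in_copy 2 ` set (d 5 # D4_roots) \<subseteq> set (concat phi_perp_roots)"
      by (auto simp: phi_perp_roots_def)
    have dual: "x $ 2 \<in> D6_dual" and half: "even (half (x $ 2))" and coord_sum: "even (coord_sum (x $ 2))"
      using D6(2)[of 2] by (simp_all add: D6_root_lattice_def)
    obtain z where z: "\<And>i. x $ 2 $ i = of_int (z i)" using int_vec_coords[OF dual half] by metis
    have z6: "z 6 = - z 5"
    proof -
      have "x $ 2 $ 6 = - (x $ 2 $ 5)" using x by (simp add: phi_perp_root_def phi_perp_iff)
      then have "real_of_int (z 6) = of_int (- z 5)" by (simp add: z)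
      then show ?thesis by (simp only: of_int_eq_iff)
    qed
    have "real_of_int (coord_sum (x $ 2)) = of_int (z 1 + z 2 + z 3 + z 4)"
      using of_int_coord_sum[OF dual] by (simp add: z z6 sum_6)
    then have "coord_sum (x $ 2) = z 1 + z 2 + z 3 + z 4" by (simp only: of_int_eq_iff)
    then have "even (z 1 + z 2 + z 3 + z 4)" using coord_sum by (simp only:)
    then obtain m where "z 1 + z 2 + z 3 + z 4 = 2 * m" by (rule evenE)
    then have m: "z 4 = 2 * m - z 1 - z 2 - z 3" by simp
    \<comment> \<open>\<open>d 5\<close> takes up the last two coordinates, which are opposite. The
      other coefficients solve for the first four coordinates in D4, with \<open>m\<close> half of
      the coordinate sum.\<close>
    have "x $ 2 = of_int (z 5) *\<^sub>R d 5 + of_int (z 1) *\<^sub>R (axis 1 1 - axis 2 1)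
        + of_int (z 1 + z 2) *\<^sub>R (axis 2 1 - axis 3 1)
        + of_int (z 1 + z 2 + z 3 - m) *\<^sub>R (axis 3 1 - axis 4 1) + of_int m *\<^sub>R (axis 3 1 + axis 4 1)"
      (is "_ = ?v") by (simp add: vec_eq_iff forall_6 d_simps axis_nth z z6 m)
    moreover have "?v \<in> zspan (set (d 5 # D4_roots))"
      by (intro int_module.span_add int_module.span_scale int_module.span_base) (simp_all add: D4_roots_def)
    ultimately show "x $ 2 \<in> zspan (set (d 5 # D4_roots))" by simp
  qed
  moreover have "in_copy 1 (x $ 1) = 0" using D6(1) by (simp add: linear_0[OF in_copy_linear])
  ultimately show "x \<in> zspan (set (concat phi_perp_roots))"
    by (subst sum_in_copy) (simp add: int_module.span_add)
qed

text \<open>Three inclusions form a circle, so the three lattices agree.\<close>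

lemma root_sublattice_phi_perp:
  "root_sublattice neg_form phi_perp = phi_perp_root"
  "embedding_image phi_perp_roots = phi_perp_root"
proof -
  have "root_sublattice neg_form phi_perp \<subseteq> phi_perp_root"
    unfolding root_sublattice_def
    by (rule int_module.span_minimal[OF _ subspace_phi_perp_root]) (use phi_perp_root_roots in blast)
  moreover have "embedding_image phi_perp_roots \<subseteq> root_sublattice neg_form phi_perp"
    unfolding root_sublattice_def embedding_image_def by (rule int_module.span_mono[OF phi_perp_roots_subset])
  moreover have "phi_perp_root \<subseteq> embedding_image phi_perp_roots"
    using phi_perp_root_span by (simp add: embedding_image_def)
  ultimately show "root_sublattice neg_form phi_perp = phi_perp_root"
    "embedding_image phi_perp_roots = phi_perp_root" by blast+
qed

lemma root_embedding_phi_perp: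
  "root_embedding neg_form phi_perp_root [Dynkin_A 1, Dynkin_D 4, Dynkin_D 6, Dynkin_D 6] phi_perp_roots"
proof -
  have D6: "simple_roots neg_form (Dynkin_D 6) (map (\<lambda>i. in_copy k (d i)) [1, 2, 3, 4, 5, 6])" for k
  proof -
    have nth: "[1, 2, 3, 4, 5, 6::nat] ! i = i + 1" if "i < 6" for i
    proof -
      have "i \<in> {0, 1, 2, 3, 4, 5}" using that by auto
      then show ?thesis by (elim insertE emptyE) simp_all
    qed
    have "neg_form (map (\<lambda>i. in_copy k (d i)) [1, 2, 3, 4, 5, 6] ! i) (map (\<lambda>i. in_copy k (d i)) [1, 2, 3, 4, 5, 6] ! j)
        = dynkin_gram (Dynkin_D 6) (i + 1) (j + 1)" if "i < 6" "j < 6" for i j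
    proof -
      have "map (\<lambda>i. in_copy k (d i)) [1, 2, 3, 4, 5, 6] ! m = in_copy k (d (m + 1))" if "m < 6" for m
        using that by (subst nth_map) (simp_all only: nth, simp)
      moreover have "i + 1 \<in> {1..6}" "j + 1 \<in> {1..6}" using that by simp_all
      ultimately show ?thesis using that by (simp only: neg_form_in_copy d_gram if_True refl)
    qed
    then show ?thesis by (simp only: simple_roots_def length_map dynkin_rank.simps) simp
  qed
  have D4: "simple_roots neg_form (Dynkin_D 4) (map (in_copy k) D4_roots)" for k
  proof -
    have "- (D4_roots ! i \<bullet> D4_roots ! j) = dynkin_gram (Dynkin_D 4) (i + 1) (j + 1)"
      if "i \<in> {0, 1, 2, 3}" "j \<in> {0, 1, 2, 3}" for i j
      using that by (elim insertE emptyE)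
        (simp_all add: D4_roots_def inner_simps inner_axis_axis dynkin_gram_D)
    moreover have "i \<in> {0, 1, 2, 3}" if "i < 4" for i :: nat using that by auto
    moreover have "length D4_roots = 4" by (simp add: D4_roots_def)
    ultimately show ?thesis by (simp add: simple_roots_def neg_form_in_copy)
  qed
  have A1: "simple_roots neg_form (Dynkin_A 1) [in_copy 2 (d 5)]"
    by (simp add: simple_roots_def neg_form_in_copy d_simps inner_simps inner_axis_axis dynkin_gram_A)
  have "set (concat phi_perp_roots) \<subseteq> phi_perp_root"
    using phi_perp_roots_subset phi_perp_root_roots by blast
  moreover have "list_all2 (simple_roots neg_form) [Dynkin_A 1, Dynkin_D 4, Dynkin_D 6, Dynkin_D 6] phi_perp_roots"
    unfolding phi_perp_roots_def by (simp only: list_all2_Cons list_all2_Nil A1 D4 D6 simp_thms)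
  moreover have "neg_form x y = 0"
    if "k < 4" "l < 4" "k \<noteq> l" "x \<in> set (phi_perp_roots ! k)" "y \<in> set (phi_perp_roots ! l)" for k l x y
  proof -
    have D4: "d 5 \<bullet> v = 0" "v \<bullet> d 5 = 0" if "v \<in> set D4_roots" for v
      using that by (auto simp: D4_roots_def d_simps inner_simps inner_axis_axis)
    have kinds: "k = 0 \<and> x = in_copy 2 (d 5) \<or> k = 1 \<and> (\<exists>v\<in>set D4_roots. x = in_copy 2 v) \<or>
        k = 2 \<and> (\<exists>v. x = in_copy 3 v) \<or> k = 3 \<and> (\<exists>v. x = in_copy 4 v)"
      if "k < 4" "x \<in> set (phi_perp_roots ! k)" for k x
    proof -
      have "k = 0 \<or> k = 1 \<or> k = 2 \<or> k = 3" using that(1) by auto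
      then show ?thesis using that(2) by (elim disjE) (auto simp: phi_perp_roots_def)
    qed
    show ?thesis
      using kinds[OF that(1,4)] kinds[OF that(2,5)] that(3)
      by (elim disjE conjE bexE exE) (simp_all add: neg_form_in_copy D4)
  qed
  moreover have "length phi_perp_roots = 4" by (simp add: phi_perp_roots_def)
  ultimately show ?thesis unfolding root_embedding_def by simp
qed

section \<open>The fibration\<close>

text \<open>\<open>lattice_isometry\<close> says nothing about \<open>f\<close> outside the lattice;
  hence the membership conditions throughout, and the inverse \<open>g\<close> along which facts
  about the concrete complement are carried back.\<close>

locale isometric_lattices =
  fixes b :: "'v::real_vector \<Rightarrow> 'v \<Rightarrow> real" and W and b' :: "'w::real_vector \<Rightarrow> 'w \<Rightarrow> real" and W' f
  assumes iso: "lattice_isometry b W b' W' f"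
    and subspace_W: "int_module.subspace W" and subspace_W': "int_module.subspace W'"
begin

definition g where "g = inv_into W f"

lemma bij: "bij_betw f W W'" and f_add: "x \<in> W \<Longrightarrow> y \<in> W \<Longrightarrow> f (x + y) = f x + f y"
  and f_form: "x \<in> W \<Longrightarrow> y \<in> W \<Longrightarrow> b' (f x) (f y) = b x y"
  using iso by (auto simp: lattice_isometry_def)

lemma f_in: "x \<in> W \<Longrightarrow> f x \<in> W'"
  using bij by (auto simp: bij_betw_def)

lemma g_in: "y \<in> W' \<Longrightarrow> g y \<in> W" and f_g: "y \<in> W' \<Longrightarrow> f (g y) = y" and g_f: "x \<in> W \<Longrightarrow> g (f x) = x"
  using bij unfolding g_def by (auto simp: bij_betw_def inv_into_into f_inv_into_f)

lemma g_add: "x \<in> W' \<Longrightarrow> y \<in> W' \<Longrightarrow> g (x + y) = g x + g y"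
  using g_f[of "g x + g y"] f_add[of "g x" "g y"] int_module.subspace_add[OF subspace_W, of "g x" "g y"]
  by (simp add: g_in f_g)

lemma g_zero: "g 0 = 0"
  using g_add[of 0 0] int_module.subspace_0[OF subspace_W'] by simp

lemma g_uminus: "x \<in> W' \<Longrightarrow> g (- x) = - g x"
  using g_add[of x "- x"] int_module.subspace_neg[OF subspace_W', of x] g_zero by (simp add: add_eq_0_iff)

lemma g_form: "x \<in> W' \<Longrightarrow> y \<in> W' \<Longrightarrow> b (g x) (g y) = b' x y"
  using f_form[of "g x" "g y"] by (simp add: g_in f_g)

lemma g_subspace:
  assumes "int_module.subspace S" "S \<subseteq> W'"
  shows "int_module.subspace (g ` S)"
proof (rule int_subspaceI)
  show "0 \<in> g ` S" using int_module.subspace_0[OF assms(1)] g_zero by (metis imageI)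
  show "x + y \<in> g ` S" if xy: "x \<in> g ` S" "y \<in> g ` S" for x y
  proof -
    obtain u v where "u \<in> S" "v \<in> S" "x = g u" "y = g v" using xy by blast
    then show ?thesis
      using g_add[of u v] assms(2) int_module.subspace_add[OF assms(1), of u v] by (metis imageI subsetD)
  qed
  show "- x \<in> g ` S" if x: "x \<in> g ` S" for x
  proof -
    obtain u where "u \<in> S" "x = g u" using x by blast
    then show ?thesis
      using g_uminus[of u] assms(2) int_module.subspace_neg[OF assms(1), of u] by (metis imageI subsetD)
  qed
qed

text \<open>\<open>g\<close> is additive on \<open>W'\<close> only, so each inclusion comes from the
  minimality of a span, the second one through the preimage of a span under
  \<open>g\<close>.\<close>

lemma g_zspan:
  assumes "A \<subseteq> W'"
  shows "zspan (g ` A) = g ` zspan A"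
proof
  have sub: "zspan A \<subseteq> W'" using assms subspace_W' by (rule int_module.span_minimal)
  show "zspan (g ` A) \<subseteq> g ` zspan A"
    using g_subspace[OF int_module.subspace_span sub]
    by (intro int_module.span_minimal image_mono int_module.span_superset)
  have "zspan A \<subseteq> {y \<in> W'. g y \<in> zspan (g ` A)}"
  proof (rule int_module.span_minimal)
    show "A \<subseteq> {y \<in> W'. g y \<in> zspan (g ` A)}"
      using assms by (auto intro: int_module.span_base)
    show "int_module.subspace {y \<in> W'. g y \<in> zspan (g ` A)}"
    proof (rule int_subspaceI)
      show "0 \<in> {y \<in> W'. g y \<in> zspan (g ` A)}"
        using int_module.subspace_0[OF subspace_W'] g_zero by (simp add: int_module.span_zero)
      show "x + y \<in> {y \<in> W'. g y \<in> zspan (g ` A)}"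
        if "x \<in> {y \<in> W'. g y \<in> zspan (g ` A)}" "y \<in> {y \<in> W'. g y \<in> zspan (g ` A)}" for x y
        using that int_module.subspace_add[OF subspace_W'] by (simp add: g_add int_module.span_add)
      show "- x \<in> {y \<in> W'. g y \<in> zspan (g ` A)}" if "x \<in> {y \<in> W'. g y \<in> zspan (g ` A)}" for x
        using that int_module.subspace_neg[OF subspace_W'] by (simp add: g_uminus int_module.span_neg)
    qed
  qed
  then show "g ` zspan A \<subseteq> zspan (g ` A)" by blast
qed

lemma root_sublattice_g: "root_sublattice b W = g ` root_sublattice b' W'"
proof -
  have "{x \<in> W. b x x = -2} = g ` {x \<in> W'. b' x x = -2}"
  proof (intro equalityI subsetI)
    fix x assume "x \<in> {x \<in> W. b x x = -2}"
    then have "f x \<in> {x \<in> W'. b' x x = -2}" "x = g (f x)" by (simp_all add: f_in f_form g_f)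
    then show "x \<in> g ` {x \<in> W'. b' x x = -2}" by (rule image_eqI[rotated])
  qed (auto simp: g_in g_form)
  then show ?thesis
    unfolding root_sublattice_def by (simp only:) (rule g_zspan, blast)
qed

lemma root_embedding_g:
  assumes "root_embedding b' S ts vss" "S \<subseteq> W'"
  shows "root_embedding b (g ` S) ts (map (map g) vss)"
    and "embedding_image (map (map g) vss) = g ` embedding_image vss"
proof -
  have emb: "set (concat vss) \<subseteq> S" "list_all2 (simple_roots b') ts vss"
    "\<And>k l x y. k < length vss \<Longrightarrow> l < length vss \<Longrightarrow> k \<noteq> l \<Longrightarrow> x \<in> set (vss ! k) \<Longrightarrow> y \<in> set (vss ! l) \<Longrightarrow> b' x y = 0"
    using assms(1) unfolding root_embedding_def by blast+
  have W': "x \<in> W'" if "k < length vss" "x \<in> set (vss ! k)" for k x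
  proof -
    have "vss ! k \<in> set vss" using that by simp
    then have "x \<in> set (concat vss)" using that(2) by auto
    then show ?thesis using emb(1) assms(2) by blast
  qed
  have set: "set (concat (map (map g) vss)) = g ` set (concat vss)" by auto
  have "list_all2 (simple_roots b) ts (map (map g) vss)"
  proof (rule list_all2_all_nthI)
    show "length ts = length (map (map g) vss)" using emb(2) by (simp add: list_all2_lengthD)
    fix k assume k: "k < length ts"
    then have k': "k < length vss" using emb(2) by (simp add: list_all2_lengthD)
    have "simple_roots b' (ts ! k) (vss ! k)" using emb(2) k by (rule list_all2_nthD)
    then show "simple_roots b (ts ! k) (map (map g) vss ! k)"
      using W'[OF k'] k' by (simp add: simple_roots_def g_form)
  qed
  moreover have "set (concat (map (map g) vss)) \<subseteq> g ` S"
    unfolding set using emb(1) by (rule image_mono)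
  moreover have "b x y = 0" if "k < length vss" "l < length vss" "k \<noteq> l"
    "x \<in> set (map (map g) vss ! k)" "y \<in> set (map (map g) vss ! l)" for k l x y
  proof -
    have "x \<in> g ` set (vss ! k)" "y \<in> g ` set (vss ! l)" using that by simp_all
    then obtain u v where "u \<in> set (vss ! k)" "v \<in> set (vss ! l)" "x = g u" "y = g v" by blast
    then show ?thesis using emb(3)[OF that(1-3)] W' that(1,2) by (simp add: g_form)
  qed
  ultimately show "root_embedding b (g ` S) ts (map (map g) vss)"
    unfolding root_embedding_def length_map by blast
  show "embedding_image (map (map g) vss) = g ` embedding_image vss"
    unfolding embedding_image_def set using emb(1) assms(2) by (intro g_zspan) blast
qed

end

section \<open>Kodaira types from root types and Euler numbers\<close>

lemma D_in_fibre_root_types: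
  assumes "Dynkin_D (n + 4) \<in># \<Sum>\<^sub># (image_mset fibre_root_type fibres)"
  shows "Kod_I_star n \<in># fibres"
proof -
  obtain k where k: "k \<in># fibres" "Dynkin_D (n + 4) \<in># fibre_root_type k"
    using assms by (auto simp: in_Union_mset_iff)
  then have "k = Kod_I_star n" by (cases k) (auto split: if_splits)
  then show ?thesis using k by simp
qed

lemma A1_in_fibre_root_types:
  assumes "Dynkin_A 1 \<in># \<Sum>\<^sub># (image_mset fibre_root_type fibres)"
  shows "Kod_I 2 \<in># fibres \<or> Kod_III \<in># fibres"
proof -
  obtain k where k: "k \<in># fibres" "Dynkin_A 1 \<in># fibre_root_type k"
    using assms by (auto simp: in_Union_mset_iff)
  then have "k = Kod_I 2 \<or> k = Kod_III" by (cases k) (auto split: if_splits)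
  then show ?thesis using k by auto
qed

lemma euler_number_pos: "k \<noteq> Kod_I 0 \<Longrightarrow> 0 < euler_number k"
  by (cases k) auto

text \<open>The D components come from two fibres of type I_2^* and one of type I_0^*, with Euler
  numbers 8 + 8 + 6 = 22. The remaining 2 is too small for III and is used up by I_2, so no
  irreducible singular fibre is left.\<close>

lemma fibres_determined:
  assumes smooth: "Kod_I 0 \<notin># fibres"
    and types: "\<Sum>\<^sub># (image_mset fibre_root_type fibres) = {#Dynkin_A 1, Dynkin_D 4, Dynkin_D 6, Dynkin_D 6#}"
    and euler: "(\<Sum>k\<in>#fibres. euler_number k) = 24"
  shows "fibres = {#Kod_I 2, Kod_I_star 0, Kod_I_star 2, Kod_I_star 2#}"
proof -
  have "Kod_I_star 2 \<in># fibres" by (rule D_in_fibre_root_types) (simp add: types)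
  then obtain F1 where F1: "fibres = add_mset (Kod_I_star 2) F1" by (rule mset_add)
  then have t1: "\<Sum>\<^sub># (image_mset fibre_root_type F1) = {#Dynkin_A 1, Dynkin_D 4, Dynkin_D 6#}"
    using types by simp
  have "Kod_I_star 2 \<in># F1" by (rule D_in_fibre_root_types) (simp add: t1)
  then obtain F2 where F2: "F1 = add_mset (Kod_I_star 2) F2" by (rule mset_add)
  then have t2: "\<Sum>\<^sub># (image_mset fibre_root_type F2) = {#Dynkin_A 1, Dynkin_D 4#}"
    using t1 by simp
  have "Kod_I_star 0 \<in># F2" by (rule D_in_fibre_root_types) (simp add: t2)
  then obtain F3 where F3: "F2 = add_mset (Kod_I_star 0) F3" by (rule mset_add)
  then have t3: "\<Sum>\<^sub># (image_mset fibre_root_type F3) = {#Dynkin_A 1#}"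
    using t2 by simp
  have e3: "(\<Sum>k\<in>#F3. euler_number k) = 2" using euler by (simp add: F1 F2 F3)
  have "Kod_I 2 \<in># F3 \<or> Kod_III \<in># F3" by (rule A1_in_fibre_root_types) (simp add: t3)
  then have I2: "Kod_I 2 \<in># F3"
  proof
    assume "Kod_III \<in># F3"
    then obtain F4 where "F3 = add_mset Kod_III F4" by (rule mset_add)
    then show ?thesis using e3 by simp
  qed
  then obtain F4 where F4: "F3 = add_mset (Kod_I 2) F4" by (rule mset_add)
  then have e4: "(\<Sum>k\<in>#F4. euler_number k) = 0" using e3 by simp
  have "F4 = {#}"
  proof (rule ccontr)
    assume "F4 \<noteq> {#}"
    then obtain k where k: "k \<in># F4" by blast
    then obtain F5 where "F4 = add_mset k F5" by (rule mset_add)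
    moreover have "k \<noteq> Kod_I 0" using k smooth by (auto simp: F1 F2 F3 F4)
    ultimately show False using e4 euler_number_pos[of k] by simp
  qed
  then show ?thesis by (simp add: F1 F2 F3 F4)
qed

text \<open>Fibre diagrams begin with A_1, D_4 and E_6, as \<open>root_decomposition\<close>
  demands.\<close>

lemma fibre_root_types_irreducible:
  assumes "t \<in># \<Sum>\<^sub># (image_mset fibre_root_type fibres)"
  shows "irreducible_type t"
proof -
  obtain k where "t \<in># fibre_root_type k" using assms by (auto simp: in_Union_mset_iff)
  then show ?thesis by (cases k) (auto split: if_splits)
qed

lemma subspace_orth_compl:
  assumes "symmetric_form b" "int_module.subspace L"
  shows "int_module.subspace (orth_compl b L M)"
proof -
  interpret symmetric_form b by fact
  show ?thesis
    by (rule int_subspaceI)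
      (use assms(2) scale_left[of "-1"] in \<open>auto simp: orth_compl_def zero_left add_left
        int_module.subspace_0 int_module.subspace_add int_module.subspace_neg\<close>)
qed

text \<open>[1,1,1,1] already has a constant first component. Subtracting a root of D6 makes the
  last two coordinates of the second component opposite; axis 4 takes part so that the glue class is
  kept.\<close>

definition section_vec :: "real ^ 6 ^ 4" where
  "section_vec = glue_word 1 1 1 1 - in_copy 2 (axis 4 1 + axis 6 1)"

text \<open>Words with 0 in the first place give torsion. Of the parities in the copies 2 and 3 this
  vector has the first one odd, \<open>torsion_vec2\<close> the second.\<close>

definition torsion_vec1 :: "real ^ 6 ^ 4" where
  "torsion_vec1 = glue_word 0 1 2 3 - in_copy 2 (axis 4 1 + axis 6 1)"

definition torsion_vec2 :: "real ^ 6 ^ 4" where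
  "torsion_vec2 = glue_word 0 2 3 1"

text \<open>Twice the projection of \<open>section_vec\<close>, so that computations stay inside the
  lattice.\<close>

definition height_vec :: "real ^ 6 ^ 4" where
  "height_vec = in_copy 1 (\<chi> i. 1)"

lemma nth_section_vec: "section_vec $ 1 = (\<chi> i. 1/2)"
  "section_vec $ 2 = (\<chi> i. if i = 4 \<or> i = 6 then -1/2 else 1/2)"
  "section_vec $ 3 = (\<chi> i. 1/2)" "section_vec $ 4 = (\<chi> i. 1/2)"
  by (simp_all add: section_vec_def glue_word_nth glue_coords in_copy_nth vec_eq_iff axis_nth forall_6)

lemma nth_torsion_vec1: "torsion_vec1 $ 1 = 0"
  "torsion_vec1 $ 2 = (\<chi> i. if i = 4 \<or> i = 6 then -1/2 else 1/2)"
  "torsion_vec1 $ 3 = axis 1 1" "torsion_vec1 $ 4 = (\<chi> i. if i = 6 then -1/2 else 1/2)"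
  by (simp_all add: torsion_vec1_def glue_word_nth glue_coords in_copy_nth vec_eq_iff axis_nth forall_6)

lemma nth_torsion_vec2: "torsion_vec2 $ 1 = 0" "torsion_vec2 $ 2 = axis 1 1"
  "torsion_vec2 $ 3 = (\<chi> i. if i = 6 then -1/2 else 1/2)" "torsion_vec2 $ 4 = (\<chi> i. 1/2)"
  by (simp_all add: torsion_vec2_def glue_word_nth glue_coords)

lemma halves_D6_dual:
  "(\<And>i. v $ i = 1/2 \<or> v $ i = -1/2) \<Longrightarrow> v \<in> D6_dual"
proof -
  assume v: "\<And>i. v $ i = 1/2 \<or> v $ i = -1/2"
  have "2 * v $ i \<in> \<int>" for i using v[of i] by (elim disjE; simp only:; simp)
  moreover have "v $ i - v $ j \<in> \<int>" for i j using v[of i] v[of j] by (elim disjE; simp only:; simp)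
  ultimately show ?thesis by (simp add: D6_dual_def)
qed

lemma section_vec: "section_vec \<in> phi_perp" "half (section_vec $ 1) = 1" "half (section_vec $ 2) = 1" "half (section_vec $ 3) = 1"
proof -
  show half: "half (section_vec $ 1) = 1" "half (section_vec $ 2) = 1" "half (section_vec $ 3) = 1"
    by (simp_all add: nth_section_vec half_def)
  have "half (section_vec $ 4) = 1" "coord_sum (section_vec $ 1) = 3" "coord_sum (section_vec $ 2) = 1"
    "coord_sum (section_vec $ 3) = 3" "coord_sum (section_vec $ 4) = 3"
    by (simp_all add: nth_section_vec half_def coord_sum_def sum_6)
  moreover have "\<forall>k. section_vec $ k \<in> D6_dual"
    unfolding forall_4 nth_section_vec by (intro conjI halves_D6_dual) auto
  ultimately show "section_vec \<in> phi_perp"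
    using half by (simp add: phi_perp_iff niemeier_coords_def glue_code_def nth_section_vec)
qed

lemma axis_D6_dual: "axis i 1 \<in> D6_dual"
  by (auto simp: D6_dual_def axis_nth)

lemma torsion_vec1: "torsion_vec1 \<in> phi_perp" "half (torsion_vec1 $ 1) = 0" "half (torsion_vec1 $ 2) = 1" "half (torsion_vec1 $ 3) = 2"
proof -
  show half: "half (torsion_vec1 $ 1) = 0" "half (torsion_vec1 $ 2) = 1" "half (torsion_vec1 $ 3) = 2"
    by (simp_all add: nth_torsion_vec1 half_def axis_nth)
  have "half (torsion_vec1 $ 4) = 1" "coord_sum (torsion_vec1 $ 1) = 0" "coord_sum (torsion_vec1 $ 2) = 1"
    "coord_sum (torsion_vec1 $ 3) = 1" "coord_sum (torsion_vec1 $ 4) = 2"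
    by (simp_all add: nth_torsion_vec1 half_def coord_sum_def sum_6 axis_nth)
  moreover have "\<forall>k. torsion_vec1 $ k \<in> D6_dual"
    unfolding forall_4 nth_torsion_vec1
    by (intro conjI D6_dual_0 axis_D6_dual halves_D6_dual) auto
  ultimately show "torsion_vec1 \<in> phi_perp"
    using half by (simp add: phi_perp_iff niemeier_coords_def glue_code_def nth_torsion_vec1)
qed

lemma torsion_vec2: "torsion_vec2 \<in> phi_perp" "half (torsion_vec2 $ 1) = 0" "half (torsion_vec2 $ 2) = 2" "half (torsion_vec2 $ 3) = 1"
proof -
  show half: "half (torsion_vec2 $ 1) = 0" "half (torsion_vec2 $ 2) = 2" "half (torsion_vec2 $ 3) = 1"
    by (simp_all add: nth_torsion_vec2 half_def axis_nth)
  have "half (torsion_vec2 $ 4) = 1" "coord_sum (torsion_vec2 $ 1) = 0" "coord_sum (torsion_vec2 $ 2) = 1"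
    "coord_sum (torsion_vec2 $ 3) = 2" "coord_sum (torsion_vec2 $ 4) = 3"
    by (simp_all add: nth_torsion_vec2 half_def coord_sum_def sum_6 axis_nth)
  moreover have "\<forall>k. torsion_vec2 $ k \<in> D6_dual"
    unfolding forall_4 nth_torsion_vec2
    by (intro conjI D6_dual_0 axis_D6_dual halves_D6_dual) auto
  ultimately show "torsion_vec2 \<in> phi_perp"
    using half by (simp add: phi_perp_iff niemeier_coords_def glue_code_def nth_torsion_vec2 axis_nth)
qed

text \<open>The last two facts identify half of \<open>height_vec\<close> as the projection of
  \<open>section_vec\<close>; its norm is -6/4.\<close>

lemma height_vec: "height_vec \<in> phi_perp" "neg_form height_vec height_vec = -6"
  "section_vec + section_vec - height_vec \<in> phi_perp_root"
  "x \<in> phi_perp_root \<Longrightarrow> neg_form height_vec x = 0"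
proof -
  have half: "half (height_vec $ 1) = 2" "half (height_vec $ 2) = 0" "half (height_vec $ 3) = 0" "half (height_vec $ 4) = 0"
    and "coord_sum (height_vec $ 1) = 6" "coord_sum (height_vec $ 2) = 0" "coord_sum (height_vec $ 3) = 0" "coord_sum (height_vec $ 4) = 0"
    by (simp_all add: height_vec_def in_copy_nth half_def coord_sum_def)
  moreover have "\<forall>k. height_vec $ k \<in> D6_dual"
    unfolding forall_4 by (auto simp: height_vec_def in_copy_nth D6_dual_def)
  ultimately show hv: "height_vec \<in> phi_perp"
    by (simp add: phi_perp_iff niemeier_coords_def glue_code_def) (simp add: height_vec_def in_copy_nth)
  show "neg_form height_vec height_vec = -6"
    by (simp add: height_vec_def neg_form_in_copy inner_vec_sum)
  have mem: "section_vec + (- height_vec) \<in> phi_perp" "- height_vec \<in> phi_perp"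
    using hv section_vec(1) int_module.subspace_add[OF subspace_phi_perp] int_module.subspace_neg[OF subspace_phi_perp] by blast+
  have "half ((section_vec + (section_vec + (- height_vec))) $ k) =
      half (section_vec $ k) + (half (section_vec $ k) + - half (height_vec $ k))" for k
    by (simp only: phi_perp_half_add[OF section_vec(1) mem(1)] phi_perp_half_add[OF section_vec(1) mem(2)]
        phi_perp_half_uminus[OF hv])
  moreover have "section_vec + (section_vec + (- height_vec)) \<in> phi_perp"
    using mem section_vec(1) int_module.subspace_add[OF subspace_phi_perp] by blast
  ultimately have "section_vec + (section_vec + (- height_vec)) \<in> phi_perp_root"
    unfolding phi_perp_root_def mem_Collect_eq by (simp only: section_vec half) simp
  then show "section_vec + section_vec - height_vec \<in> phi_perp_root" by simp
  show "neg_form height_vec x = 0" if "x \<in> phi_perp_root"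
    using phi_perp_root_D6(1)[OF that] unfolding neg_form_def height_vec_def
    by (simp add: inner_commute[of "in_copy 1 _"] inner_in_copy_right)
qed

lemma phi_perp_root_even:
  assumes "x \<in> phi_perp_root"
  obtains m :: int where "neg_form x x = 2 * of_int m"
proof -
  have D6: "x $ k \<in> D6_root_lattice" for k using phi_perp_root_D6(2)[OF assms] .
  obtain m1 m2 m3 m4 :: int where "x $ 1 \<bullet> x $ 1 = 2 * of_int m1" "x $ 2 \<bullet> x $ 2 = 2 * of_int m2"
    "x $ 3 \<bullet> x $ 3 = 2 * of_int m3" "x $ 4 \<bullet> x $ 4 = 2 * of_int m4"
    using D6_root_lattice_norm_even[OF D6] by metis
  then have "neg_form x x = 2 * of_int (- (m1 + m2 + m3 + m4))"
    by (simp add: neg_form_def inner_four)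
  then show ?thesis by (rule that)
qed

section \<open>Transport to the frame of the fibration\<close>

theorem proposition2:
  fixes b :: "'v::real_vector \<Rightarrow> 'v \<Rightarrow> real"
    and H T NS W :: "'v set"
    and F Z :: 'v
    and fibres :: "kodaira multiset"
  assumes X: "K3_with_transcendental_6_2 b H T"
    and NS: "NS = neron_severi b H T"
    and fibration: "elliptic_fibration b NS F Z fibres"
    and derived: "derived_from b NS F Z neg_form niemeier_D6_4 phi"
    and W: "W = frame b NS F Z"
  shows
    "primitive_root_embedding neg_form niemeier_D6_4 [Dynkin_A 5, Dynkin_A 1] phi \<and>
     (\<forall>psi. primitive_root_embedding neg_form niemeier_D6_4 [Dynkin_A 5, Dynkin_A 1] psi \<longrightarrow>
        (\<exists>g. lattice_isometry neg_form niemeier_D6_4 neg_form niemeier_D6_4 g \<and>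
             psi = map (map g) phi)) \<and>
     has_root_type b (root_sublattice b W)
       {#Dynkin_A 1, Dynkin_D 4, Dynkin_D 6, Dynkin_D 6#} \<and>
     fibres = {#Kod_I 2, Kod_I_star 0, Kod_I_star 2, Kod_I_star 2#} \<and>
     has_rank (mordell_weil b W) 1 \<and>
     (mordell_weil b W)\<lparr>carrier := torsion_elements (mordell_weil b W)\<rparr>
       \<cong> integer_mod_group 2 \<times>\<times> integer_mod_group 2 \<and>
     (\<exists>w\<in>W. mw_class b W w \<notin> torsion_elements (mordell_weil b W) \<and>
        carrier (mordell_weil_lattice b W)
          = generate (mordell_weil_lattice b W) {mwl_class b W w} \<and>
        height_pairing b W w w = 3 / 2)"
proof -
  have lattice: "integral_lattice b H"
    using X by (simp add: K3_with_transcendental_6_2_def K3_lattice_def)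
  interpret form: symmetric_form b
    using lattice by (intro symmetric_form.intro) (simp_all add: integral_lattice_def)
  have "int_module.subspace H"
    using lattice int_module.subspace_span by (auto simp: integral_lattice_def)
  then have subspace_W: "int_module.subspace W"
    unfolding W frame_def NS neron_severi_def by (intro subspace_orth_compl form.symmetric_form_axioms)
  obtain f where f: "lattice_isometry b W neg_form phi_perp f"
    using derived by (auto simp: derived_from_def W phi_perp_def)
  interpret isometric_lattices b W neg_form phi_perp f
    by unfold_locales (rule f subspace_W subspace_phi_perp)+
  let ?R = "root_sublattice b W"
  have R: "?R = g ` phi_perp_root"
    by (simp add: root_sublattice_g root_sublattice_phi_perp)
  have root_le: "phi_perp_root \<subseteq> phi_perp" by (auto simp: phi_perp_root_def)
  have R_iff: "x \<in> ?R \<longleftrightarrow> x \<in> W \<and> f x \<in> phi_perp_root" for x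
    using root_le g_in f_g g_f unfolding R by (metis (no_types, lifting) image_iff subsetD)
  have form_f: "b x x = neg_form (f x) (f x)" if "x \<in> ?R" for x
    using that R_iff f_form by simp
  have subspace_R: "int_module.subspace ?R"
    unfolding root_sublattice_def by (rule int_module.subspace_span)

  \<comment> \<open>Definiteness and evenness come from the Niemeier side, where the form is minus
    the Euclidean product.\<close>
  interpret definite_lattice b ?R
  proof
    show "int_module.subspace ?R" by (rule subspace_R)
    fix x assume x: "x \<in> ?R"
    show "b x x \<le> 0" using form_f[OF x] by (simp add: neg_form_def)
    show "\<exists>m::int. b x x = 2 * of_int m"
      using form_f[OF x] phi_perp_root_even[of "f x"] x R_iff by metis
    assume "b x x = 0"
    then have "f x = 0" using form_f[OF x] by (simp add: neg_form_def)
    then show "x = 0" using g_f[of x] g_zero x R_iff by simp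
  qed

  have emb: "root_embedding b ?R [Dynkin_A 1, Dynkin_D 4, Dynkin_D 6, Dynkin_D 6] (map (map g) phi_perp_roots)"
    and im: "embedding_image (map (map g) phi_perp_roots) = ?R"
    using root_embedding_g[OF root_embedding_phi_perp root_le] by (simp_all add: R root_sublattice_phi_perp)
  then have type: "has_root_type b ?R {#Dynkin_A 1, Dynkin_D 4, Dynkin_D 6, Dynkin_D 6#}"
    unfolding has_root_type_def by (intro exI conjI) simp_all
  have D2: "root_decomposition [Dynkin_A 1, Dynkin_D 4, Dynkin_D 6, Dynkin_D 6] (map (map g) phi_perp_roots)"
    using emb im by (simp add: root_decomposition_def)

  have fibres: "fibres = {#Kod_I 2, Kod_I_star 0, Kod_I_star 2, Kod_I_star 2#}"
  proof (rule fibres_determined)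
    show "Kod_I 0 \<notin># fibres" "(\<Sum>k\<in>#fibres. euler_number k) = 24"
      using fibration by (simp_all add: elliptic_fibration_def)
    \<comment> \<open>The hypothesis provides some decomposition with the types of the fibres;
      comparison with the explicit one determines these types.\<close>
    obtain ts vss where ts: "mset ts = \<Sum>\<^sub># (image_mset fibre_root_type fibres)"
      "root_embedding b ?R ts vss" "embedding_image vss = ?R"
      using fibration unfolding elliptic_fibration_def has_root_type_def W by blast
    have "\<forall>t\<in>set ts. irreducible_type t"
      using fibre_root_types_irreducible ts(1) by (metis set_mset_mset)
    then have "root_decomposition ts vss"
      using ts by (simp add: root_decomposition_def)
    then have "mset ts = mset [Dynkin_A 1, Dynkin_D 4, Dynkin_D 6, Dynkin_D 6]"
      using D2 by (rule root_type_unique) auto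
    then show "\<Sum>\<^sub># (image_mset fibre_root_type fibres) = {#Dynkin_A 1, Dynkin_D 4, Dynkin_D 6, Dynkin_D 6#}"
      using ts(1) by simp
  qed

  \<comment> \<open>Of \<open>section_vec\<close> only the value 1 of the first coordinate is asked;
    its two parities are odd.\<close>
  interpret mw: lattice_coordinates W ?R "\<lambda>x. half (f x $ 1)" "\<lambda>x. half (f x $ 2)" "\<lambda>x. half (f x $ 3)"
    "g section_vec" "g torsion_vec1" "g torsion_vec2"
  proof
    show "?R \<subseteq> W" using R_iff by blast
    show "?R = {x \<in> W. half (f x $ 1) = 0 \<and> even (half (f x $ 2)) \<and> even (half (f x $ 3))}"
      using R_iff f_in by (auto simp: phi_perp_root_def)
  qed (simp_all only: subspace_W subspace_R f_add f_in phi_perp_half_add g_in f_g section_vec torsion_vec1 torsion_vec2,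
      simp_all)

  have w: "g section_vec \<in> W" by (rule mw.w(1))
  have height: "height_pairing b W (g section_vec) (g section_vec) = 3 / 2"
  proof -
    let ?u = "g height_vec"
    have u: "?u \<in> W" using height_vec(1) by (rule g_in)
    have "root_orth_proj b W (g section_vec) = (1/2) *\<^sub>R ?u"
    proof (rule root_orth_proj_eq[OF form.linear_b form.sym definite])
      show "(1/2) *\<^sub>R ?u \<in> orth_compl b (rational_hull W) ?R"
      proof -
        have "(1/2) *\<^sub>R ?u \<in> rational_hull W"
          using u by (auto simp: rational_hull_def intro!: exI[of _ 2])
        moreover have "b ?u y = 0" if y: "y \<in> ?R" for y
        proof -
          obtain z where z: "z \<in> phi_perp_root" "y = g z" using y R by blast
          then show ?thesis using g_form[OF height_vec(1), of z] height_vec(4)[OF z(1)] root_le by auto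
        qed
        ultimately show ?thesis by (simp add: orth_compl_def form.scale_left)
      qed
      have "g (section_vec + section_vec - height_vec) \<in> ?R" unfolding R using height_vec(3) by (rule imageI)
      \<comment> \<open>The factor 2 is the denominator that puts the difference into the rational
        hull of the root sublattice.\<close>
      moreover have "g (section_vec + section_vec - height_vec) = 2 *\<^sub>R (g section_vec - (1/2) *\<^sub>R ?u)"
      proof -
        have "section_vec + section_vec \<in> phi_perp" "- height_vec \<in> phi_perp"
          using section_vec(1) height_vec(1) int_module.subspace_add[OF subspace_phi_perp]
            int_module.subspace_neg[OF subspace_phi_perp] by blast+
        then have "g (section_vec + section_vec + - height_vec) = g section_vec + g section_vec + - ?u"
          using section_vec(1) height_vec(1) by (simp only: g_add g_uminus)
        then show ?thesis by (simp add: algebra_simps scaleR_2)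
      qed
      ultimately show "g section_vec - (1/2) *\<^sub>R ?u \<in> rational_hull ?R"
        unfolding rational_hull_def by (intro CollectI exI[of _ 2]) simp
    qed
    moreover have "b ?u ?u = -6" using g_form[OF height_vec(1) height_vec(1)] height_vec(2) by simp
    ultimately show ?thesis by (simp add: height_pairing_def form.scale_left form.scale_right)
  qed

  have "\<exists>w\<in>W. mw_class b W w \<notin> torsion_elements (mordell_weil b W) \<and>
        carrier (mordell_weil_lattice b W)
          = generate (mordell_weil_lattice b W) {mwl_class b W w} \<and>
        height_pairing b W w w = 3 / 2"
    using mw.w_not_torsion mw.generate_mod_P height
    by (intro bexI[OF _ w] conjI)
      (simp_all add: mw_class_def mordell_weil_def mwl_class_def mordell_weil_lattice_def mw.primitive_closure_R)
  moreover have "primitive_root_embedding neg_form niemeier_D6_4 [Dynkin_A 5, Dynkin_A 1] phi"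
    using root_embedding_phi primitive_phi by (simp add: primitive_root_embedding_def)
  moreover have "\<forall>psi. primitive_root_embedding neg_form niemeier_D6_4 [Dynkin_A 5, Dynkin_A 1] psi \<longrightarrow>
        (\<exists>g. lattice_isometry neg_form niemeier_D6_4 neg_form niemeier_D6_4 g \<and> psi = map (map g) phi)"
    using embedding_unique by (simp add: primitive_root_embedding_def)
  moreover have "has_rank (mordell_weil b W) 1"
    using mw.has_rank_Q by (simp add: mordell_weil_def)
  moreover have "(mordell_weil b W)\<lparr>carrier := torsion_elements (mordell_weil b W)\<rparr>
       \<cong> integer_mod_group 2 \<times>\<times> integer_mod_group 2"
    using mw.torsion_iso by (simp add: mordell_weil_def)
  ultimately show ?thesis using type fibres by blast
qed

end
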